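(* Let $(\mathcal{A},\phi)$ be a $W^*$-probability space with a non-degenerated normal state such that $\mathcal{A}$ is generated by a bilateral sequence $(x_i)_{i\in\mathbb{Z}}$ of selfadjoint random variables, the unit of $\mathcal{A}$ being contained in the WOT-closure of the non-unital algebra generated by $(x_i)_{i\in\mathbb{Z}}$, and such that $(x_i)_{i\in\mathbb{Z}}$ is boolean spreadable. Then the positive tail algebra $\mathcal{A}^+_{tail}$ and the negative tail algebra $\mathcal{A}^-_{tail}$ of $(x_i)_{i\in\mathbb{Z}}$ are the same.
   Context: **Non-degenerated normal state.** $\mathcal{A}$ is a von Neumann algebra and $\phi$ a normal state such that $x=0$ whenever $\phi(axb)=0$ for all $a,b\in\mathcal{A}$ ($\phi$ is not assumed faithful). The GNS representation of $\phi$ is then faithful; $\mathcal{A}$ is identified with its image, and WOT refers to it. **Boolean spreadability.** $\mathbb{C}\langle X_1,\dots,X_n\rangle$ is the algebra of noncommutative polynomials. The joint distribution of $x_1,\dots,x_n\in\mathcal{A}$ is $\mu_{x_1,\dots,x_n}(p)=\phi(p(x_1,\dots,x_n))$. For $k\le n$ in $\mathbb{N}$, $B_i(n,k)$ is the universal unital $C^*$-algebra generated by elements $u_{i,j}$ ($1\le i\le n$, $1\le j\le k$) and a projection $\mathbf{P}$ such that: (1) each $u_{i,j}$ is an orthogonal projection; (2) $\sum_{i=1}^nu_{i,j}\mathbf{P}=\mathbf{P}$ for $1\le j\le k$; (3) $u_{i,j}u_{i',j'}=0$ if $j<j'$ and $i\ge i'$. Let $\alpha^{(b)}_{n,k}:\mathbb{C}\langle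 X_1,\dots,X_k\rangle\to\mathbb{C}\langle X_1,\dots,X_n\rangle\otimes B_i(n,k)$ be the unital homomorphism with $X_j\mapsto\sum_{i=1}^nX_i\otimes u_{i,j}$. The sequence $(x_1,\dots,x_n)$ is boolean spreadable if for all $k=1,\dots,n-1$ and all $p\in\mathbb{C}\langle X_1,\dots,X_k\rangle$, $\mu_{x_1,\dots,x_n}(p)\mathbf{P}=\mathbf{P}\,\big[(\mu_{x_1,\dots,x_n}\otimes id)(\alpha^{(b)}_{n,k}(p))\big]\,\mathbf{P}$. A sequence indexed by an ordered infinite set is boolean spreadable if all its finite subsequences $(x_{i_1},\dots,x_{i_l})$, $i_1<\dots<i_l$, are. **Tail algebras.** Let $\mathcal{A}^+_k$ (resp. $\mathcal{A}^-_k$) be the WOT-closure of the non-unital algebra generated by $\{x_i:i\ge k\}$ (resp. $\{x_i:i\le k\}$). The positive tail algebra is $\mathcal{A}^+_{tail}=\bigcap_{k>0}\mathcal{A}^+_k$ and the negative tail algebra is $\mathcal{A}^-_{tail}=\bigcap_{k<0}\mathcal{A}^-_k$. *)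

theory Defs
  imports
    "HOL-Analysis.Analysis"
    "HOL-Library.Poly_Mapping"
    "HOL-Algebra.Module"
begin

section \<open>Complex Hilbert spaces and operators\<close>

class complex_normed_vector = real_normed_vector +
  fixes scaleC :: "complex \<Rightarrow> 'a \<Rightarrow> 'a" (infixr \<open>*\<^sub>C\<close> 75)
  assumes scaleC_add_right: "c *\<^sub>C (x + y) = c *\<^sub>C x + c *\<^sub>C y"
    and scaleC_add_left: "(c + d) *\<^sub>C x = c *\<^sub>C x + d *\<^sub>C x"
    and scaleC_scaleC: "c *\<^sub>C d *\<^sub>C x = (c * d) *\<^sub>C x"
    and scaleC_of_real: "complex_of_real r *\<^sub>C x = r *\<^sub>R x"
    and norm_scaleC: "norm (c *\<^sub>C x) = cmod c * norm x"

text \<open>The inner product is conjugate-linear in the first argument.\<close>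

class complex_inner = complex_normed_vector +
  fixes cinner :: "'a \<Rightarrow> 'a \<Rightarrow> complex"
  assumes cinner_commute: "cinner x y = cnj (cinner y x)"
    and cinner_add_right: "cinner x (y + z) = cinner x y + cinner x z"
    and cinner_scaleC_right: "cinner x (c *\<^sub>C y) = c * cinner x y"
    and cinner_self: "cinner x x = complex_of_real ((norm x)\<^sup>2)"

class chilbert_space = complex_inner + complete_space

instantiation complex :: chilbert_space
begin

definition scaleC_complex :: "complex \<Rightarrow> complex \<Rightarrow> complex"
  where "scaleC_complex c z = c * z"

definition cinner_complex :: "complex \<Rightarrow> complex \<Rightarrow> complex"
  where "cinner_complex w z = cnj w * z"

instance
proof
  fix c d x y z :: complex and r :: real
  show "c *\<^sub>C (x + y) = c *\<^sub>C x + c *\<^sub>C y" "(c + d) *\<^sub>C x = c *\<^sub>C x + d *\<^sub>C x"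
    "c *\<^sub>C d *\<^sub>C x = (c * d) *\<^sub>C x" "norm (c *\<^sub>C x) = cmod c * norm x"
    by (simp_all add: scaleC_complex_def norm_mult distrib_left distrib_right mult.assoc)
  show "complex_of_real r *\<^sub>C x = r *\<^sub>R x"
    by (simp only: scaleC_complex_def scaleR_conv_of_real)
  show "cinner x y = cnj (cinner y x)"
    by (simp add: cinner_complex_def mult.commute)
  show "cinner x (y + z) = cinner x y + cinner x z"
    by (simp add: cinner_complex_def distrib_left)
  show "cinner x (c *\<^sub>C y) = c * cinner x y"
    by (simp add: cinner_complex_def scaleC_complex_def mult.left_commute)
  show "cinner x x = complex_of_real ((norm x)\<^sup>2)"
    by (simp only: cinner_complex_def complex_norm_square mult.commute)
qed

end

instantiation blinfun :: (real_normed_vector, complex_normed_vector) complex_normed_vector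
begin

lift_definition scaleC_blinfun :: "complex \<Rightarrow> 'a \<Rightarrow>\<^sub>L 'b \<Rightarrow> 'a \<Rightarrow>\<^sub>L 'b"
  is "\<lambda>c f x. c *\<^sub>C f x"
proof -
  fix c :: complex and f :: "'a \<Rightarrow> 'b"
  assume "bounded_linear f"
  then interpret bounded_linear f .
  obtain K where K: "norm (f x) \<le> norm x * K" for x
    using bounded by blast
  show "bounded_linear (\<lambda>x. c *\<^sub>C f x)"
  proof (rule bounded_linear_intro[where K = "cmod c * K"])
    show "c *\<^sub>C f (x + y) = c *\<^sub>C f x + c *\<^sub>C f y" for x y
      by (simp only: add scaleC_add_right)
    show "c *\<^sub>C f (r *\<^sub>R x) = r *\<^sub>R c *\<^sub>C f x" for r x
      by (simp only: scaleR scaleC_of_real[symmetric] scaleC_scaleC mult.commute)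
    show "norm (c *\<^sub>C f x) \<le> norm x * (cmod c * K)" for x
      using mult_left_mono[OF K[of x], of "cmod c"] by (simp add: norm_scaleC mult.left_commute)
  qed
qed

instance
proof
  fix c d :: complex and r :: real and f g :: "'a \<Rightarrow>\<^sub>L 'b"
  show "c *\<^sub>C (f + g) = c *\<^sub>C f + c *\<^sub>C g"
    by (rule blinfun_eqI) (simp add: scaleC_blinfun.rep_eq plus_blinfun.rep_eq scaleC_add_right)
  show "(c + d) *\<^sub>C f = c *\<^sub>C f + d *\<^sub>C f"
    by (rule blinfun_eqI) (simp add: scaleC_blinfun.rep_eq plus_blinfun.rep_eq scaleC_add_left)
  show "c *\<^sub>C d *\<^sub>C f = (c * d) *\<^sub>C f"
    by (rule blinfun_eqI) (simp add: scaleC_blinfun.rep_eq scaleC_scaleC)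
  show "complex_of_real r *\<^sub>C f = r *\<^sub>R f"
    by (rule blinfun_eqI) (simp add: scaleC_blinfun.rep_eq scaleR_blinfun.rep_eq scaleC_of_real)
  have le: "norm (a *\<^sub>C h) \<le> cmod a * norm h" for a and h :: "'a \<Rightarrow>\<^sub>L 'b"
  proof (rule norm_blinfun_bound)
    show "norm (blinfun_apply (a *\<^sub>C h) x) \<le> cmod a * norm h * norm x" for x
      using mult_left_mono[OF norm_blinfun[of h x], of "cmod a"]
      by (simp add: scaleC_blinfun.rep_eq norm_scaleC mult.assoc)
  qed simp
  show "norm (c *\<^sub>C f) = cmod c * norm f"
  proof (cases "c = 0")
    case True
    then show ?thesis using le[of c f] by simp
  next
    case False
    have "inverse c *\<^sub>C c *\<^sub>C f = f"
      using False by (intro blinfun_eqI)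
        (simp add: scaleC_blinfun.rep_eq scaleC_scaleC scaleC_of_real[of 1, simplified])
    with le[of "inverse c" "c *\<^sub>C f"] have "norm f \<le> inverse (cmod c) * norm (c *\<^sub>C f)"
      by (simp add: norm_inverse)
    with False have "cmod c * norm f \<le> norm (c *\<^sub>C f)"
      by (simp add: field_simps)
    with le[of c f] show ?thesis by simp
  qed
qed

end

text \<open>The type of \<open>blinfun\<close> contains all bounded real-linear maps.\<close>

definition cbounded_ops :: "('h::chilbert_space \<Rightarrow>\<^sub>L 'h) set"
  where "cbounded_ops = {a. \<forall>c x. blinfun_apply a (c *\<^sub>C x) = c *\<^sub>C blinfun_apply a x}"

definition is_adjoint :: "('h::chilbert_space \<Rightarrow>\<^sub>L 'h) \<Rightarrow> ('h \<Rightarrow>\<^sub>L 'h) \<Rightarrow> bool"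
  where "is_adjoint a b \<longleftrightarrow>
    (\<forall>x y. cinner (blinfun_apply a x) y = cinner x (blinfun_apply b y))"

abbreviation selfadjoint_op :: "('h::chilbert_space \<Rightarrow>\<^sub>L 'h) \<Rightarrow> bool"
  where "selfadjoint_op a \<equiv> is_adjoint a a"

definition weak_operator_topology :: "('h::chilbert_space \<Rightarrow>\<^sub>L 'h) topology"
  where "weak_operator_topology =
    pullback_topology UNIV (\<lambda>a (x, y). cinner x (blinfun_apply a y)) euclidean"

definition von_neumann_algebra :: "('h::chilbert_space \<Rightarrow>\<^sub>L 'h) set \<Rightarrow> bool"
  where "von_neumann_algebra A \<longleftrightarrow>
    A \<subseteq> cbounded_ops \<and> id_blinfun \<in> A \<and>
    (\<forall>a\<in>A. \<forall>b\<in>A. a + b \<in> A \<and> a o\<^sub>L b \<in> A) \<and>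
    (\<forall>c. \<forall>a\<in>A. c *\<^sub>C a \<in> A) \<and>
    (\<forall>a\<in>A. \<exists>b\<in>A. is_adjoint a b) \<and>
    closedin weak_operator_topology A"

definition vN_generated :: "('h::chilbert_space \<Rightarrow>\<^sub>L 'h) set \<Rightarrow> ('h \<Rightarrow>\<^sub>L 'h) set"
  where "vN_generated S = \<Inter>{M. von_neumann_algebra M \<and> S \<subseteq> M}"

inductive_set nonunital_algebra :: "('h::chilbert_space \<Rightarrow>\<^sub>L 'h) set \<Rightarrow> ('h \<Rightarrow>\<^sub>L 'h) set"
  for S where
  zero: "0 \<in> nonunital_algebra S"
| gen: "a \<in> S \<Longrightarrow> a \<in> nonunital_algebra S"
| add: "a \<in> nonunital_algebra S \<Longrightarrow> b \<in> nonunital_algebra S \<Longrightarrow> a + b \<in> nonunital_algebra S"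
| scale: "a \<in> nonunital_algebra S \<Longrightarrow> c *\<^sub>C a \<in> nonunital_algebra S"
| mult: "a \<in> nonunital_algebra S \<Longrightarrow> b \<in> nonunital_algebra S \<Longrightarrow> a o\<^sub>L b \<in> nonunital_algebra S"


section \<open>Normal states and the GNS representation\<close>

text \<open>Only the values of a state on the algebra matter.\<close>

definition state_on :: "('h::chilbert_space \<Rightarrow>\<^sub>L 'h) set \<Rightarrow> (('h \<Rightarrow>\<^sub>L 'h) \<Rightarrow> complex) \<Rightarrow> bool"
  where "state_on A \<phi> \<longleftrightarrow>
    (\<forall>a\<in>A. \<forall>b\<in>A. \<phi> (a + b) = \<phi> a + \<phi> b) \<and>
    (\<forall>c. \<forall>a\<in>A. \<phi> (c *\<^sub>C a) = c * \<phi> a) \<and>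
    (\<forall>a\<in>A. \<forall>b\<in>A. is_adjoint a b \<longrightarrow> \<phi> (b o\<^sub>L a) \<in> \<real>\<^sub>\<ge>\<^sub>0) \<and>
    \<phi> id_blinfun = 1"

definition op_le :: "('h::chilbert_space \<Rightarrow>\<^sub>L 'h) \<Rightarrow> ('h \<Rightarrow>\<^sub>L 'h) \<Rightarrow> bool"
  where "op_le a b \<longleftrightarrow>
    (\<forall>x. Re (cinner x (blinfun_apply a x)) \<le> Re (cinner x (blinfun_apply b x)))"

text \<open>A state is normal if it preserves the least upper bounds of increasing nets of selfadjoint
  elements, here expressed by upward directed sets.\<close>

definition normal_state_on ::
  "('h::chilbert_space \<Rightarrow>\<^sub>L 'h) set \<Rightarrow> (('h \<Rightarrow>\<^sub>L 'h) \<Rightarrow> complex) \<Rightarrow> bool"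
  where "normal_state_on A \<phi> \<longleftrightarrow> state_on A \<phi> \<and>
    (\<forall>D s. let Asa = {a \<in> A. selfadjoint_op a} in
      D \<noteq> {} \<and> D \<subseteq> Asa \<and> (\<forall>a\<in>D. \<forall>b\<in>D. \<exists>c\<in>D. op_le a c \<and> op_le b c) \<and>
      s \<in> Asa \<and> (\<forall>a\<in>D. op_le a s) \<and> (\<forall>t\<in>Asa. (\<forall>a\<in>D. op_le a t) \<longrightarrow> op_le s t)
      \<longrightarrow> Re (\<phi> s) = (SUP a\<in>D. Re (\<phi> a)))"

definition nondegenerated ::
  "('h::chilbert_space \<Rightarrow>\<^sub>L 'h) set \<Rightarrow> (('h \<Rightarrow>\<^sub>L 'h) \<Rightarrow> complex) \<Rightarrow> bool"
  where "nondegenerated A \<phi> \<longleftrightarrow>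
    (\<forall>x\<in>A. (\<forall>a\<in>A. \<forall>b\<in>A. \<phi> (a o\<^sub>L x o\<^sub>L b) = 0) \<longrightarrow> x = 0)"

text \<open>The GNS representation is determined by the following conditions up to unitary equivalence:
  a unital *-representation on a Hilbert space, with a cyclic vector implementing the state.\<close>

definition GNS_representation ::
  "('h::chilbert_space \<Rightarrow>\<^sub>L 'h) set \<Rightarrow> (('h \<Rightarrow>\<^sub>L 'h) \<Rightarrow> complex) \<Rightarrow>
    (('h \<Rightarrow>\<^sub>L 'h) \<Rightarrow> ('k::chilbert_space \<Rightarrow>\<^sub>L 'k)) \<Rightarrow> 'k \<Rightarrow> bool"
  where "GNS_representation A \<phi> \<pi> \<xi> \<longleftrightarrow>
    \<pi> ` A \<subseteq> cbounded_ops \<and> \<pi> id_blinfun = id_blinfun \<and>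
    (\<forall>a\<in>A. \<forall>b\<in>A. \<pi> (a + b) = \<pi> a + \<pi> b \<and> \<pi> (a o\<^sub>L b) = \<pi> a o\<^sub>L \<pi> b) \<and>
    (\<forall>c. \<forall>a\<in>A. \<pi> (c *\<^sub>C a) = c *\<^sub>C \<pi> a) \<and>
    (\<forall>a\<in>A. \<forall>b\<in>A. is_adjoint a b \<longrightarrow> is_adjoint (\<pi> a) (\<pi> b)) \<and>
    closure ((\<lambda>a. blinfun_apply (\<pi> a) \<xi>) ` A) = UNIV \<and>
    (\<forall>a\<in>A. \<phi> a = cinner \<xi> (blinfun_apply (\<pi> a) \<xi>))"


section \<open>Noncommutative polynomials\<close>

text \<open>Words form the free monoid, so that \<open>'v list \<Rightarrow>\<^sub>0 complex\<close> is the free algebra on \<open>'v\<close>.\<close>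

instantiation list :: (type) monoid_add
begin

definition zero_list :: "'a list" where "zero_list = []"

definition plus_list :: "'a list \<Rightarrow> 'a list \<Rightarrow> 'a list" where "plus_list v w = v @ w"

instance by standard (simp_all add: zero_list_def plus_list_def)

end

text \<open>The polynomials in the indeterminates with indices \<open>1, \<dots>, n\<close>.\<close>

definition ncpolys :: "nat \<Rightarrow> (nat list \<Rightarrow>\<^sub>0 complex) set"
  where "ncpolys n = {p. \<forall>w\<in>Poly_Mapping.keys p. set w \<subseteq> {1..n}}"

text \<open>The unital homomorphism from noncommutative polynomials to a complex algebra \<open>M\<close>, given by
  \<open>X\<^sub>j \<mapsto> f j\<close>.\<close>

definition ncpoly_eval ::
  "(complex, 'b, 'm) module_scheme \<Rightarrow> ('v \<Rightarrow> 'b) \<Rightarrow> ('v list \<Rightarrow>\<^sub>0 complex) \<Rightarrow> 'b"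
  where "ncpoly_eval M f p =
    (\<Oplus>\<^bsub>M\<^esub>w\<in>Poly_Mapping.keys p.
      Poly_Mapping.lookup p w \<odot>\<^bsub>M\<^esub> foldr (\<lambda>v b. f v \<otimes>\<^bsub>M\<^esub> b) w \<one>\<^bsub>M\<^esub>)"

definition op_algebra :: "(complex, 'h::chilbert_space \<Rightarrow>\<^sub>L 'h) module"
  where "op_algebra = \<lparr>carrier = cbounded_ops, monoid.mult = (o\<^sub>L), one = id_blinfun,
    zero = 0, add = (+), smult = (*\<^sub>C)\<rparr>"

definition joint_distribution ::
  "(('h::chilbert_space \<Rightarrow>\<^sub>L 'h) \<Rightarrow> complex) \<Rightarrow> (nat \<Rightarrow> ('h \<Rightarrow>\<^sub>L 'h)) \<Rightarrow>
    (nat list \<Rightarrow>\<^sub>0 complex) \<Rightarrow> complex"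
  where "joint_distribution \<phi> x p = \<phi> (ncpoly_eval op_algebra x p)"

text \<open>The algebraic tensor product of the polynomials in \<open>X\<^sub>1, \<dots>, X\<^sub>n\<close> with an algebra \<open>B\<close>. As
  the words are a basis of the polynomials, its elements have a unique expression
  \<open>\<Sum>\<^sub>w w \<otimes> f w\<close> with a finitely supported family of coefficients \<open>f w \<in> B\<close>, by which they are
  represented.\<close>

definition ncpoly_tensor ::
  "nat \<Rightarrow> (complex, 'b, 'm) module_scheme \<Rightarrow> (complex, nat list \<Rightarrow> 'b) module"
  where "ncpoly_tensor n B = \<lparr>
    carrier = {f. range f \<subseteq> carrier B \<and> finite {w. f w \<noteq> \<zero>\<^bsub>B\<^esub>} \<and>
      (\<forall>w. f w \<noteq> \<zero>\<^bsub>B\<^esub> \<longrightarrow> set w \<subseteq> {1..n})},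
    monoid.mult = (\<lambda>f g w. \<Oplus>\<^bsub>B\<^esub>r\<in>{..length w}. f (take r w) \<otimes>\<^bsub>B\<^esub> g (drop r w)),
    one = (\<lambda>w. if w = [] then \<one>\<^bsub>B\<^esub> else \<zero>\<^bsub>B\<^esub>),
    zero = (\<lambda>w. \<zero>\<^bsub>B\<^esub>),
    add = (\<lambda>f g w. f w \<oplus>\<^bsub>B\<^esub> g w),
    smult = (\<lambda>c f w. c \<odot>\<^bsub>B\<^esub> f w)\<rparr>"

text \<open>The elementary tensor \<open>v \<otimes> b\<close> of a word and an element of \<open>B\<close>.\<close>

definition word_tensor ::
  "(complex, 'b, 'm) module_scheme \<Rightarrow> nat list \<Rightarrow> 'b \<Rightarrow> nat list \<Rightarrow> 'b"
  where "word_tensor B v b = (\<lambda>w. if w = v then b else \<zero>\<^bsub>B\<^esub>)"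

text \<open>The map \<open>\<mu> \<otimes> id\<close> on this tensor product, for a linear functional \<open>\<mu>\<close>.\<close>

definition tensor_id ::
  "(complex, 'b, 'm) module_scheme \<Rightarrow> ((nat list \<Rightarrow>\<^sub>0 complex) \<Rightarrow> complex) \<Rightarrow>
    (nat list \<Rightarrow> 'b) \<Rightarrow> 'b"
  where "tensor_id B \<mu> f =
    (\<Oplus>\<^bsub>B\<^esub>w\<in>{w. f w \<noteq> \<zero>\<^bsub>B\<^esub>}. \<mu> (Poly_Mapping.single w 1) \<odot>\<^bsub>B\<^esub> f w)"


section \<open>Universal unital C*-algebras\<close>

text \<open>Polynomials in the letters \<open>(g, False)\<close> and \<open>(g, True)\<close>, which stand for a generator \<open>g\<close>
  and its adjoint: the free unital *-algebra.\<close>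

type_synonym 'g free_star = "('g \<times> bool) list \<Rightarrow>\<^sub>0 complex"

definition free_gen :: "'g \<Rightarrow> 'g free_star"
  where "free_gen g = Poly_Mapping.single [(g, False)] 1"

definition free_scale :: "complex \<Rightarrow> 'g free_star \<Rightarrow> 'g free_star"
  where "free_scale c x = Poly_Mapping.single 0 c * x"

definition free_adj :: "'g free_star \<Rightarrow> 'g free_star"
  where "free_adj x = (\<Sum>w\<in>Poly_Mapping.keys x.
    Poly_Mapping.single (rev (map (apsnd Not) w)) (cnj (Poly_Mapping.lookup x w)))"

definition free_star_algebra :: "'g set \<Rightarrow> 'g free_star set"
  where "free_star_algebra G = {x. \<forall>w\<in>Poly_Mapping.keys x. fst ` set w \<subseteq> G}"

definition cstar_seminorm :: "'g set \<Rightarrow> ('g free_star \<Rightarrow> real) \<Rightarrow> bool"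
  where "cstar_seminorm G p \<longleftrightarrow>
    (\<forall>x\<in>free_star_algebra G. 0 \<le> p x \<and> p (free_adj x * x) = (p x)\<^sup>2 \<and>
      (\<forall>c. p (free_scale c x) = cmod c * p x) \<and>
      (\<forall>y\<in>free_star_algebra G. p (x + y) \<le> p x + p y \<and> p (x * y) \<le> p x * p y))"

text \<open>The norm of the universal C*-algebra with generators \<open>G\<close> and relations \<open>r = 0\<close> for \<open>r \<in> R\<close>.
  C*-seminorms vanishing on \<open>R\<close> are the seminorms \<open>x \<mapsto> \<parallel>\<rho> x\<parallel>\<close> for the *-homomorphisms \<open>\<rho>\<close> into
  C*-algebras that respect the relations. The supremum is meaningful if the relations bound each
  generator, as they do for projections.\<close>

definition universal_seminorm :: "'g set \<Rightarrow> 'g free_star set \<Rightarrow> 'g free_star \<Rightarrow> real"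
  where "universal_seminorm G R x = (SUP p\<in>{p. cstar_seminorm G p \<and> (\<forall>r\<in>R. p r = 0)}. p x)"

text \<open>The universal C*-algebra is the separated completion of the free *-algebra, built from
  Cauchy sequences modulo null sequences.\<close>

definition universal_cauchy :: "'g set \<Rightarrow> 'g free_star set \<Rightarrow> (nat \<Rightarrow> 'g free_star) set"
  where "universal_cauchy G R = {X. range X \<subseteq> free_star_algebra G \<and>
    (\<forall>e>0. \<exists>M. \<forall>m\<ge>M. \<forall>n\<ge>M. universal_seminorm G R (X m - X n) < e)}"

definition universal_rel ::
  "'g set \<Rightarrow> 'g free_star set \<Rightarrow> ((nat \<Rightarrow> 'g free_star) \<times> (nat \<Rightarrow> 'g free_star)) set"
  where "universal_rel G R = {(X, Y). X \<in> universal_cauchy G R \<and> Y \<in> universal_cauchy G R \<and>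
    (\<lambda>m. universal_seminorm G R (X m - Y m)) \<longlonglongrightarrow> 0}"

record 'b cstar_alg = "(complex, 'b) module" +
  adj :: "'b \<Rightarrow> 'b"
  cnorm :: "'b \<Rightarrow> real"

definition universal_cstar ::
  "'g set \<Rightarrow> 'g free_star set \<Rightarrow> (nat \<Rightarrow> 'g free_star) set cstar_alg"
  where "universal_cstar G R = \<lparr>
    carrier = universal_cauchy G R // universal_rel G R,
    monoid.mult = (\<lambda>S T. \<Union>X\<in>S. \<Union>Y\<in>T. universal_rel G R `` {\<lambda>m. X m * Y m}),
    one = universal_rel G R `` {\<lambda>m. 1},
    zero = universal_rel G R `` {\<lambda>m. 0},
    add = (\<lambda>S T. \<Union>X\<in>S. \<Union>Y\<in>T. universal_rel G R `` {\<lambda>m. X m + Y m}),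
    smult = (\<lambda>c S. \<Union>X\<in>S. universal_rel G R `` {\<lambda>m. free_scale c (X m)}),
    adj = (\<lambda>S. \<Union>X\<in>S. universal_rel G R `` {\<lambda>m. free_adj (X m)}),
    cnorm = (\<lambda>S. THE r. \<forall>X\<in>S. (\<lambda>m. universal_seminorm G R (X m)) \<longlonglongrightarrow> r)\<rparr>"

definition universal_gen ::
  "'g set \<Rightarrow> 'g free_star set \<Rightarrow> 'g \<Rightarrow> (nat \<Rightarrow> 'g free_star) set"
  where "universal_gen G R g = universal_rel G R `` {\<lambda>m. free_gen g}"


section \<open>Boolean spreadability\<close>

datatype spread_gen = U nat nat | Pr

definition spread_gens :: "nat \<Rightarrow> nat \<Rightarrow> spread_gen set"
  where "spread_gens n k = insert Pr {U i j | i j. i \<in> {1..n} \<and> j \<in> {1..k}}"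

definition spread_rels :: "nat \<Rightarrow> nat \<Rightarrow> spread_gen free_star set"
  where "spread_rels n k =
    (\<Union>g\<in>spread_gens n k.
      {free_adj (free_gen g) - free_gen g, free_gen g * free_gen g - free_gen g}) \<union>
    {(\<Sum>i=1..n. free_gen (U i j) * free_gen Pr) - free_gen Pr | j. j \<in> {1..k}} \<union>
    {free_gen (U i j) * free_gen (U i' j') | i j i' j'.
      i \<in> {1..n} \<and> i' \<in> {1..n} \<and> j \<in> {1..k} \<and> j' \<in> {1..k} \<and> j < j' \<and> i \<ge> i'}"

definition Bi :: "nat \<Rightarrow> nat \<Rightarrow> (nat \<Rightarrow> spread_gen free_star) set cstar_alg"
  where "Bi n k = universal_cstar (spread_gens n k) (spread_rels n k)"

definition Bi_u :: "nat \<Rightarrow> nat \<Rightarrow> nat \<Rightarrow> nat \<Rightarrow> (nat \<Rightarrow> spread_gen free_star) set"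
  where "Bi_u n k i j = universal_gen (spread_gens n k) (spread_rels n k) (U i j)"

definition Bi_P :: "nat \<Rightarrow> nat \<Rightarrow> (nat \<Rightarrow> spread_gen free_star) set"
  where "Bi_P n k = universal_gen (spread_gens n k) (spread_rels n k) Pr"

definition spread_coaction ::
  "nat \<Rightarrow> nat \<Rightarrow> (nat list \<Rightarrow>\<^sub>0 complex) \<Rightarrow> nat list \<Rightarrow> (nat \<Rightarrow> spread_gen free_star) set"
  where "spread_coaction n k =
    ncpoly_eval (ncpoly_tensor n (Bi n k))
      (\<lambda>j. \<Oplus>\<^bsub>ncpoly_tensor n (Bi n k)\<^esub>i\<in>{1..n}. word_tensor (Bi n k) [i] (Bi_u n k i j))"

text \<open>The finite sequence is \<open>(x 1, \<dots>, x n)\<close>.\<close>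

definition boolean_spreadable_fin ::
  "(('h::chilbert_space \<Rightarrow>\<^sub>L 'h) \<Rightarrow> complex) \<Rightarrow> nat \<Rightarrow> (nat \<Rightarrow> ('h \<Rightarrow>\<^sub>L 'h)) \<Rightarrow> bool"
  where "boolean_spreadable_fin \<phi> n x \<longleftrightarrow>
    (\<forall>k\<in>{1..<n}. \<forall>p\<in>ncpolys k.
      joint_distribution \<phi> x p \<odot>\<^bsub>Bi n k\<^esub> Bi_P n k =
      Bi_P n k \<otimes>\<^bsub>Bi n k\<^esub>
        tensor_id (Bi n k) (joint_distribution \<phi> x) (spread_coaction n k p) \<otimes>\<^bsub>Bi n k\<^esub> Bi_P n k)"

definition boolean_spreadable ::
  "(('h::chilbert_space \<Rightarrow>\<^sub>L 'h) \<Rightarrow> complex) \<Rightarrow> ('i::linorder \<Rightarrow> ('h \<Rightarrow>\<^sub>L 'h)) \<Rightarrow> bool"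
  where "boolean_spreadable \<phi> x \<longleftrightarrow>
    (\<forall>l i. strict_mono_on {1..l} i \<longrightarrow> boolean_spreadable_fin \<phi> l (x \<circ> i))"


section \<open>Tail algebras\<close>

definition positive_tail_algebra :: "(int \<Rightarrow> ('h::chilbert_space \<Rightarrow>\<^sub>L 'h)) \<Rightarrow> ('h \<Rightarrow>\<^sub>L 'h) set"
  where "positive_tail_algebra x =
    (\<Inter>k\<in>{0<..}. weak_operator_topology closure_of nonunital_algebra (x ` {k..}))"

definition negative_tail_algebra :: "(int \<Rightarrow> ('h::chilbert_space \<Rightarrow>\<^sub>L 'h)) \<Rightarrow> ('h \<Rightarrow>\<^sub>L 'h) set"
  where "negative_tail_algebra x =
    (\<Inter>k\<in>{..<0}. weak_operator_topology closure_of nonunital_algebra (x ` {..k}))"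

end

(*
  Representing B_i(n,k) on C^2 with orthogonal coordinate projections p_1, p_2 and the rank one
  projection P onto the diagonal gives, besides ordinary spreadability, the relation
    2 phi(b c b') = phi(b c T(b')) + phi(T(b) c b')
  for words b, b' whose indices lie strictly on one side of those of c, where T translates the
  indices away from c. In the GNS space, averages of translates of a word vector converge to a common
  limit in both directions, the projection Q to the translation-invariant vectors, and the
  relation becomes <b xi, c b' xi> = <Q b xi, c Q b' xi>. Hence an element a of either tail algebra
  satisfies a = Q a Q. Conversely, Q c Q is the weak limit of the translates of c in both
  directions for every c in the algebra generated by the sequence. Approximating a by such c,
  a = Q a Q is a weak limit of elements Q c Q, which lie in the opposite tail algebra.
*)
theory Submission
  imports Defs
begin

lemma free_star_algebra_add:
  "x \<in> free_star_algebra G \<Longrightarrow> y \<in> free_star_algebra G \<Longrightarrow> x + y \<in> free_star_algebra G"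
  unfolding free_star_algebra_def using keys_add[of x y] by blast

lemma free_star_algebra_uminus: "x \<in> free_star_algebra G \<Longrightarrow> - x \<in> free_star_algebra G"
  by (simp add: free_star_algebra_def in_keys_iff)

lemma free_star_algebra_diff:
  "x \<in> free_star_algebra G \<Longrightarrow> y \<in> free_star_algebra G \<Longrightarrow> x - y \<in> free_star_algebra G"
  using free_star_algebra_add[of x G "- y"] free_star_algebra_uminus[of y G] by simp

lemma free_star_algebra_mult:
  assumes "x \<in> free_star_algebra G" "y \<in> free_star_algebra G"
  shows "x * y \<in> free_star_algebra G"
  unfolding free_star_algebra_def
proof (intro CollectI ballI)
  fix w assume "w \<in> Poly_Mapping.keys (x * y)"
  then obtain a b where "w = a + b" "a \<in> Poly_Mapping.keys x" "b \<in> Poly_Mapping.keys y"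
    using keys_mult[of x y] by blast
  then show "fst ` set w \<subseteq> G"
    using assms by (auto simp: free_star_algebra_def plus_list_def)
qed

lemma free_star_algebra_single:
  "fst ` set w \<subseteq> G \<Longrightarrow> Poly_Mapping.single w c \<in> free_star_algebra G"
  by (auto simp: free_star_algebra_def)

lemma free_star_algebra_zero: "0 \<in> free_star_algebra G"
  by (simp add: free_star_algebra_def)

lemma free_star_algebra_one: "1 \<in> free_star_algebra G"
  by (simp add: free_star_algebra_def zero_list_def)

lemma free_star_algebra_gen: "g \<in> G \<Longrightarrow> free_gen g \<in> free_star_algebra G"
  unfolding free_gen_def by (rule free_star_algebra_single) simp

lemma free_star_algebra_scale: "x \<in> free_star_algebra G \<Longrightarrow> free_scale c x \<in> free_star_algebra G"
  unfolding free_scale_def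
  by (rule free_star_algebra_mult[OF free_star_algebra_single]) (simp_all add: zero_list_def)

lemma free_star_algebra_sum:
  "(\<And>i. i \<in> I \<Longrightarrow> f i \<in> free_star_algebra G) \<Longrightarrow> sum f I \<in> free_star_algebra G"
  by (induction I rule: infinite_finite_induct)
    (auto intro: free_star_algebra_add free_star_algebra_zero)

lemmas free_star_algebra_intros =
  free_star_algebra_add free_star_algebra_uminus free_star_algebra_diff free_star_algebra_mult
  free_star_algebra_zero free_star_algebra_one free_star_algebra_gen free_star_algebra_scale
  free_star_algebra_sum

lemma free_scale_one [simp]: "free_scale 1 x = x"
  by (simp add: free_scale_def single_one)

lemma free_scale_minus_one: "free_scale (- 1) x = - x"
  by (simp add: free_scale_def single_uminus single_one)

lemma free_scale_zero [simp]: "free_scale 0 x = 0" "free_scale c 0 = 0"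
  by (simp_all add: free_scale_def)

lemma free_scale_diff: "free_scale c (x - y) = free_scale c x - free_scale c y"
  by (simp add: free_scale_def algebra_simps)

lemma free_scale_single: "free_scale c (Poly_Mapping.single w d) = Poly_Mapping.single w (c * d)"
  by (simp add: free_scale_def mult_single)

lemma free_adj_gen: "free_adj (free_gen g) = Poly_Mapping.single [(g, True)] 1"
  by (simp add: free_adj_def free_gen_def apsnd_def)

lemma sum_single_lookup:
  assumes "finite F" "Poly_Mapping.keys x \<subseteq> F"
  shows "(\<Sum>w\<in>F. Poly_Mapping.single w (Poly_Mapping.lookup x w)) = x"
proof (rule poly_mapping_eqI)
  fix v
  have "Poly_Mapping.lookup (\<Sum>w\<in>F. Poly_Mapping.single w (Poly_Mapping.lookup x w)) v
      = (\<Sum>w\<in>F. if w = v then Poly_Mapping.lookup x v else 0)"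
    by (auto simp: lookup_sum lookup_single when_def intro!: sum.cong)
  then show "Poly_Mapping.lookup (\<Sum>w\<in>F. Poly_Mapping.single w (Poly_Mapping.lookup x w)) v
      = Poly_Mapping.lookup x v"
    using assms by (auto simp: in_keys_iff)
qed

section \<open>The universal C*-algebra of a family of projections with relations\<close>

lemma tendsto_zero_le:
  fixes f g :: "nat \<Rightarrow> real"
  assumes "g \<longlonglongrightarrow> 0" "\<And>n. 0 \<le> f n" "\<And>n. f n \<le> g n"
  shows "f \<longlonglongrightarrow> 0"
  by (rule tendsto_sandwich[OF _ _ tendsto_const assms(1)]) (auto simp: assms)

locale projection_relations =
  fixes G :: "'g set" and R :: "'g free_star set"
  assumes adj_rel: "g \<in> G \<Longrightarrow> free_adj (free_gen g) - free_gen g \<in> R"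
    and idem_rel: "g \<in> G \<Longrightarrow> free_gen g * free_gen g - free_gen g \<in> R"
begin

abbreviation "FA \<equiv> free_star_algebra G"
abbreviation "N \<equiv> universal_seminorm G R"
abbreviation "admissible p \<equiv> cstar_seminorm G p \<and> (\<forall>r\<in>R. p r = 0)"
abbreviation "Q \<equiv> universal_cstar G R"

context
  fixes p assumes adm: "admissible p"
begin

lemma adm_nonneg: "x \<in> FA \<Longrightarrow> 0 \<le> p x"
  and adm_cstar: "x \<in> FA \<Longrightarrow> p (free_adj x * x) = (p x)\<^sup>2"
  and adm_scale: "x \<in> FA \<Longrightarrow> p (free_scale c x) = cmod c * p x"
  and adm_add: "x \<in> FA \<Longrightarrow> y \<in> FA \<Longrightarrow> p (x + y) \<le> p x + p y"
  and adm_mult: "x \<in> FA \<Longrightarrow> y \<in> FA \<Longrightarrow> p (x * y) \<le> p x * p y"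
  and adm_rel: "r \<in> R \<Longrightarrow> p r = 0"
  using adm by (auto simp: cstar_seminorm_def)

lemma adm_zero: "p 0 = 0"
  using adm_scale[of 0 0] by (simp add: free_star_algebra_zero)

lemma adm_gen: assumes "g \<in> G" shows "p (free_gen g) \<le> 1" "p (free_adj (free_gen g)) \<le> 1"
proof -
  let ?g = "free_gen g" and ?h = "free_adj (free_gen g)"
  have g: "?g \<in> FA" "?h \<in> FA"
    using assms by (auto simp: free_adj_gen intro: free_star_algebra_gen free_star_algebra_single)
  have "(p ?g)\<^sup>2 = p ((?h - ?g) * ?g + (?g * ?g - ?g) + ?g)"
    using adm_cstar[OF g(1)] by (simp add: algebra_simps)
  also have "\<dots> \<le> p ((?h - ?g) * ?g + (?g * ?g - ?g)) + p ?g"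
    using g by (intro adm_add) (auto intro!: free_star_algebra_intros)
  also have "p ((?h - ?g) * ?g + (?g * ?g - ?g)) \<le> p ((?h - ?g) * ?g) + p (?g * ?g - ?g)"
    using g by (intro adm_add) (auto intro!: free_star_algebra_intros)
  also have "p (?g * ?g - ?g) = 0" using adm_rel idem_rel assms by blast
  also have "p ((?h - ?g) * ?g) \<le> p (?h - ?g) * p ?g"
    using g by (intro adm_mult) (auto intro!: free_star_algebra_intros)
  also have "p (?h - ?g) = 0" using adm_rel adj_rel assms by blast
  finally have "p ?g * p ?g \<le> p ?g" by (simp add: power2_eq_square)
  then show *: "p ?g \<le> 1"
    using adm_nonneg[OF g(1)] by (cases "p ?g = 0") (auto simp: mult_le_cancel_left)
  have "p ?h \<le> p (?h - ?g) + p ?g"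
    using adm_add[of "?h - ?g" ?g] g by (auto intro!: free_star_algebra_intros)
  then show "p ?h \<le> 1" using * adm_rel[OF adj_rel[OF assms]] by simp
qed

lemma adm_word: "fst ` set w \<subseteq> G \<Longrightarrow> p (Poly_Mapping.single w 1) \<le> 1"
proof (induction w)
  case Nil
  have "free_adj 1 = (1 :: 'g free_star)"
    by (simp add: free_adj_def zero_list_def) (simp flip: zero_list_def)
  then have "p 1 = (p 1)\<^sup>2"
    using adm_cstar[of 1] by (simp add: free_star_algebra_one)
  then have "p 1 \<le> 1" by (cases "p 1 = 0") (auto simp: power2_eq_square)
  then show ?case by (simp only: single_one[symmetric] zero_list_def)
next
  case (Cons l w)
  obtain g b where l: "l = (g, b)" by fastforce
  have g: "g \<in> G" and w: "fst ` set w \<subseteq> G" using Cons.prems l by auto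
  have l1: "p (Poly_Mapping.single [l] 1) \<le> 1"
    using adm_gen[OF g] l by (cases b) (auto simp: free_gen_def free_adj_def apsnd_def)
  have "Poly_Mapping.single (l # w) 1 = Poly_Mapping.single [l] 1 * Poly_Mapping.single w (1 :: complex)"
    by (simp add: mult_single plus_list_def)
  then have "p (Poly_Mapping.single (l # w) 1) \<le> p (Poly_Mapping.single [l] 1) * p (Poly_Mapping.single w 1)"
    using g w l by (auto intro!: adm_mult free_star_algebra_single)
  also have "\<dots> \<le> 1 * 1"
    using l1 Cons.IH[OF w] w g l
    by (intro mult_mono) (auto intro!: adm_nonneg free_star_algebra_single)
  finally show ?case by simp
qed

lemma adm_sum:
  assumes "finite F" "\<And>w. w \<in> F \<Longrightarrow> fst ` set w \<subseteq> G"
  shows "p (\<Sum>w\<in>F. Poly_Mapping.single w (f w)) \<le> (\<Sum>w\<in>F. cmod (f w))"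
  using assms
proof (induction F rule: finite_induct)
  case empty
  show ?case by (simp add: adm_zero)
next
  case (insert w F)
  have FA: "Poly_Mapping.single w c \<in> FA" for c
    using insert.prems by (intro free_star_algebra_single) auto
  have "p (Poly_Mapping.single w (f w)) = cmod (f w) * p (Poly_Mapping.single w 1)"
    using adm_scale[OF FA[of 1], of "f w"] by (simp add: free_scale_single)
  also have "\<dots> \<le> cmod (f w)"
    using adm_word[of w] insert.prems by (simp add: mult_left_le)
  finally have "p (Poly_Mapping.single w (f w)) \<le> cmod (f w)" .
  moreover have "p (\<Sum>w\<in>F. Poly_Mapping.single w (f w)) \<le> (\<Sum>w\<in>F. cmod (f w))"
    using insert by auto
  moreover have "p (Poly_Mapping.single w (f w) + (\<Sum>w\<in>F. Poly_Mapping.single w (f w)))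
      \<le> p (Poly_Mapping.single w (f w)) + p (\<Sum>w\<in>F. Poly_Mapping.single w (f w))"
    using insert.prems
    by (intro adm_add FA free_star_algebra_sum) (auto intro!: free_star_algebra_single)
  ultimately show ?case using insert by simp
qed

lemma adm_bound:
  "x \<in> FA \<Longrightarrow> p x \<le> (\<Sum>w\<in>Poly_Mapping.keys x. cmod (Poly_Mapping.lookup x w))"
  using adm_sum[of "Poly_Mapping.keys x" "Poly_Mapping.lookup x"]
  by (simp add: sum_single_lookup) (auto simp: free_star_algebra_def)

end

lemma adm_trivial: "admissible (\<lambda>_. 0)"
  by (simp add: cstar_seminorm_def)

lemma adm_bdd:
  assumes "x \<in> FA" shows "bdd_above ((\<lambda>p. p x) ` {p. admissible p})"
proof (rule bdd_aboveI2)
  fix p :: "'g free_star \<Rightarrow> real" assume "p \<in> {p. admissible p}"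
  then show "p x \<le> (\<Sum>w\<in>Poly_Mapping.keys x. cmod (Poly_Mapping.lookup x w))"
    using adm_bound[of p x] assms by blast
qed

lemma adm_le: "admissible p \<Longrightarrow> x \<in> FA \<Longrightarrow> p x \<le> N x"
  unfolding universal_seminorm_def by (rule cSUP_upper[OF _ adm_bdd]) simp_all

lemma N_least:
  assumes "\<And>p. admissible p \<Longrightarrow> p x \<le> b" shows "N x \<le> b"
  unfolding universal_seminorm_def
proof (rule cSUP_least)
  show "{p. admissible p} \<noteq> {}" using adm_trivial by blast
qed (use assms in blast)

lemma N_nonneg: "x \<in> FA \<Longrightarrow> 0 \<le> N x"
  using adm_le[OF adm_trivial] by simp

lemma N_add: assumes "x \<in> FA" "y \<in> FA" shows "N (x + y) \<le> N x + N y"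
proof (rule N_least)
  fix p assume p: "admissible p"
  show "p (x + y) \<le> N x + N y"
    using adm_add[OF p assms] adm_le[OF p assms(1)] adm_le[OF p assms(2)] by linarith
qed

lemma N_mult: assumes "x \<in> FA" "y \<in> FA" shows "N (x * y) \<le> N x * N y"
proof (rule N_least)
  fix p assume p: "admissible p"
  have "p x * p y \<le> N x * N y"
    using adm_le[OF p assms(1)] adm_le[OF p assms(2)] adm_nonneg[OF p assms(2)] N_nonneg[OF assms(1)]
    by (intro mult_mono)
  then show "p (x * y) \<le> N x * N y"
    using adm_mult[OF p assms] by linarith
qed

lemma N_scale: assumes "x \<in> FA" shows "N (free_scale c x) \<le> cmod c * N x"
proof (rule N_least)
  fix p assume p: "admissible p"
  show "p (free_scale c x) \<le> cmod c * N x"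
    using adm_scale[OF p assms] mult_left_mono[OF adm_le[OF p assms], of "cmod c"] by simp
qed

lemma N_zero: "N 0 = 0"
proof (rule antisym)
  show "N 0 \<le> 0" by (rule N_least) (simp add: adm_zero)
qed (simp add: N_nonneg free_star_algebra_zero)

lemma N_minus: "x \<in> FA \<Longrightarrow> N (- x) \<le> N x"
  using N_scale[of x "-1"] by (simp add: free_scale_minus_one)

lemma N_commute: assumes "x \<in> FA" "y \<in> FA" shows "N (x - y) = N (y - x)"
  using N_minus[of "x - y"] N_minus[of "y - x"] assms
  by (simp add: free_star_algebra_diff)

lemma N_triangle: assumes "x \<in> FA" "y \<in> FA" "z \<in> FA" shows "N (x - z) \<le> N (x - y) + N (y - z)"
  using N_add[of "x - y" "y - z"] assms by (simp add: free_star_algebra_diff)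

abbreviation "Cs \<equiv> universal_cauchy G R"
abbreviation "Rel \<equiv> universal_rel G R"

lemma CsD: "X \<in> Cs \<Longrightarrow> X m \<in> FA"
  by (auto simp: universal_cauchy_def)

lemma Cs_cauchy: "X \<in> Cs \<Longrightarrow> e > 0 \<Longrightarrow> \<exists>M. \<forall>m\<ge>M. \<forall>n\<ge>M. N (X m - X n) < e"
  by (simp add: universal_cauchy_def)

lemma null_cauchy_transfer:
  assumes X: "X \<in> Cs" and Y: "\<And>m. Y m \<in> FA" and lim: "(\<lambda>m. N (X m - Y m)) \<longlonglongrightarrow> 0"
  shows "Y \<in> Cs"
  unfolding universal_cauchy_def
proof (intro CollectI conjI allI impI)
  show "range Y \<subseteq> FA" using Y by blast
  fix e :: real assume e: "e > 0"
  then have e3: "e / 3 > 0" by simp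
  obtain M1 where M1: "\<And>m n. m \<ge> M1 \<Longrightarrow> n \<ge> M1 \<Longrightarrow> N (X m - X n) < e / 3"
    using Cs_cauchy[OF X e3] by blast
  obtain M2 where M2: "\<And>m. m \<ge> M2 \<Longrightarrow> N (X m - Y m) < e / 3"
    using order_tendstoD(2)[OF lim e3] unfolding eventually_sequentially by blast
  show "\<exists>M. \<forall>m\<ge>M. \<forall>n\<ge>M. N (Y m - Y n) < e"
  proof (intro exI allI impI)
    fix m n assume mn: "m \<ge> max M1 M2" "n \<ge> max M1 M2"
    have "N (Y m - Y n) \<le> N (Y m - X m) + N (X m - Y n)"
      using X Y by (intro N_triangle) (auto intro: CsD)
    also have "N (X m - Y n) \<le> N (X m - X n) + N (X n - Y n)"
      using X Y by (intro N_triangle) (auto intro: CsD)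
    finally show "N (Y m - Y n) < e"
      using M1[of m n] M2[of m] M2[of n] mn N_commute[of "Y m" "X m"] Y CsD[OF X] by auto
  qed
qed

lemma const_Cs: "x \<in> FA \<Longrightarrow> (\<lambda>_. x) \<in> Cs"
  by (auto simp: universal_cauchy_def N_zero)

lemma RelD:
  assumes "(X, Y) \<in> Rel"
  shows "X \<in> Cs" "Y \<in> Cs" "(\<lambda>m. N (X m - Y m)) \<longlonglongrightarrow> 0"
  using assms by (simp_all add: universal_rel_def)

lemma equiv_Rel: "equiv Cs Rel"
proof (rule equivI)
  show "Rel \<subseteq> Cs \<times> Cs" by (auto simp: universal_rel_def)
  show "refl_on Cs Rel" by (auto simp: refl_on_def universal_rel_def N_zero)
  show "sym Rel"
  proof (rule symI)
    fix X Y assume "(X, Y) \<in> Rel"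
    moreover from this have "N (X m - Y m) = N (Y m - X m)" for m
      by (intro N_commute) (auto simp: universal_rel_def intro: CsD)
    ultimately show "(Y, X) \<in> Rel" by (simp add: universal_rel_def)
  qed
  show "trans Rel"
  proof (rule transI)
    fix X Y Z assume XY: "(X, Y) \<in> Rel" and YZ: "(Y, Z) \<in> Rel"
    note C = RelD(1,2)[OF XY] RelD(2)[OF YZ]
    have lim: "(\<lambda>m. N (X m - Y m) + N (Y m - Z m)) \<longlonglongrightarrow> 0"
      using tendsto_add[OF RelD(3)[OF XY] RelD(3)[OF YZ]] by simp
    have "(\<lambda>m. N (X m - Z m)) \<longlonglongrightarrow> 0"
      by (intro tendsto_zero_le[OF lim] N_nonneg N_triangle free_star_algebra_diff C[THEN CsD])
    then show "(X, Z) \<in> Rel" using C by (simp add: universal_rel_def)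
  qed
qed

lemma add_Cs:
  assumes X: "X \<in> Cs" and Y: "Y \<in> Cs" shows "(\<lambda>m. X m + Y m) \<in> Cs"
  unfolding universal_cauchy_def
proof (intro CollectI conjI allI impI)
  show "range (\<lambda>m. X m + Y m) \<subseteq> FA" by (intro image_subsetI free_star_algebra_add CsD[OF X] CsD[OF Y])
  fix e :: real assume "e > 0"
  then have e2: "e / 2 > 0" by simp
  obtain M1 where M1: "\<And>m n. m \<ge> M1 \<Longrightarrow> n \<ge> M1 \<Longrightarrow> N (X m - X n) < e / 2"
    using Cs_cauchy[OF X e2] by blast
  obtain M2 where M2: "\<And>m n. m \<ge> M2 \<Longrightarrow> n \<ge> M2 \<Longrightarrow> N (Y m - Y n) < e / 2"
    using Cs_cauchy[OF Y e2] by blast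
  show "\<exists>M. \<forall>m\<ge>M. \<forall>n\<ge>M. N (X m + Y m - (X n + Y n)) < e"
  proof (intro exI allI impI)
    fix m n assume mn: "m \<ge> max M1 M2" "n \<ge> max M1 M2"
    have "N (X m + Y m - (X n + Y n)) = N ((X m - X n) + (Y m - Y n))"
      by (simp add: algebra_simps)
    also have "\<dots> \<le> N (X m - X n) + N (Y m - Y n)"
      using X Y by (intro N_add free_star_algebra_diff CsD)
    finally show "N (X m + Y m - (X n + Y n)) < e"
      using M1[of m n] M2[of m n] mn by auto
  qed
qed

lemma Rel_add:
  assumes "(X, X') \<in> Rel" "(Y, Y') \<in> Rel"
  shows "((\<lambda>m. X m + Y m), (\<lambda>m. X' m + Y' m)) \<in> Rel"
proof -
  note C = RelD(1,2)[OF assms(1)] RelD(1,2)[OF assms(2)]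
  have lim: "(\<lambda>m. N (X m - X' m) + N (Y m - Y' m)) \<longlonglongrightarrow> 0"
    using tendsto_add[OF RelD(3)[OF assms(1)] RelD(3)[OF assms(2)]] by simp
  have le: "N (X m + Y m - (X' m + Y' m)) \<le> N (X m - X' m) + N (Y m - Y' m)" for m
    using N_add[OF free_star_algebra_diff free_star_algebra_diff, OF C[THEN CsD]]
    by (simp add: algebra_simps)
  have "(\<lambda>m. N (X m + Y m - (X' m + Y' m))) \<longlonglongrightarrow> 0"
    by (intro tendsto_zero_le[OF lim] le N_nonneg free_star_algebra_diff free_star_algebra_add
        C[THEN CsD])
  then show ?thesis using add_Cs C by (simp add: universal_rel_def)
qed

lemma Q_add:
  assumes "X \<in> Cs" "Y \<in> Cs"
  shows "Rel `` {X} \<oplus>\<^bsub>Q\<^esub> Rel `` {Y} = Rel `` {\<lambda>m. X m + Y m}"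
proof -
  have "congruent2 Rel Rel (\<lambda>X Y. Rel `` {\<lambda>m. X m + Y m})"
    by (rule congruent2I') (intro equiv_class_eq[OF equiv_Rel] Rel_add)
  then show ?thesis
    using UN_equiv_class2[OF equiv_Rel equiv_Rel _ assms] by (simp add: universal_cstar_def)
qed

definition embed :: "'g free_star \<Rightarrow> (nat \<Rightarrow> 'g free_star) set"
  where "embed x = Rel `` {\<lambda>_. x}"

lemma carrier_Q: "carrier Q = Cs // Rel"
  and zero_Q: "\<zero>\<^bsub>Q\<^esub> = embed 0"
  and one_Q: "\<one>\<^bsub>Q\<^esub> = embed 1"
  and universal_gen_eq: "universal_gen G R g = embed (free_gen g)"
  by (simp_all add: universal_cstar_def embed_def universal_gen_def)

lemma embed_carrier: "x \<in> FA \<Longrightarrow> embed x \<in> carrier Q"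
  unfolding carrier_Q embed_def by (intro quotientI const_Cs)

lemma abelian_monoid_Q: "abelian_monoid Q"
proof (rule abelian_monoidI)
  fix x y z assume "x \<in> carrier Q" "y \<in> carrier Q" "z \<in> carrier Q"
  then obtain X Y Z where *: "X \<in> Cs" "x = Rel `` {X}" "Y \<in> Cs" "y = Rel `` {Y}"
    "Z \<in> Cs" "z = Rel `` {Z}"
    unfolding carrier_Q by (auto elim!: quotientE)
  then show "x \<oplus>\<^bsub>Q\<^esub> y \<oplus>\<^bsub>Q\<^esub> z = x \<oplus>\<^bsub>Q\<^esub> (y \<oplus>\<^bsub>Q\<^esub> z)"
    by (simp add: Q_add add_Cs add.assoc)
next
  fix x y assume "x \<in> carrier Q" "y \<in> carrier Q"
  then obtain X Y where *: "X \<in> Cs" "x = Rel `` {X}" "Y \<in> Cs" "y = Rel `` {Y}"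
    unfolding carrier_Q by (auto elim!: quotientE)
  then show "x \<oplus>\<^bsub>Q\<^esub> y = y \<oplus>\<^bsub>Q\<^esub> x"
    by (simp add: Q_add add.commute)
  show "x \<oplus>\<^bsub>Q\<^esub> y \<in> carrier Q"
    using * by (simp add: Q_add add_Cs carrier_Q quotientI)
next
  fix x assume "x \<in> carrier Q"
  then obtain X where *: "X \<in> Cs" "x = Rel `` {X}"
    unfolding carrier_Q by (auto elim!: quotientE)
  then show "\<zero>\<^bsub>Q\<^esub> \<oplus>\<^bsub>Q\<^esub> x = x"
    by (simp add: zero_Q embed_def Q_add const_Cs free_star_algebra_zero)
qed (simp add: zero_Q embed_carrier free_star_algebra_zero)

lemma embed_add: "x \<in> FA \<Longrightarrow> y \<in> FA \<Longrightarrow> embed x \<oplus>\<^bsub>Q\<^esub> embed y = embed (x + y)"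
  by (simp add: embed_def Q_add const_Cs)

lemma embed_classD:
  assumes "X \<in> embed x" shows "X \<in> Cs" "(\<lambda>m. N (X m - x)) \<longlonglongrightarrow> 0"
proof -
  have "((\<lambda>_. x), X) \<in> Rel" using assms by (simp add: embed_def)
  then have "(X, (\<lambda>_. x)) \<in> Rel" using equiv_Rel by (meson equivE symD)
  then show "X \<in> Cs" "(\<lambda>m. N (X m - x)) \<longlonglongrightarrow> 0" by (auto dest: RelD)
qed

lemma class_embedI:
  assumes x: "x \<in> FA" and X: "\<And>m. X m \<in> FA" and lim: "(\<lambda>m. N (X m - x)) \<longlonglongrightarrow> 0"
  shows "Rel `` {X} = embed x"
proof -
  have lim': "(\<lambda>m. N (x - X m)) \<longlonglongrightarrow> 0" using lim N_commute[OF x X] by simp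
  have "X \<in> Cs" by (rule null_cauchy_transfer[OF const_Cs[OF x] X lim'])
  then have "((\<lambda>_. x), X) \<in> Rel" using lim' const_Cs[OF x] by (simp add: universal_rel_def)
  then show ?thesis using equiv_class_eq[OF equiv_Rel] by (simp add: embed_def)
qed

lemma embed_self: "x \<in> FA \<Longrightarrow> (\<lambda>_. x) \<in> embed x"
  using equiv_class_self[OF equiv_Rel const_Cs] by (simp add: embed_def)

lemma embed_mult:
  assumes "x \<in> FA" "y \<in> FA" shows "embed x \<otimes>\<^bsub>Q\<^esub> embed y = embed (x * y)"
proof -
  have "Rel `` {\<lambda>m. X m * Y m} = embed (x * y)" if "X \<in> embed x" "Y \<in> embed y" for X Y
  proof (rule class_embedI)
    note X = embed_classD[OF that(1)] and Y = embed_classD[OF that(2)]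
    note F = CsD[OF X(1)] CsD[OF Y(1)] assms
    show "x * y \<in> FA" "X m * Y m \<in> FA" for m using F by (auto intro: free_star_algebra_mult)
    have "(\<lambda>m. N (X m - x) * N (Y m - y) + N (X m - x) * N y + N x * N (Y m - y))
        \<longlonglongrightarrow> 0 * 0 + 0 * N y + N x * 0"
      by (intro tendsto_intros X Y)
    then have lim: "(\<lambda>m. N (X m - x) * N (Y m - y) + N (X m - x) * N y + N x * N (Y m - y))
        \<longlonglongrightarrow> 0" by simp
    have "N (X m * Y m - x * y)
        \<le> N (X m - x) * N (Y m - y) + N (X m - x) * N y + N x * N (Y m - y)" for m
    proof -
      have "X m * Y m - x * y = (X m - x) * (Y m - y) + (X m - x) * y + x * (Y m - y)"
        by (simp add: algebra_simps)
      then have "N (X m * Y m - x * y)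
          \<le> N ((X m - x) * (Y m - y) + (X m - x) * y) + N (x * (Y m - y))"
        by (simp only:) (intro N_add free_star_algebra_intros F)
      moreover have "N ((X m - x) * (Y m - y) + (X m - x) * y)
          \<le> N ((X m - x) * (Y m - y)) + N ((X m - x) * y)"
        by (intro N_add free_star_algebra_intros F)
      moreover have "N ((X m - x) * (Y m - y)) \<le> N (X m - x) * N (Y m - y)"
        by (intro N_mult free_star_algebra_intros F)
      moreover have "N ((X m - x) * y) \<le> N (X m - x) * N y"
        by (intro N_mult free_star_algebra_intros F)
      moreover have "N (x * (Y m - y)) \<le> N x * N (Y m - y)"
        by (intro N_mult free_star_algebra_intros F)
      ultimately show ?thesis by linarith
    qed
    then show "(\<lambda>m. N (X m * Y m - x * y)) \<longlonglongrightarrow> 0"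
      by (intro tendsto_zero_le[OF lim] N_nonneg free_star_algebra_intros F)
  qed
  moreover have "embed x \<noteq> {}" "embed y \<noteq> {}" using embed_self assms by blast+
  ultimately show ?thesis by (simp add: universal_cstar_def)
qed

lemma embed_smult:
  assumes "x \<in> FA" shows "c \<odot>\<^bsub>Q\<^esub> embed x = embed (free_scale c x)"
proof -
  have "Rel `` {\<lambda>m. free_scale c (X m)} = embed (free_scale c x)" if "X \<in> embed x" for X
  proof (rule class_embedI)
    note X = embed_classD[OF that(1)]
    note F = CsD[OF X(1)] assms
    show "free_scale c x \<in> FA" "free_scale c (X m) \<in> FA" for m using F by (auto intro: free_star_algebra_scale)
    have lim: "(\<lambda>m. cmod c * N (X m - x)) \<longlonglongrightarrow> 0"
      using tendsto_mult[OF tendsto_const X(2), of "cmod c"] by simp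
    show "(\<lambda>m. N (free_scale c (X m) - free_scale c x)) \<longlonglongrightarrow> 0"
      unfolding free_scale_diff[symmetric]
      by (intro tendsto_zero_le[OF lim] N_nonneg N_scale free_star_algebra_intros F)
  qed
  moreover have "embed x \<noteq> {}" using embed_self assms by blast
  ultimately show ?thesis by (simp add: universal_cstar_def)
qed

lemma embed_finsum:
  assumes "finite I" "\<And>i. i \<in> I \<Longrightarrow> f i \<in> FA"
  shows "(\<Oplus>\<^bsub>Q\<^esub>i\<in>I. embed (f i)) = embed (\<Sum>i\<in>I. f i)"
proof -
  interpret abelian_monoid Q by (rule abelian_monoid_Q)
  show ?thesis using assms
    by (induction I rule: finite_induct)
      (auto simp: zero_Q embed_add finsum_insert Pi_iff embed_carrier free_star_algebra_sum)
qed

lemma embed_eqD: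
  assumes "embed x = embed y" "x \<in> FA" "y \<in> FA" "admissible p"
  shows "p (x - y) = 0"
proof -
  have "((\<lambda>_. x), (\<lambda>_. y)) \<in> Rel"
    using eq_equiv_class[OF _ equiv_Rel const_Cs] assms by (simp add: embed_def)
  then have "N (x - y) = 0" by (auto simp: universal_rel_def LIMSEQ_const_iff)
  then show ?thesis
    using adm_le[OF assms(4), of "x - y"] adm_nonneg[OF assms(4), of "x - y"] assms
    by (simp add: free_star_algebra_diff)
qed

end

section \<open>The coaction\<close>

lemma abelian_monoid_ncpoly_tensor:
  assumes "abelian_monoid B" shows "abelian_monoid (ncpoly_tensor n B)"
proof -
  interpret B: abelian_monoid B by fact
  have fin: "finite {w. f w \<oplus>\<^bsub>B\<^esub> g w \<noteq> \<zero>\<^bsub>B\<^esub>}"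
    if "finite {w. f w \<noteq> \<zero>\<^bsub>B\<^esub>}" "finite {w. g w \<noteq> \<zero>\<^bsub>B\<^esub>}" for f g :: "nat list \<Rightarrow> _"
    by (rule finite_subset[OF _ finite_UnI[OF that]]) auto
  show ?thesis
  proof (rule abelian_monoidI)
    fix f g assume "f \<in> carrier (ncpoly_tensor n B)" "g \<in> carrier (ncpoly_tensor n B)"
    then have *: "\<And>w. f w \<in> carrier B" "\<And>w. g w \<in> carrier B"
      "finite {w. f w \<noteq> \<zero>\<^bsub>B\<^esub>}" "finite {w. g w \<noteq> \<zero>\<^bsub>B\<^esub>}"
      "\<And>w. f w \<noteq> \<zero>\<^bsub>B\<^esub> \<Longrightarrow> set w \<subseteq> {1..n}" "\<And>w. g w \<noteq> \<zero>\<^bsub>B\<^esub> \<Longrightarrow> set w \<subseteq> {1..n}"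
      by (auto simp: ncpoly_tensor_def)
    have "set w \<subseteq> {1..n}" if "f w \<oplus>\<^bsub>B\<^esub> g w \<noteq> \<zero>\<^bsub>B\<^esub>" for w
      using *(5)[of w] *(6)[of w] that B.r_zero[OF B.zero_closed] by metis
    then show "f \<oplus>\<^bsub>ncpoly_tensor n B\<^esub> g \<in> carrier (ncpoly_tensor n B)"
      using *(1,2) fin[OF *(3,4)] by (simp add: ncpoly_tensor_def image_subset_iff)
    show "f \<oplus>\<^bsub>ncpoly_tensor n B\<^esub> g = g \<oplus>\<^bsub>ncpoly_tensor n B\<^esub> f"
      using *(1,2) by (simp add: ncpoly_tensor_def B.a_comm)
  qed (auto simp: ncpoly_tensor_def B.a_assoc image_subset_iff)
qed

lemma ncpoly_tensor_finsum:
  assumes B: "abelian_monoid B" and I: "finite I"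
    and f: "\<And>i. i \<in> I \<Longrightarrow> f i \<in> carrier (ncpoly_tensor n B)"
  shows "(\<Oplus>\<^bsub>ncpoly_tensor n B\<^esub>i\<in>I. f i) = (\<lambda>w. \<Oplus>\<^bsub>B\<^esub>i\<in>I. f i w)"
proof -
  interpret B: abelian_monoid B by fact
  interpret T: abelian_monoid "ncpoly_tensor n B" by (rule abelian_monoid_ncpoly_tensor[OF B])
  show ?thesis using I f
  proof (induction I rule: finite_induct)
    case empty
    show ?case by (simp only: T.finsum_empty B.finsum_empty) (simp add: ncpoly_tensor_def)
  next
    case (insert i I)
    have "f j w \<in> carrier B" if "j \<in> insert i I" for j w
      using insert.prems[OF that] by (auto simp: ncpoly_tensor_def)
    then show ?case
      using insert by (simp add: T.finsum_insert B.finsum_insert Pi_iff)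
        (simp add: ncpoly_tensor_def)
  qed
qed

lemma ncpoly_eval_word:
  assumes M: "abelian_monoid M" and F: "F = foldr (\<lambda>v b. f v \<otimes>\<^bsub>M\<^esub> b) w \<one>\<^bsub>M\<^esub>"
    and one: "1 \<odot>\<^bsub>M\<^esub> F = F" and carr: "F \<in> carrier M"
  shows "ncpoly_eval M f (Poly_Mapping.single w 1) = F"
proof -
  interpret abelian_monoid M by fact
  show ?thesis
    using finsum_insert[of "{}" w "\<lambda>v. Poly_Mapping.lookup (Poly_Mapping.single w 1) v \<odot>\<^bsub>M\<^esub>
      foldr (\<lambda>v b. f v \<otimes>\<^bsub>M\<^esub> b) v \<one>\<^bsub>M\<^esub>"] one carr
    by (simp add: ncpoly_eval_def F)
qed

context projection_relations
begin

lemma embed_tensor_mult: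
  assumes "\<And>w. a w \<in> FA" "\<And>w. b w \<in> FA"
  shows "(\<lambda>w. embed (a w)) \<otimes>\<^bsub>ncpoly_tensor n Q\<^esub> (\<lambda>w. embed (b w))
    = (\<lambda>w. embed (\<Sum>r\<le>length w. a (take r w) * b (drop r w)))"
  using assms
  by (simp add: ncpoly_tensor_def embed_mult embed_finsum free_star_algebra_mult)

lemma tensor_id_embed:
  assumes fin: "finite W" and F: "\<And>w. w \<in> W \<Longrightarrow> F w \<in> FA"
    and supp: "\<And>w. w \<notin> W \<Longrightarrow> F w = 0"
  shows "tensor_id Q \<mu> (\<lambda>w. embed (F w))
    = embed (\<Sum>w\<in>W. free_scale (\<mu> (Poly_Mapping.single w 1)) (F w))"
proof -
  interpret abelian_monoid Q by (rule abelian_monoid_Q)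
  have "(\<Oplus>\<^bsub>Q\<^esub>w\<in>{w. embed (F w) \<noteq> \<zero>\<^bsub>Q\<^esub>}. \<mu> (Poly_Mapping.single w 1) \<odot>\<^bsub>Q\<^esub> embed (F w))
      = (\<Oplus>\<^bsub>Q\<^esub>w\<in>W. \<mu> (Poly_Mapping.single w 1) \<odot>\<^bsub>Q\<^esub> embed (F w))"
  proof (rule add.finprod_mono_neutral_cong_left)
    show "{w. embed (F w) \<noteq> \<zero>\<^bsub>Q\<^esub>} \<subseteq> W" using supp by (auto simp: zero_Q)
    fix w assume "w \<in> W - {w. embed (F w) \<noteq> \<zero>\<^bsub>Q\<^esub>}"
    then show "\<mu> (Poly_Mapping.single w 1) \<odot>\<^bsub>Q\<^esub> embed (F w) = \<zero>\<^bsub>Q\<^esub>"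
      using embed_smult[of 0 "\<mu> (Poly_Mapping.single w 1)"]
      by (simp add: zero_Q free_star_algebra_zero)
  qed (use fin F in \<open>auto simp: embed_smult embed_carrier free_star_algebra_scale\<close>)
  also have "\<dots> = (\<Oplus>\<^bsub>Q\<^esub>w\<in>W. embed (free_scale (\<mu> (Poly_Mapping.single w 1)) (F w)))"
    by (rule finsum_cong')
      (auto simp: F embed_smult embed_carrier free_star_algebra_scale)
  also have "\<dots> = embed (\<Sum>w\<in>W. free_scale (\<mu> (Poly_Mapping.single w 1)) (F w))"
    using fin F by (intro embed_finsum free_star_algebra_scale)
  finally show ?thesis by (simp add: tensor_id_def)
qed

end

text \<open>The coefficient of the word \<open>v\<close> in the image of the word \<open>w\<close> under the coaction.\<close>

fun coaction_coeff :: "nat \<Rightarrow> nat list \<Rightarrow> nat list \<Rightarrow> spread_gen free_star" where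
  "coaction_coeff n [] [] = 1"
| "coaction_coeff n (i # v) (j # w)
    = (if i \<in> {1..n} then free_gen (U i j) * coaction_coeff n v w else 0)"
| "coaction_coeff n v w = 0"

lemma coaction_coeff_supp:
  "coaction_coeff n v w \<noteq> 0 \<Longrightarrow> set v \<subseteq> {1..n} \<and> length v = length w"
proof (induction n v w rule: coaction_coeff.induct)
  case (2 n i v j w)
  then show ?case by (cases "coaction_coeff n v w = 0") (auto split: if_splits)
qed simp_all

lemma coaction_coeff_free_star:
  "set w \<subseteq> {1..k} \<Longrightarrow> coaction_coeff n v w \<in> free_star_algebra (spread_gens n k)"
  by (induction n v w rule: coaction_coeff.induct)
    (auto intro!: free_star_algebra_intros simp: spread_gens_def)

lemma projection_relations_spread: "projection_relations (spread_gens n k) (spread_rels n k)"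
  by standard (auto simp: spread_rels_def)

definition letter_coeff :: "nat \<Rightarrow> nat \<Rightarrow> nat list \<Rightarrow> spread_gen free_star"
  where "letter_coeff n j v = (\<Sum>i\<in>{1..n}. if v = [i] then free_gen (U i j) else 0)"

lemma letter_coeff_single: "letter_coeff n j [i] = (if i \<in> {1..n} then free_gen (U i j) else 0)"
  by (simp add: letter_coeff_def)

lemma letter_coeff_other: "length v \<noteq> 1 \<Longrightarrow> letter_coeff n j v = 0"
  by (auto simp: letter_coeff_def intro!: sum.neutral)

lemma letter_coeff_conv:
  "(\<Sum>r\<le>length v. letter_coeff n j (take r v) * coaction_coeff n (drop r v) w)
    = coaction_coeff n v (j # w)"
proof (cases v)
  case Nil
  then show ?thesis by (simp add: letter_coeff_other)
next
  case (Cons i u)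
  have "(\<Sum>r\<le>length v. letter_coeff n j (take r v) * coaction_coeff n (drop r v) w)
      = (\<Sum>r\<in>{1}. letter_coeff n j (take r v) * coaction_coeff n (drop r v) w)"
    using Cons by (intro sum.mono_neutral_right) (auto simp: letter_coeff_other)
  then show ?thesis using Cons by (simp add: letter_coeff_single)
qed

context
  fixes n k :: nat
begin

interpretation projection_relations "spread_gens n k" "spread_rels n k"
  by (rule projection_relations_spread)

lemma letter_coeff_free_star: "j \<in> {1..k} \<Longrightarrow> letter_coeff n j v \<in> FA"
  unfolding letter_coeff_def
  by (auto intro!: free_star_algebra_intros simp: spread_gens_def)

lemma coaction_letter:
  assumes "j \<in> {1..k}"
  shows "(\<Oplus>\<^bsub>ncpoly_tensor n (Bi n k)\<^esub>i\<in>{1..n}. word_tensor (Bi n k) [i] (Bi_u n k i j))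
    = (\<lambda>v. embed (letter_coeff n j v))"
proof -
  have g: "free_gen (U i j) \<in> FA" if "i \<in> {1..n}" for i
    using assms that by (auto intro!: free_star_algebra_gen simp: spread_gens_def)
  have w: "word_tensor Q [i] (Bi_u n k i j) = (\<lambda>v. embed (if v = [i] then free_gen (U i j) else 0))" for i
    by (rule ext) (simp add: word_tensor_def Bi_u_def universal_gen_eq zero_Q)
  have C: "(\<lambda>v. embed (if v = [i] then free_gen (U i j) else 0)) \<in> carrier (ncpoly_tensor n Q)"
    if "i \<in> {1..n}" for i
  proof -
    have "{v. embed (if v = [i] then free_gen (U i j) else 0) \<noteq> \<zero>\<^bsub>Q\<^esub>} \<subseteq> {[i]}"
      by (auto simp: zero_Q)
    then have "finite {v. embed (if v = [i] then free_gen (U i j) else 0) \<noteq> \<zero>\<^bsub>Q\<^esub>}"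
      by (rule finite_subset) simp
    then show ?thesis
      using g[OF that] that
      by (auto simp: ncpoly_tensor_def zero_Q embed_carrier free_star_algebra_zero)
  qed
  have "(\<Oplus>\<^bsub>Q\<^esub>i\<in>{1..n}. embed (if v = [i] then free_gen (U i j) else 0)) = embed (letter_coeff n j v)" for v
    unfolding letter_coeff_def using g by (intro embed_finsum) (auto intro: free_star_algebra_zero)
  then show ?thesis
    by (simp only: Bi_def w ncpoly_tensor_finsum[OF abelian_monoid_Q finite_atLeastAtMost C])
qed

lemma coaction_word:
  assumes "set w \<subseteq> {1..k}"
  shows "foldr (\<lambda>j b. (\<Oplus>\<^bsub>ncpoly_tensor n (Bi n k)\<^esub>i\<in>{1..n}. word_tensor (Bi n k) [i] (Bi_u n k i j))
      \<otimes>\<^bsub>ncpoly_tensor n (Bi n k)\<^esub> b) w \<one>\<^bsub>ncpoly_tensor n (Bi n k)\<^esub>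
    = (\<lambda>v. embed (coaction_coeff n v w))"
  using assms
proof (induction w)
  case Nil
  have "coaction_coeff n v [] = (if v = [] then 1 else 0)" for v
    by (cases v) auto
  then show ?case
    by (intro ext) (simp add: ncpoly_tensor_def Bi_def one_Q zero_Q)
next
  case (Cons j w)
  have "(\<lambda>v. embed (letter_coeff n j v)) \<otimes>\<^bsub>ncpoly_tensor n (Bi n k)\<^esub> (\<lambda>v. embed (coaction_coeff n v w))
      = (\<lambda>v. embed (coaction_coeff n v (j # w)))"
    using Cons.prems
    by (simp add: Bi_def embed_tensor_mult letter_coeff_free_star coaction_coeff_free_star letter_coeff_conv)
  moreover have "j \<in> {1..k}" "set w \<subseteq> {1..k}" using Cons.prems by auto
  ultimately show ?case
    by (simp only: foldr.simps comp_apply Cons.IH coaction_letter)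
qed

lemma spread_coaction_word:
  assumes "set w \<subseteq> {1..k}"
  shows "spread_coaction n k (Poly_Mapping.single w 1) = (\<lambda>v. embed (coaction_coeff n v w))"
proof -
  let ?T = "ncpoly_tensor n (Bi n k)" and ?F = "\<lambda>v. embed (coaction_coeff n v w)"
  have T: "abelian_monoid ?T"
    unfolding Bi_def by (intro abelian_monoid_ncpoly_tensor abelian_monoid_Q)
  have "{v. ?F v \<noteq> \<zero>\<^bsub>Q\<^esub>} \<subseteq> {v. set v \<subseteq> {1..n} \<and> length v = length w}"
  proof (intro subsetI CollectI)
    fix v assume "v \<in> {v. ?F v \<noteq> \<zero>\<^bsub>Q\<^esub>}"
    then have "coaction_coeff n v w \<noteq> 0" by (auto simp: zero_Q)
    then show "set v \<subseteq> {1..n} \<and> length v = length w" by (rule coaction_coeff_supp)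
  qed
  moreover from this have "finite {v. ?F v \<noteq> \<zero>\<^bsub>Q\<^esub>}"
    by (rule finite_subset) (simp add: finite_lists_length_eq)
  ultimately have "?F \<in> carrier ?T"
    using assms
    by (auto simp: ncpoly_tensor_def Bi_def coaction_coeff_free_star embed_carrier)
  moreover have "1 \<odot>\<^bsub>?T\<^esub> ?F = ?F"
    using assms by (simp add: ncpoly_tensor_def Bi_def embed_smult coaction_coeff_free_star)
  ultimately show ?thesis
    unfolding spread_coaction_def by (intro ncpoly_eval_word[OF T coaction_word[OF assms, symmetric]])
qed

lemma spread_identity:
  assumes sp: "boolean_spreadable_fin \<phi> n x" and k: "k \<in> {1..<n}" and w: "set w \<subseteq> {1..k}"
    and adm: "cstar_seminorm (spread_gens n k) p" "\<And>r. r \<in> spread_rels n k \<Longrightarrow> p r = 0"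
  shows "p (free_scale (joint_distribution \<phi> x (Poly_Mapping.single w 1)) (free_gen Pr) -
    free_gen Pr * (\<Sum>v | set v \<subseteq> {1..n} \<and> length v = length w.
      free_scale (joint_distribution \<phi> x (Poly_Mapping.single v 1)) (coaction_coeff n v w)) *
    free_gen Pr) = 0"
proof (rule embed_eqD)
  let ?\<mu> = "joint_distribution \<phi> x"
  let ?S = "\<Sum>v | set v \<subseteq> {1..n} \<and> length v = length w.
      free_scale (?\<mu> (Poly_Mapping.single v 1)) (coaction_coeff n v w)"
  have P: "free_gen Pr \<in> FA" by (auto intro!: free_star_algebra_gen simp: spread_gens_def)
  have S: "?S \<in> FA"
    by (intro free_star_algebra_intros coaction_coeff_free_star w)
  show "admissible p" using adm by blast
  show "free_scale (?\<mu> (Poly_Mapping.single w 1)) (free_gen Pr) \<in> FA"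
    "free_gen Pr * ?S * free_gen Pr \<in> FA"
    using P S by (auto intro!: free_star_algebra_intros)
  have T: "tensor_id (Bi n k) ?\<mu> (spread_coaction n k (Poly_Mapping.single w 1)) = embed ?S"
    unfolding spread_coaction_word[OF w] Bi_def
  proof (rule tensor_id_embed)
    show "coaction_coeff n v w = 0" if "v \<notin> {v. set v \<subseteq> {1..n} \<and> length v = length w}" for v
      using that coaction_coeff_supp[of n v w] by blast
  qed (auto simp: finite_lists_length_eq intro!: coaction_coeff_free_star w)
  have pk: "Poly_Mapping.single w 1 \<in> ncpolys k" using w by (auto simp: ncpolys_def)
  have eq: "?\<mu> (Poly_Mapping.single w 1) \<odot>\<^bsub>Bi n k\<^esub> Bi_P n k
      = Bi_P n k \<otimes>\<^bsub>Bi n k\<^esub> embed ?S \<otimes>\<^bsub>Bi n k\<^esub> Bi_P n k"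
    using sp[unfolded boolean_spreadable_fin_def, rule_format, OF k pk] by (simp only: T)
  have "Bi_P n k = embed (free_gen Pr)" by (simp add: Bi_P_def universal_gen_eq)
  with eq show "embed (free_scale (?\<mu> (Poly_Mapping.single w 1)) (free_gen Pr))
      = embed (free_gen Pr * ?S * free_gen Pr)"
    using P S by (simp add: Bi_def embed_smult embed_mult free_star_algebra_mult)
qed

end

section \<open>Representations on a two-dimensional space\<close>

definition cact :: "complex \<Rightarrow> complex \<times> complex \<Rightarrow> complex \<times> complex"
  where "cact c v = (c * fst v, c * snd v)"

lemma cact_simps [simp]:
  "cact 1 v = v" "cact 0 v = 0" "cact c (cact d v) = cact (c * d) v"
  by (simp_all add: cact_def prod_eq_iff)

lemma cact_add_left: "cact (c + d) v = cact c v + cact d v"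
  by (simp add: cact_def prod_eq_iff distrib_right)

lemma bounded_linear_cact: "bounded_linear (cact c)"
  unfolding cact_def
  by (intro bounded_linear_Pair bounded_linear_compose[OF bounded_linear_mult_right]
      bounded_linear_fst bounded_linear_snd)

lemma norm_cact: "norm (cact c v) = cmod c * norm v"
proof -
  have "norm (cact c v) = sqrt ((cmod c)\<^sup>2 * ((cmod (fst v))\<^sup>2 + (cmod (snd v))\<^sup>2))"
    by (simp add: cact_def norm_prod_def norm_mult power_mult_distrib distrib_left)
  then show ?thesis
    by (simp add: real_sqrt_mult norm_prod_def)
qed

lemma inner_cact: "inner (cact c u) v = inner u (cact (cnj c) v)"
  by (cases u; cases v) (simp add: cact_def inner_complex_def algebra_simps)

locale pair_representation =
  fixes gop :: "'g \<Rightarrow> complex \<times> complex \<Rightarrow> complex \<times> complex"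
  assumes bl_gop: "bounded_linear (gop g)"
    and gop_cact: "gop g (cact c v) = cact c (gop g v)"
    and gop_adj: "inner (gop g u) v = inner u (gop g v)"
begin

definition word_op :: "('g \<times> bool) list \<Rightarrow> complex \<times> complex \<Rightarrow> complex \<times> complex"
  where "word_op w = foldr (\<lambda>l. gop (fst l)) w"

definition rep :: "'g free_star \<Rightarrow> complex \<times> complex \<Rightarrow> complex \<times> complex"
  where "rep x v = (\<Sum>w\<in>Poly_Mapping.keys x. cact (Poly_Mapping.lookup x w) (word_op w v))"

lemma bl_word_op: "bounded_linear (word_op w)"
proof (induction w)
  case Nil
  show ?case by (simp add: word_op_def id_def bounded_linear_ident)
next
  case (Cons l w)
  have "word_op (l # w) = (\<lambda>v. gop (fst l) (word_op w v))" by (simp add: word_op_def comp_def)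
  then show ?case using bounded_linear_compose[OF bl_gop Cons.IH] by simp
qed

lemma word_op_cact: "word_op w (cact c v) = cact c (word_op w v)"
  by (induction w) (simp_all add: word_op_def gop_cact)

lemma word_op_append: "word_op (a @ b) v = word_op a (word_op b v)"
  by (simp add: word_op_def)

lemma word_op_adj: "inner (word_op (rev (map (apsnd Not) w)) u) v = inner u (word_op w v)"
proof (induction w arbitrary: u)
  case Nil
  show ?case by (simp add: word_op_def)
next
  case (Cons l w)
  have "word_op (rev (map (apsnd Not) (l # w))) u
      = word_op (rev (map (apsnd Not) w)) (gop (fst l) u)"
    by (simp add: word_op_append) (simp add: word_op_def)
  moreover have "word_op (l # w) v = gop (fst l) (word_op w v)" by (simp add: word_op_def)
  ultimately show ?case by (simp only: Cons.IH gop_adj)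
qed

lemma rep_superset:
  assumes "finite F" "Poly_Mapping.keys x \<subseteq> F"
  shows "rep x v = (\<Sum>w\<in>F. cact (Poly_Mapping.lookup x w) (word_op w v))"
  unfolding rep_def using assms
  by (intro sum.mono_neutral_left) (auto simp: in_keys_iff)

lemma rep_add: "rep (x + y) v = rep x v + rep y v"
proof -
  let ?F = "Poly_Mapping.keys x \<union> Poly_Mapping.keys y"
  have "Poly_Mapping.keys (x + y) \<subseteq> ?F" by (rule keys_add)
  then show ?thesis
    by (simp add: rep_superset[of ?F] lookup_add cact_add_left sum.distrib)
qed

lemma rep_zero: "rep 0 v = 0"
  by (simp add: rep_def)

lemma rep_sum: "rep (sum f I) v = (\<Sum>i\<in>I. rep (f i) v)"
  by (induction I rule: infinite_finite_induct) (simp_all add: rep_zero rep_add)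

lemma rep_single: "rep (Poly_Mapping.single w c) v = cact c (word_op w v)"
  by (simp add: rep_superset[of "{w}"])

lemma rep_minus: "rep (- x) v = - rep x v"
  using rep_add[of x "- x" v] by (simp add: rep_zero eq_neg_iff_add_eq_0 add.commute)

lemma rep_diff: "rep (x - y) v = rep x v - rep y v"
  using rep_add[of x "- y" v] by (simp add: rep_minus)

lemma bl_rep: "bounded_linear (rep x)"
  unfolding rep_def
  by (intro bounded_linear_sum bounded_linear_compose[OF bounded_linear_cact bl_word_op])

lemma rep_single_mult:
  "rep (Poly_Mapping.single a c * y) v = cact c (word_op a (rep y v))"
proof -
  have y: "y = (\<Sum>w\<in>Poly_Mapping.keys y. Poly_Mapping.single w (Poly_Mapping.lookup y w))"
    by (rule sum_single_lookup[symmetric]) simp_all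
  have "rep (Poly_Mapping.single a c * y) v
      = (\<Sum>w\<in>Poly_Mapping.keys y. cact c (word_op a (cact (Poly_Mapping.lookup y w) (word_op w v))))"
    by (subst y) (simp add: sum_distrib_left rep_sum mult_single rep_single plus_list_def
        word_op_append word_op_cact)
  also have "\<dots> = cact c (word_op a (rep y v))"
    unfolding rep_def
    by (simp add: linear_sum[OF bounded_linear.linear[OF bl_word_op]]
        linear_sum[OF bounded_linear.linear[OF bounded_linear_cact]])
  finally show ?thesis .
qed

lemma rep_mult: "rep (x * y) v = rep x (rep y v)"
proof -
  have x: "x = (\<Sum>w\<in>Poly_Mapping.keys x. Poly_Mapping.single w (Poly_Mapping.lookup x w))"
    by (rule sum_single_lookup[symmetric]) simp_all
  have "rep (x * y) v
      = (\<Sum>w\<in>Poly_Mapping.keys x. rep (Poly_Mapping.single w (Poly_Mapping.lookup x w) * y) v)"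
    by (subst x) (simp add: sum_distrib_right rep_sum)
  then show ?thesis by (simp add: rep_single_mult rep_def[of x])
qed

lemma rep_one: "rep 1 v = v"
proof -
  have "rep 1 v = rep (Poly_Mapping.single [] 1) v" by (simp flip: zero_list_def)
  then show ?thesis by (simp add: rep_single word_op_def)
qed

lemma rep_scale: "rep (free_scale c x) v = cact c (rep x v)"
  unfolding free_scale_def rep_single_mult by (simp add: word_op_def zero_list_def)

lemma rep_gen: "rep (free_gen g) v = gop g v"
  by (simp add: free_gen_def rep_single word_op_def)

lemma rep_adj_gen: "rep (free_adj (free_gen g)) v = gop g v"
  by (simp add: free_adj_gen rep_single word_op_def)

lemma rep_cact: "rep x (cact c v) = cact c (rep x v)"
  by (simp add: rep_def word_op_cact linear_sum[OF bounded_linear.linear[OF bounded_linear_cact]]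
      mult.commute)

lemma rep_adj: "inner (rep (free_adj x) u) v = inner u (rep x v)"
proof -
  have "inner (rep (free_adj x) u) v = (\<Sum>w\<in>Poly_Mapping.keys x.
      inner (cact (cnj (Poly_Mapping.lookup x w)) (word_op (rev (map (apsnd Not) w)) u)) v)"
    by (simp add: free_adj_def rep_sum rep_single inner_sum_left)
  also have "\<dots> = (\<Sum>w\<in>Poly_Mapping.keys x. inner u (cact (Poly_Mapping.lookup x w) (word_op w v)))"
    by (simp add: inner_cact word_op_adj word_op_cact)
  also have "\<dots> = inner u (rep x v)"
    by (simp add: rep_def inner_sum_right)
  finally show ?thesis .
qed

lemma onorm_rep: "norm (rep x v) \<le> onorm (rep x) * norm v"
  by (rule onorm[OF bl_rep])

lemma onorm_adj_le:
  assumes f: "bounded_linear f" and g: "bounded_linear g"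
    and adj: "\<And>u v. inner (g u) v = inner u (f v)"
  shows "onorm g \<le> onorm f"
proof (rule onorm_bound)
  show "0 \<le> onorm f" using f by (rule onorm_pos_le)
  fix u
  have "norm (g u) * norm (g u) = inner u (f (g u))"
    using adj[of u "g u"] by (simp add: power2_norm_eq_inner[symmetric] power2_eq_square)
  also have "\<dots> \<le> norm u * (onorm f * norm (g u))"
    using norm_cauchy_schwarz[of u "f (g u)"] onorm[OF f, of "g u"]
    by (meson mult_left_mono norm_ge_zero order_trans)
  finally show "norm (g u) \<le> onorm f * norm u"
    by (cases "norm (g u) = 0") (auto simp: onorm_pos_le[OF f] mult_ac)
qed

lemma onorm_cstar:
  assumes f: "bounded_linear f" and g: "bounded_linear g"
    and adj: "\<And>u v. inner (g u) v = inner u (f v)"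
  shows "onorm (\<lambda>v. g (f v)) = (onorm f)\<^sup>2"
proof (rule antisym)
  have gf: "bounded_linear (\<lambda>v. g (f v))" by (rule bounded_linear_compose[OF g f])
  have "onorm (\<lambda>v. g (f v)) \<le> onorm g * onorm f"
    using onorm_compose[OF g f] by (simp add: comp_def)
  also have "\<dots> \<le> onorm f * onorm f"
    using onorm_adj_le[OF f g adj] onorm_pos_le[OF f] by (rule mult_right_mono)
  finally show "onorm (\<lambda>v. g (f v)) \<le> (onorm f)\<^sup>2" by (simp add: power2_eq_square)
  have "onorm f \<le> sqrt (onorm (\<lambda>v. g (f v)))"
  proof (rule onorm_bound)
    show "0 \<le> sqrt (onorm (\<lambda>v. g (f v)))" using onorm_pos_le[OF gf] by simp
    fix v
    have "(norm (f v))\<^sup>2 = inner (g (f v)) v"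
      by (simp add: adj power2_norm_eq_inner)
    also have "\<dots> \<le> onorm (\<lambda>v. g (f v)) * norm v * norm v"
      using norm_cauchy_schwarz[of "g (f v)" v] onorm[OF gf, of v]
      by (meson mult_right_mono norm_ge_zero order_trans)
    also have "\<dots> = (sqrt (onorm (\<lambda>v. g (f v))) * norm v)\<^sup>2"
      by (simp only: power_mult_distrib real_sqrt_pow2[OF onorm_pos_le[OF gf]])
        (simp only: power2_eq_square mult.assoc)
    finally show "norm (f v) \<le> sqrt (onorm (\<lambda>v. g (f v))) * norm v"
      by (rule power2_le_imp_le) (simp add: onorm_pos_le[OF gf])
  qed
  then have "(onorm f)\<^sup>2 \<le> (sqrt (onorm (\<lambda>v. g (f v))))\<^sup>2"
    using onorm_pos_le[OF f] by (rule power_mono)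
  then show "(onorm f)\<^sup>2 \<le> onorm (\<lambda>v. g (f v))" using onorm_pos_le[OF gf] by simp
qed

lemma cstar_seminorm_rep: "cstar_seminorm G (\<lambda>x. onorm (rep x))"
  unfolding cstar_seminorm_def
proof (intro ballI conjI allI)
  fix x y :: "'g free_star" and c
  show "0 \<le> onorm (rep x)" by (rule onorm_pos_le[OF bl_rep])
  have "rep (free_adj x * x) = (\<lambda>v. rep (free_adj x) (rep x v))"
    by (rule ext) (rule rep_mult)
  then show "onorm (rep (free_adj x * x)) = (onorm (rep x))\<^sup>2"
    using onorm_cstar[OF bl_rep bl_rep rep_adj] by simp
  show "onorm (rep (free_scale c x)) = cmod c * onorm (rep x)"
  proof (cases "c = 0")
    case True
    then show ?thesis by (simp add: rep_zero[abs_def] onorm_zero)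
  next
    case False
    have le: "onorm (rep (free_scale c x)) \<le> cmod c * onorm (rep x)" for c x
    proof (rule onorm_bound)
      show "0 \<le> cmod c * onorm (rep x)" by (simp add: onorm_pos_le[OF bl_rep])
      show "norm (rep (free_scale c x) v) \<le> cmod c * onorm (rep x) * norm v" for v
        using mult_left_mono[OF onorm_rep[of x v], of "cmod c"]
        by (simp add: rep_scale norm_cact mult.assoc)
    qed
    have "free_scale (inverse c) (free_scale c x) = x"
      using False by (simp add: free_scale_def mult.assoc[symmetric] mult_single)
    then have "onorm (rep x) \<le> inverse (cmod c) * onorm (rep (free_scale c x))"
      using le[of "inverse c" "free_scale c x"] by (simp add: norm_inverse)
    then have "cmod c * onorm (rep x) \<le> onorm (rep (free_scale c x))"
      using False by (simp add: field_simps)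
    with le[of c x] show ?thesis by simp
  qed
  have "rep (x + y) = (\<lambda>v. rep x v + rep y v)" by (rule ext) (rule rep_add)
  then show "onorm (rep (x + y)) \<le> onorm (rep x) + onorm (rep y)"
    using onorm_triangle[OF bl_rep bl_rep] by simp
  have "rep (x * y) = rep x \<circ> rep y" by (rule ext) (simp add: rep_mult)
  then show "onorm (rep (x * y)) \<le> onorm (rep x) * onorm (rep y)"
    using onorm_compose[OF bl_rep bl_rep] by simp
qed

end

definition avg :: "complex \<times> complex \<Rightarrow> complex \<times> complex"
  where "avg v = ((fst v + snd v) / 2, (fst v + snd v) / 2)"

lemma avg_idem [simp]: "avg (avg v) = avg v"
  by (simp add: avg_def)

text \<open>Between two coordinate projections, the rank one projection \<open>avg\<close> onto \<open>(1, 1)\<close> forgets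
  which of them was used. Hence letters outside \<open>S\<close> on the two sides of a nonempty block of letters
  in \<open>S\<close> are moved by \<open>f\<close> or \<open>g\<close> independently of each other.\<close>

fun spread_op :: "nat set \<Rightarrow> (nat \<Rightarrow> nat) \<Rightarrow> (nat \<Rightarrow> nat) \<Rightarrow> spread_gen \<Rightarrow>
    complex \<times> complex \<Rightarrow> complex \<times> complex" where
  "spread_op S f g Pr v = avg v"
| "spread_op S f g (U i j) v = (if j \<in> S then if i = f j then avg v else 0
    else (if i = f j then fst v else 0, if i = g j then snd v else 0))"

lemma pair_representation_spread_op: "pair_representation (spread_op S f g)"
proof (rule pair_representation.intro)
  fix h :: spread_gen and u v :: "complex \<times> complex" and c :: complex
  have avg: "bounded_linear avg"
    unfolding avg_def
    by (intro bounded_linear_Pair bounded_linear_compose[OF bounded_linear_divide]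
        bounded_linear_add bounded_linear_fst bounded_linear_snd)
  have avg': "inner (avg u) v = inner u (avg v)"
    by (cases u; cases v) (simp add: avg_def algebra_simps inner_complex_def add_divide_distrib)
  show "bounded_linear (spread_op S f g h)"
  proof (cases h)
    case (U i j)
    have "bounded_linear (\<lambda>v. if i = f j then fst v else 0 :: complex)"
      "bounded_linear (\<lambda>v. if i = g j then snd v else 0 :: complex)"
      by (cases "i = f j"; simp add: bounded_linear_fst)
        (cases "i = g j"; simp add: bounded_linear_snd)
    then have "bounded_linear (\<lambda>v. (if i = f j then fst v else 0, if i = g j then snd v else 0)
        :: complex \<times> complex)"
      by (rule bounded_linear_Pair)
    moreover have "spread_op S f g (U i j) = (if j \<in> S then if i = f j then avg else (\<lambda>_. 0)
        else (\<lambda>v. (if i = f j then fst v else 0, if i = g j then snd v else 0)))"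
      by (rule ext) simp
    ultimately show ?thesis using avg U by simp
  next
    case Pr
    have "spread_op S f g Pr = avg" by (rule ext) simp
    then show ?thesis using avg Pr by simp
  qed
  show "spread_op S f g h (cact c v) = cact c (spread_op S f g h v)"
    by (cases h) (auto simp: avg_def cact_def prod_eq_iff algebra_simps)
  show "inner (spread_op S f g h u) v = inner u (spread_op S f g h v)"
    using avg' by (cases h; cases u; cases v) auto
qed

locale two_maps =
  fixes n k :: nat and S :: "nat set" and f g :: "nat \<Rightarrow> nat"
  assumes mono_f: "strict_mono_on {1..k} f" and mono_g: "strict_mono_on {1..k} g"
    and range_f: "f ` {1..k} \<subseteq> {1..n}" and range_g: "g ` {1..k} \<subseteq> {1..n}"
    and eq_on_S: "j \<in> {1..k} \<Longrightarrow> j \<in> S \<Longrightarrow> f j = g j"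
begin

sublocale pair_representation "spread_op S f g"
  by (rule pair_representation_spread_op)

lemma rep_rel:
  assumes "r \<in> spread_rels n k" shows "rep r v = 0"
proof -
  have idem: "spread_op S f g h (spread_op S f g h v) = spread_op S f g h v" for h
    by (cases h) auto
  have total: "(\<Sum>i=1..n. spread_op S f g (U i j) (avg v)) = avg v" if "j \<in> {1..k}" for j
  proof -
    have "f j \<in> {1..n}" "g j \<in> {1..n}" using that range_f range_g by blast+
    then show ?thesis
      by (cases "j \<in> S") (simp_all add: prod_eq_iff fst_sum snd_sum)
  qed
  have orth: "spread_op S f g (U i j) (spread_op S f g (U i' j') v) = 0"
    if "j \<in> {1..k}" "j' \<in> {1..k}" "j < j'" "i \<ge> i'" for i j i' j'
  proof -
    have "f j < f j'" "g j < g j'"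
      using strict_mono_onD[OF mono_f] strict_mono_onD[OF mono_g] that by auto
    then show ?thesis
      using eq_on_S[of j] eq_on_S[of j'] that by (auto simp: prod_eq_iff avg_def)
  qed
  show ?thesis
    using assms unfolding spread_rels_def
  proof (elim UnE)
    assume "r \<in> (\<Union>h\<in>spread_gens n k.
      {free_adj (free_gen h) - free_gen h, free_gen h * free_gen h - free_gen h})"
    then obtain h where "r = free_adj (free_gen h) - free_gen h
        \<or> r = free_gen h * free_gen h - free_gen h"
      by blast
    then show ?thesis
      by (elim disjE) (simp_all only: rep_diff rep_adj_gen rep_gen rep_mult idem diff_self)
  next
    assume "r \<in> {(\<Sum>i=1..n. free_gen (U i j) * free_gen Pr) - free_gen Pr | j. j \<in> {1..k}}"
    then obtain j where j: "r = (\<Sum>i=1..n. free_gen (U i j) * free_gen Pr) - free_gen Pr"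
      "j \<in> {1..k}"
      by blast
    have "spread_op S f g Pr v = avg v" by simp
    then show ?thesis
      by (simp only: j(1) rep_diff rep_sum rep_mult rep_gen total[OF j(2)] diff_self)
  next
    assume "r \<in> {free_gen (U i j) * free_gen (U i' j') | i j i' j'.
      i \<in> {1..n} \<and> i' \<in> {1..n} \<and> j \<in> {1..k} \<and> j' \<in> {1..k} \<and> j < j' \<and> i \<ge> i'}"
    then obtain i j i' j' where r: "r = free_gen (U i j) * free_gen (U i' j')"
      and *: "j \<in> {1..k}" "j' \<in> {1..k}" "j < j'" "i \<ge> i'"
      by blast
    show ?thesis by (simp only: r rep_mult rep_gen orth[OF *])
  qed
qed

fun transform :: "nat list \<Rightarrow> (nat list \<Rightarrow> complex \<times> complex) \<Rightarrow> complex \<times> complex" where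
  "transform [] H = H []"
| "transform (j # w) H = (\<Sum>i=1..n. spread_op S f g (U i j) (transform w (\<lambda>v. H (i # v))))"

lemma transform_append:
  "transform (v @ w) H = transform v (\<lambda>v'. transform w (\<lambda>w'. H (v' @ w')))"
  by (induction v arbitrary: H) simp_all

lemma transform_sum:
  "transform w H
    = (\<Sum>v | set v \<subseteq> {1..n} \<and> length v = length w. rep (coaction_coeff n v w) (H v))"
proof (induction w arbitrary: H)
  case Nil
  have "{v. set v \<subseteq> {1..n} \<and> length v = length []} = {[]}" by auto
  then show ?case by (simp add: rep_one)
next
  case (Cons j w)
  let ?W = "{v. set v \<subseteq> {1..n} \<and> length v = length w}"
  have "{v. set v \<subseteq> {1..n} \<and> length v = length (j # w)} = (\<lambda>(i, v). i # v) ` ({1..n} \<times> ?W)"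
  proof (intro equalityI subsetI)
    fix v assume "v \<in> {v. set v \<subseteq> {1..n} \<and> length v = length (j # w)}"
    then obtain i u where "v = i # u" "i \<in> {1..n}" "u \<in> ?W" by (cases v) auto
    then show "v \<in> (\<lambda>(i, v). i # v) ` ({1..n} \<times> ?W)" by force
  qed auto
  then have "(\<Sum>v | set v \<subseteq> {1..n} \<and> length v = length (j # w). rep (coaction_coeff n v (j # w)) (H v))
      = (\<Sum>(i, v)\<in>{1..n} \<times> ?W. rep (coaction_coeff n (i # v) (j # w)) (H (i # v)))"
    by (simp only:) (subst sum.reindex, auto simp: inj_on_def intro!: sum.cong)
  also have "\<dots> = (\<Sum>i=1..n. \<Sum>v\<in>?W. rep (coaction_coeff n (i # v) (j # w)) (H (i # v)))"
    by (simp only: sum.cartesian_product)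
  also have "\<dots> = (\<Sum>i=1..n. spread_op S f g (U i j) (transform w (\<lambda>v. H (i # v))))"
    by (intro sum.cong refl)
      (simp add: Cons.IH rep_mult rep_gen linear_sum[OF bounded_linear.linear[OF bl_gop]]
        del: spread_op.simps)
  finally show ?case by simp
qed

lemma transform_outside:
  assumes "set w \<subseteq> {1..k} - S"
  shows "transform w H = (fst (H (map f w)), snd (H (map g w)))"
  using assms
proof (induction w arbitrary: H)
  case (Cons j w)
  have "f j \<in> {1..n}" "g j \<in> {1..n}" "j \<notin> S" using Cons.prems range_f range_g by (auto dest!: subsetD)
  then show ?case
    using Cons by (simp add: prod_eq_iff fst_sum snd_sum)
qed simp

lemma transform_inside:
  assumes "set w \<subseteq> {1..k} \<inter> S" "w \<noteq> []"
  shows "transform w H = avg (H (map f w))"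
  using assms
proof (induction w arbitrary: H)
  case (Cons j w)
  have "f j \<in> {1..n}" "j \<in> S" using Cons.prems range_f by (auto dest!: subsetD)
  then show ?case
    using Cons by (cases "w = []") simp_all
qed simp

lemma spread_moments:
  assumes sp: "boolean_spreadable_fin \<phi> n x" and k: "k \<in> {1..<n}"
    and v: "set v \<subseteq> {1..k} - S" and w: "set w \<subseteq> {1..k} - S"
    and c: "set c \<subseteq> {1..k} \<inter> S" "c \<noteq> []"
    and \<mu>: "\<And>u. \<mu> u = joint_distribution \<phi> x (Poly_Mapping.single u 1)"
  shows "4 * \<mu> (v @ c @ w) =
    \<mu> (map f v @ map f c @ map f w) + \<mu> (map f v @ map f c @ map g w) +
    \<mu> (map g v @ map f c @ map f w) + \<mu> (map g v @ map f c @ map g w)"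
proof -
  let ?u = "(1, 1) :: complex \<times> complex" and ?w = "v @ c @ w"
  let ?S = "\<Sum>v | set v \<subseteq> {1..n} \<and> length v = length ?w. free_scale (\<mu> v) (coaction_coeff n v ?w)"
  let ?z = "free_scale (\<mu> ?w) (free_gen Pr) - free_gen Pr * ?S * free_gen Pr"
  have "onorm (rep ?z) = 0"
    unfolding \<mu>
  proof (rule spread_identity[OF sp k])
    show "set ?w \<subseteq> {1..k}" using v w c by auto
    show "onorm (rep r) = 0" if "r \<in> spread_rels n k" for r
      using rep_rel[OF that] by (simp add: onorm_eq_0[OF bl_rep])
  qed (rule cstar_seminorm_rep)
  then have "rep ?z ?u = 0" by (simp add: onorm_eq_0[OF bl_rep])
  moreover have "rep ?z ?u = cact (\<mu> ?w) (avg ?u) - avg (rep ?S (avg ?u))"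
    by (simp add: rep_diff rep_scale rep_gen rep_mult)
  moreover have "rep ?S ?u = transform ?w (\<lambda>v. cact (\<mu> v) ?u)"
    by (simp only: transform_sum rep_sum rep_scale rep_cact)
  moreover have "avg ?u = ?u" by (simp add: avg_def)
  ultimately have "cact (\<mu> ?w) ?u = avg (transform ?w (\<lambda>v. cact (\<mu> v) ?u))" by simp
  also have "transform ?w (\<lambda>v. cact (\<mu> v) ?u)
      = ((\<mu> (map f v @ map f c @ map f w) + \<mu> (map f v @ map f c @ map g w)) / 2,
         (\<mu> (map g v @ map f c @ map f w) + \<mu> (map g v @ map f c @ map g w)) / 2)"
    by (simp add: transform_append transform_outside[OF v] transform_inside[OF c]
        transform_outside[OF w] cact_def avg_def)
  finally have "4 * \<mu> ?w = 4 * (((\<mu> (map f v @ map f c @ map f w) + \<mu> (map f v @ map f c @ map g w)) / 2 +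
      (\<mu> (map g v @ map f c @ map f w) + \<mu> (map g v @ map f c @ map g w)) / 2) / 2)"
    by (simp only: cact_def avg_def fst_conv snd_conv prod.inject mult_1_right)
  also have "4 * ((((a :: complex) + b) / 2 + (c + d) / 2) / 2) = a + b + c + d" for a b c d
    by (simp add: field_simps)
  finally show ?thesis .
qed

end

section \<open>Complex inner products and moments\<close>

lemma cinner_add_left: "cinner (x + y) z = cinner x z + cinner y (z :: 'a::complex_inner)"
  by (metis cinner_add_right cinner_commute complex_cnj_add)

lemma cinner_scaleC_left: "cinner (c *\<^sub>C x) (y :: 'a::complex_inner) = cnj c * cinner x y"
  by (metis cinner_scaleC_right cinner_commute complex_cnj_mult)

lemma cinner_scaleR_right: "cinner x (r *\<^sub>R (y :: 'a::complex_inner)) = r *\<^sub>R cinner x y"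
  by (metis cinner_scaleC_right scaleC_of_real scaleR_conv_of_real)

lemma cinner_scaleR_left: "cinner (r *\<^sub>R x) (y :: 'a::complex_inner) = r *\<^sub>R cinner x y"
  by (metis cinner_scaleC_left scaleC_of_real scaleR_conv_of_real complex_cnj_complex_of_real)

lemma scaleC_one [simp]: "1 *\<^sub>C x = (x :: 'a::complex_normed_vector)"
  using scaleC_of_real[of 1 x] by simp

lemma scaleC_zero_left [simp]: "0 *\<^sub>C x = (0 :: 'a::complex_normed_vector)"
  using scaleC_of_real[of 0 x] by simp

lemma scaleC_minus_one: "(- 1) *\<^sub>C x = - (x :: 'a::complex_normed_vector)"
  using scaleC_of_real[of "-1" x] by simp

lemma scaleC_zero_right [simp]: "c *\<^sub>C (0 :: 'a::complex_normed_vector) = 0"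
  using scaleC_add_right[of c 0 "0 :: 'a"] by simp

lemma complex_cauchy_schwarz: "cmod (cinner x y) \<le> norm x * norm (y :: 'a::complex_inner)"
proof (cases "y = 0")
  case True
  then show ?thesis using cinner_scaleC_right[of x 0 y] by simp
next
  case False
  define n where "n = (norm y)\<^sup>2"
  define c where "c = cinner y x / complex_of_real n"
  have n: "n > 0" using False by (simp add: n_def)
  have xy: "cinner y x = cnj (cinner x y)" by (rule cinner_commute)
  have "complex_of_real ((norm (x + (- c) *\<^sub>C y))\<^sup>2)
      = cinner x x - c * cinner x y - cnj c * cinner y x + cnj c * c * cinner y y"
    unfolding cinner_self[symmetric]
    by (simp only: cinner_add_left cinner_add_right cinner_scaleC_left cinner_scaleC_right)
      (simp add: algebra_simps)
  also have "\<dots> = complex_of_real ((norm x)\<^sup>2) - cinner x y * cnj (cinner x y) / complex_of_real n"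
    using n by (simp add: cinner_self[of x] cinner_self[of y] c_def xy flip: n_def)
  also have "\<dots> = complex_of_real ((norm x)\<^sup>2 - (cmod (cinner x y))\<^sup>2 / n)"
    by (simp flip: complex_norm_square)
  finally have "(norm (x + (- c) *\<^sub>C y))\<^sup>2 = (norm x)\<^sup>2 - (cmod (cinner x y))\<^sup>2 / n"
    using of_real_eq_iff by blast
  then have "(cmod (cinner x y))\<^sup>2 / n \<le> (norm x)\<^sup>2"
    by (smt (verit) zero_le_power2)
  then have "(cmod (cinner x y))\<^sup>2 \<le> (norm x * norm y)\<^sup>2"
    using n by (simp add: divide_le_eq n_def power_mult_distrib)
  then show ?thesis by (rule power2_le_imp_le) simp
qed

interpretation cinner: bounded_bilinear "cinner :: 'a::complex_inner \<Rightarrow> 'a \<Rightarrow> complex"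
proof
  show "\<exists>K. \<forall>x y :: 'a. norm (cinner x y) \<le> norm x * norm y * K"
    by (rule exI[of _ 1]) (simp add: complex_cauchy_schwarz)
qed (simp_all add: cinner_add_left cinner_add_right cinner_scaleR_left cinner_scaleR_right)

lemma norm_add_squared:
  "(norm (x + y))\<^sup>2 = (norm x)\<^sup>2 + 2 * Re (cinner x y) + (norm (y :: 'a::complex_inner))\<^sup>2"
proof -
  have "complex_of_real ((norm (x + y))\<^sup>2)
      = complex_of_real ((norm x)\<^sup>2) + (cinner x y + cnj (cinner x y)) + complex_of_real ((norm y)\<^sup>2)"
    unfolding cinner_self[symmetric] cinner_commute[of y x, symmetric]
    by (simp add: cinner_add_left cinner_add_right)
  also have "\<dots> = complex_of_real ((norm x)\<^sup>2 + 2 * Re (cinner x y) + (norm y)\<^sup>2)"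
    by (simp add: complex_add_cnj)
  finally show ?thesis using of_real_eq_iff by blast
qed

lemma norm_squared_cinner: "(norm x)\<^sup>2 = Re (cinner x (x :: 'a::complex_inner))"
  by (simp add: cinner_self)

lemma cbounded_ops_intros:
  "0 \<in> cbounded_ops" "id_blinfun \<in> cbounded_ops"
  "a \<in> cbounded_ops \<Longrightarrow> b \<in> cbounded_ops \<Longrightarrow> a + b \<in> cbounded_ops"
  "a \<in> cbounded_ops \<Longrightarrow> c *\<^sub>C a \<in> cbounded_ops"
  "a \<in> cbounded_ops \<Longrightarrow> b \<in> cbounded_ops \<Longrightarrow> a o\<^sub>L b \<in> cbounded_ops"
  by (simp_all add: cbounded_ops_def plus_blinfun.rep_eq scaleC_add_right scaleC_blinfun.rep_eq
      scaleC_scaleC mult.commute)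

definition word_product :: "('v \<Rightarrow> ('h::chilbert_space \<Rightarrow>\<^sub>L 'h)) \<Rightarrow> 'v list \<Rightarrow> 'h \<Rightarrow>\<^sub>L 'h"
  where "word_product x w = foldr (\<lambda>v b. x v o\<^sub>L b) w id_blinfun"

lemma word_product_simps [simp]:
  "word_product x [] = id_blinfun" "word_product x (v # w) = x v o\<^sub>L word_product x w"
  by (simp_all add: word_product_def)

lemma word_product_map: "word_product (x \<circ> i) w = word_product x (map i w)"
  by (induction w) simp_all

lemma word_product_cbounded: "(\<And>v. x v \<in> cbounded_ops) \<Longrightarrow> word_product x w \<in> cbounded_ops"
  by (induction w) (simp_all add: cbounded_ops_intros)

lemma joint_distribution_word:
  fixes x :: "nat \<Rightarrow> ('h::chilbert_space \<Rightarrow>\<^sub>L 'h)"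
  assumes "\<And>v. x v \<in> cbounded_ops"
  shows "joint_distribution \<phi> x (Poly_Mapping.single w 1) = \<phi> (word_product x w)"
proof -
  have "abelian_monoid (op_algebra :: (complex, 'h \<Rightarrow>\<^sub>L 'h) module)"
    by (rule abelian_monoidI) (simp_all add: op_algebra_def cbounded_ops_intros algebra_simps)
  then have "ncpoly_eval op_algebra x (Poly_Mapping.single w 1) = word_product x w"
    by (rule ncpoly_eval_word)
      (simp_all add: op_algebra_def word_product_def[symmetric] word_product_cbounded assms)
  then show ?thesis by (simp add: joint_distribution_def)
qed

lemma boolean_spreadable_moments:
  fixes x :: "int \<Rightarrow> ('h::chilbert_space \<Rightarrow>\<^sub>L 'h)" and M :: int
  assumes sp: "boolean_spreadable \<phi> x" and x: "\<And>i. x i \<in> cbounded_ops"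
    and f: "strict_mono f" "\<And>j. j \<le> f j" "\<And>j. f j \<le> j + M"
    and g: "strict_mono g" "\<And>j. j \<le> g j" "\<And>j. g j \<le> j + M"
    and eq: "\<And>j. j \<in> set c \<Longrightarrow> f j = g j" and disj: "(set v \<union> set w) \<inter> set c = {}"
    and c: "c \<noteq> []" and \<mu>: "\<And>u. \<mu> u = \<phi> (word_product x u)"
  shows "4 * \<mu> (v @ c @ w) =
    \<mu> (map f v @ map f c @ map f w) + \<mu> (map f v @ map f c @ map g w) +
    \<mu> (map g v @ map f c @ map f w) + \<mu> (map g v @ map f c @ map g w)"
proof -
  define I where "I = set (v @ c @ w)"
  define a where "a = Min I - 1"
  define k where "k = nat (Max I - a)"
  define n where "n = k + nat M + 1"
  define i where "i j = int j + a" for j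
  define r where "r j = nat (j - a)" for j
  have I: "finite I" "I \<noteq> {}" using c by (auto simp: I_def)
  have M: "M \<ge> 0" using f(2)[of 0] f(3)[of 0] by linarith
  have le: "Min I \<le> j" "j \<le> Max I" if "j \<in> I" for j using that I by auto
  have "Min I \<le> Max I" using I by simp
  then have k: "k \<in> {1..<n}" by (auto simp: n_def k_def a_def)
  have rI: "r j \<in> {1..k}" "i (r j) = j" if "j \<in> I" for j
    using le[OF that] by (auto simp: r_def a_def k_def i_def)
  have ri: "r (i j) = j" for j by (simp add: r_def i_def)
  have range: "r (h (i j)) \<in> {1..n}" "i (r (h (i j))) = h (i j)"
    if h: "\<And>j. j \<le> h j" "\<And>j. h j \<le> j + M" and j: "j \<in> {1..k}" for h j
    using h(1)[of "i j"] h(2)[of "i j"] j M by (auto simp: r_def i_def n_def)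
  have mono: "strict_mono_on {1..k} (\<lambda>j. r (h (i j)))"
    if h: "strict_mono h" "\<And>j. j \<le> h j" for h
  proof (rule strict_mono_onI)
    fix j j' assume "j \<in> {1..k}" "j' \<in> {1..k}" "j < j'"
    then have "h (i j) < h (i j')" using h(1) by (simp add: strict_mono_def i_def)
    then show "r (h (i j)) < r (h (i j'))"
      using h(2)[of "i j"] \<open>j \<in> {1..k}\<close> by (simp add: r_def i_def)
  qed
  interpret two_maps n k "r ` set c" "\<lambda>j. r (f (i j))" "\<lambda>j. r (g (i j))"
  proof
    fix j assume "j \<in> r ` set c"
    then obtain j' where "j' \<in> set c" "j = r j'" by blast
    then show "r (f (i j)) = r (g (i j))" using eq[of j'] rI(2)[of j'] by (simp add: I_def)
  qed (use mono f g range(1) in auto)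
  have xi: "boolean_spreadable_fin \<phi> n (x \<circ> i)"
    using sp unfolding boolean_spreadable_def
    by (auto simp: strict_mono_on_def i_def)
  have sub: "set v \<subseteq> I" "set w \<subseteq> I" "set c \<subseteq> I" by (auto simp: I_def)
  have rinj: "inj_on r I" using rI(2) by (metis inj_onI)
  have \<mu>i: "\<mu> (map i u) = joint_distribution \<phi> (x \<circ> i) (Poly_Mapping.single u 1)" for u
    using x by (simp add: joint_distribution_word \<mu> word_product_map)
  have outside: "set (map r u) \<subseteq> {1..k} - r ` set c" if "set u \<subseteq> I" "set u \<inter> set c = {}" for u
    using that rI(1) sub rinj by (fastforce dest: inj_onD)
  have m1: "map i (map r u) = u" if "set u \<subseteq> I" for u
    using that rI(2) by (simp add: map_idI subset_iff)
  have m2: "map i (map (\<lambda>j. r (h (i j))) (map r u)) = map h u"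
    if "set u \<subseteq> I" "\<And>j. j \<le> h j" "\<And>j. h j \<le> j + M" for u h
  proof -
    have "i (r (h x)) = h x" if "x \<in> I" for x
      using range(2)[of h "r x"] rI[OF that] \<open>\<And>j. j \<le> h j\<close> \<open>\<And>j. h j \<le> j + M\<close> by metis
    then show ?thesis using \<open>set u \<subseteq> I\<close> rI(2) by (auto simp: subset_iff)
  qed
  have "4 * \<mu> (map i (map r v @ map r c @ map r w)) =
    \<mu> (map i (map (\<lambda>j. r (f (i j))) (map r v) @ map (\<lambda>j. r (f (i j))) (map r c) @ map (\<lambda>j. r (f (i j))) (map r w))) +
    \<mu> (map i (map (\<lambda>j. r (f (i j))) (map r v) @ map (\<lambda>j. r (f (i j))) (map r c) @ map (\<lambda>j. r (g (i j))) (map r w))) +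
    \<mu> (map i (map (\<lambda>j. r (g (i j))) (map r v) @ map (\<lambda>j. r (f (i j))) (map r c) @ map (\<lambda>j. r (f (i j))) (map r w))) +
    \<mu> (map i (map (\<lambda>j. r (g (i j))) (map r v) @ map (\<lambda>j. r (f (i j))) (map r c) @ map (\<lambda>j. r (g (i j))) (map r w)))"
  proof (rule spread_moments[OF xi k])
    show "set (map r v) \<subseteq> {1..k} - r ` set c" "set (map r w) \<subseteq> {1..k} - r ` set c"
      using outside[of v] outside[of w] disj sub by auto
    show "set (map r c) \<subseteq> {1..k} \<inter> r ` set c" using sub rI(1) by auto
  qed (use c \<mu>i in auto)
  then show ?thesis
    unfolding map_append by (simp only: m1 m2 sub f g)
qed

section \<open>Weak operator closures\<close>

lemma topspace_wot [simp]: "topspace weak_operator_topology = UNIV"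
  by (simp add: weak_operator_topology_def topspace_pullback_topology)

lemma open_finite_cylinder:
  assumes "finite F" shows "open (\<Inter>p\<in>F. {h :: 'p \<Rightarrow> complex. cmod (h p - m p) < e})"
proof -
  have op: "open {h :: 'p \<Rightarrow> complex. cmod (h p - m p) < e}" for p
    by (rule open_Collect_less[OF continuous_on_norm[OF continuous_on_diff[OF
        continuous_on_product_coordinates continuous_on_const]] continuous_on_const])
  show ?thesis by (rule open_INT[OF assms]) (rule ballI, rule op)
qed

lemma wot_closure_iff:
  "a \<in> weak_operator_topology closure_of S \<longleftrightarrow>
    (\<forall>F e. finite F \<and> e > 0 \<longrightarrow> (\<exists>s\<in>S. \<forall>(u, v)\<in>F.
      cmod (cinner u (blinfun_apply s v) - cinner u (blinfun_apply a v)) < e))"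
  (is "?lhs \<longleftrightarrow> ?rhs")
proof -
  define ev :: "('a \<Rightarrow>\<^sub>L 'a) \<Rightarrow> 'a \<times> 'a \<Rightarrow> complex"
    where "ev = (\<lambda>a (u, v). cinner u (blinfun_apply a v))"
  have ev: "ev a (u, v) = cinner u (blinfun_apply a v)" for a u v by (simp add: ev_def)
  have openin: "openin weak_operator_topology T \<longleftrightarrow> (\<exists>U. open U \<and> T = ev -` U)" for T
    by (simp add: weak_operator_topology_def openin_pullback_topology ev_def flip: open_openin)
  have rhs: "?rhs \<longleftrightarrow> (\<forall>F e. finite F \<and> e > 0 \<longrightarrow> (\<exists>s\<in>S. \<forall>p\<in>F. cmod (ev s p - ev a p) < e))"
    by (simp add: ev_def split_def)
  show ?thesis unfolding rhs
  proof (intro iffI allI impI)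
    fix F :: "('a \<times> 'a) set" and e :: real
    assume a: ?lhs and F: "finite F \<and> e > 0"
    let ?O = "\<Inter>p\<in>F. {h. cmod (h p - ev a p) < e}"
    have "open ?O" using F by (intro open_finite_cylinder) simp
    then have op: "openin weak_operator_topology (ev -` ?O)" unfolding openin by blast
    have mem: "a \<in> ev -` ?O" using F by simp
    obtain s where "s \<in> S" "s \<in> ev -` ?O"
      using a[unfolded in_closure_of, THEN conjunct2, rule_format, OF conjI, OF mem op] by (elim exE conjE)
    then show "\<exists>s\<in>S. \<forall>p\<in>F. cmod (ev s p - ev a p) < e"
      by (intro bexI[of _ s]) simp_all
  next
    assume *: "\<forall>F e. finite F \<and> e > 0 \<longrightarrow> (\<exists>s\<in>S. \<forall>p\<in>F. cmod (ev s p - ev a p) < e)"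
    show ?lhs
      unfolding in_closure_of
    proof (intro conjI allI impI)
      show "a \<in> topspace weak_operator_topology" by simp
      fix T assume T: "a \<in> T \<and> openin weak_operator_topology T"
      then obtain U where U: "open U" "T = ev -` U"
        unfolding openin by blast
      have U': "openin (product_topology (\<lambda>_. euclidean) UNIV) U"
        using U(1) by (simp add: euclidean_product_topology flip: open_openin)
      have "ev a \<in> U" using T U by auto
      then obtain X where X: "ev a \<in> Pi\<^sub>E UNIV X" "\<And>p. openin euclidean (X p)"
        "finite {p. X p \<noteq> topspace euclidean}" "Pi\<^sub>E UNIV X \<subseteq> U"
        using product_topology_open_contains_basis[OF U'] by blast
      define F where "F = {p. X p \<noteq> UNIV}"
      have F: "finite F" using X(3) by (simp add: F_def)
      have "\<exists>e>0. \<forall>z. dist z (ev a p) < e \<longrightarrow> z \<in> X p" for p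
      proof -
        have "open (X p)" "ev a p \<in> X p" using X(2)[of p] PiE_mem[OF X(1), of p] by (simp_all flip: open_openin)
        then show ?thesis unfolding open_dist by blast
      qed
      then obtain r where r: "\<And>p. r p > 0" "\<And>p z. dist z (ev a p) < r p \<Longrightarrow> z \<in> X p" by metis
      define e where "e = Min (insert 1 (r ` F))"
      have e: "e > 0" "\<And>p. p \<in> F \<Longrightarrow> e \<le> r p" using F r(1) by (auto simp: e_def)
      then obtain s where s: "s \<in> S" "\<forall>p\<in>F. cmod (ev s p - ev a p) < e"
        using * F by blast
      have "ev s p \<in> X p" for p
      proof (cases "p \<in> F")
        case True
        then have "dist (ev s p) (ev a p) < e" using s(2) by (simp add: dist_norm)
        then show ?thesis using r(2)[of "ev s p" p] e(2)[OF True] by linarith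
      qed (simp add: F_def)
      then have "ev s \<in> U" using X(4) by (auto simp: PiE_iff)
      then show "\<exists>s. s \<in> S \<and> s \<in> T" using s(1) U(2) by blast
    qed
  qed
qed

lemma orthogonal_if_minimal:
  fixes z v :: "'a::complex_inner"
  assumes "\<And>t. norm z \<le> norm (z + t *\<^sub>C v)"
  shows "cinner z v = 0"
proof (rule ccontr)
  let ?c = "cinner z v"
  assume "?c \<noteq> 0"
  define s where "s = 1 / ((norm v)\<^sup>2 + 1)"
  have s: "s > 0" "s * (norm v)\<^sup>2 < 1"
    by (simp_all add: s_def add_nonneg_pos divide_less_eq)
  let ?t = "- (complex_of_real s * cnj ?c)"
  have "(norm z)\<^sup>2 \<le> (norm (z + ?t *\<^sub>C v))\<^sup>2"
    using assms by (intro power_mono) simp_all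
  also have "\<dots> = (norm z)\<^sup>2 + 2 * Re (?t * ?c) + (cmod ?t)\<^sup>2 * (norm v)\<^sup>2"
    by (simp only: norm_add_squared cinner_scaleC_right norm_scaleC power_mult_distrib)
  also have "Re (?t * ?c) = - s * (cmod ?c)\<^sup>2"
    by (simp add: cmod_power2) (simp add: power2_eq_square algebra_simps)
  also have "(cmod ?t)\<^sup>2 = s\<^sup>2 * (cmod ?c)\<^sup>2"
    using s by (simp add: norm_mult power_mult_distrib)
  finally have "2 * s * (cmod ?c)\<^sup>2 \<le> s * (s * (norm v)\<^sup>2) * (cmod ?c)\<^sup>2"
    by (simp add: power2_eq_square mult_ac)
  then have "2 * s \<le> s * (s * (norm v)\<^sup>2)" using \<open>?c \<noteq> 0\<close> by (simp add: mult_le_cancel_right)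
  then have "2 \<le> s * (norm v)\<^sup>2" using s(1) by simp
  then show False using s(2) by simp
qed

lemma parallelogram:
  "(norm (x + y))\<^sup>2 + (norm (x - y))\<^sup>2 = 2 * (norm x)\<^sup>2 + 2 * (norm (y :: 'a::complex_inner))\<^sup>2"
  using norm_add_squared[of x y] norm_add_squared[of x "- y"] by (simp add: cinner.minus_right)

lemma in_closure_if_orthogonal:
  fixes V :: "'a::chilbert_space set"
  assumes V0: "0 \<in> V" and add: "\<And>u v. u \<in> V \<Longrightarrow> v \<in> V \<Longrightarrow> u + v \<in> V"
    and scale: "\<And>c v. v \<in> V \<Longrightarrow> c *\<^sub>C v \<in> V"
    and orth: "\<And>z. (\<And>v. v \<in> V \<Longrightarrow> cinner z v = 0) \<Longrightarrow> cinner z \<eta> = 0"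
  shows "\<eta> \<in> closure V"
proof -
  define d where "d = infdist \<eta> V"
  have d0: "d \<ge> 0" by (simp add: d_def infdist_nonneg)
  have dle: "d \<le> norm (\<eta> - v)" if "v \<in> V" for v
    using infdist_le[OF that, of \<eta>] by (simp add: d_def dist_norm)
  have "\<exists>v\<in>V. norm (\<eta> - v) < d + inverse (real (Suc n))" for n
  proof -
    have "V \<noteq> {}" "bdd_below (dist \<eta> ` V)" using V0 by (auto intro: bdd_belowI[of _ 0])
    moreover have "(INF v\<in>V. dist \<eta> v) < d + inverse (real (Suc n))"
      using infdist_notempty[of V \<eta>] \<open>V \<noteq> {}\<close> by (simp add: d_def)
    ultimately show ?thesis by (simp add: cINF_less_iff dist_norm)
  qed
  then obtain p where p: "\<And>n. p n \<in> V" "\<And>n. norm (\<eta> - p n) < d + inverse (real (Suc n))" by metis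
  have lim: "(\<lambda>n. norm (\<eta> - p n)) \<longlonglongrightarrow> d"
  proof (rule tendsto_sandwich[OF _ _ tendsto_const])
    show "(\<lambda>n. d + inverse (real (Suc n))) \<longlonglongrightarrow> d"
      using tendsto_add[OF tendsto_const LIMSEQ_inverse_real_of_nat, of d] by simp
    show "\<forall>\<^sub>F n in sequentially. d \<le> norm (\<eta> - p n)" using dle p(1) by simp
    show "\<forall>\<^sub>F n in sequentially. norm (\<eta> - p n) \<le> d + inverse (real (Suc n))"
      using p(2) by (simp add: less_imp_le)
  qed
  have par: "(norm (p m - p n))\<^sup>2 \<le> 2 * ((norm (\<eta> - p m))\<^sup>2 - d\<^sup>2) + 2 * ((norm (\<eta> - p n))\<^sup>2 - d\<^sup>2)" for m n
  proof -
    have mid: "(1/2) *\<^sub>R (p m + p n) \<in> V"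
      using scale[OF add[OF p(1) p(1)], of "complex_of_real (1/2)"] by (simp only: scaleC_of_real)
    have "(\<eta> - p m) + (\<eta> - p n) = 2 *\<^sub>R (\<eta> - (1/2) *\<^sub>R (p m + p n))"
      by (simp add: algebra_simps scaleR_2)
    then have "2 * d \<le> norm ((\<eta> - p m) + (\<eta> - p n))"
      using dle[OF mid] by simp
    then have "(2 * d)\<^sup>2 \<le> (norm ((\<eta> - p m) + (\<eta> - p n)))\<^sup>2"
      using d0 by (intro power_mono) auto
    moreover have "(\<eta> - p m) - (\<eta> - p n) = - (p m - p n)" by simp
    then have "norm ((\<eta> - p m) - (\<eta> - p n)) = norm (p m - p n)" by (metis norm_minus_cancel)
    ultimately show ?thesis
      using parallelogram[of "\<eta> - p m" "\<eta> - p n"] by (simp add: power_mult_distrib)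
  qed
  have "Cauchy p"
  proof (rule metric_CauchyI)
    fix e :: real assume e: "e > 0"
    have "(\<lambda>n. (norm (\<eta> - p n))\<^sup>2 - d\<^sup>2) \<longlonglongrightarrow> d\<^sup>2 - d\<^sup>2"
      by (intro tendsto_intros lim)
    then have "(\<lambda>n. (norm (\<eta> - p n))\<^sup>2 - d\<^sup>2) \<longlonglongrightarrow> 0" by simp
    moreover have "e\<^sup>2 / 4 > 0" using e by simp
    ultimately have "\<forall>\<^sub>F n in sequentially. (norm (\<eta> - p n))\<^sup>2 - d\<^sup>2 < e\<^sup>2 / 4"
      by (rule order_tendstoD(2))
    then obtain N where N: "\<And>n. n \<ge> N \<Longrightarrow> (norm (\<eta> - p n))\<^sup>2 - d\<^sup>2 < e\<^sup>2 / 4"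
      by (auto simp: eventually_sequentially)
    show "\<exists>N. \<forall>m\<ge>N. \<forall>n\<ge>N. dist (p m) (p n) < e"
    proof (intro exI allI impI)
      fix m n assume mn: "m \<ge> N" "n \<ge> N"
      have "x < s" if "x \<le> 2 * a + 2 * b" "a < s / 4" "b < s / 4" for x a b s :: real
        using that by linarith
      from this[OF par N[OF mn(1)] N[OF mn(2)]] have "(norm (p m - p n))\<^sup>2 < e\<^sup>2" .
      then show "dist (p m) (p n) < e"
        unfolding dist_norm using e by (simp add: power2_less_imp_less)
    qed
  qed
  then obtain l where l: "p \<longlonglongrightarrow> l" using Cauchy_convergent convergentD by blast
  have lV: "l \<in> closure V" using closure_sequential p(1) l by blast
  have zd: "norm (\<eta> - l) = d"
    using LIMSEQ_unique[OF tendsto_norm[OF tendsto_diff[OF tendsto_const l]] lim] .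
  have z0: "cinner (\<eta> - l) v = 0" if "v \<in> V" for v
  proof (rule orthogonal_if_minimal)
    fix t
    have "norm (\<eta> - p n + t *\<^sub>C v) \<ge> d" for n
      using dle[OF add[OF p(1)[of n] scale[OF that, of "- t"]]] scaleC_minus_one[of "t *\<^sub>C v"]
      by (simp add: scaleC_scaleC algebra_simps)
    moreover have "(\<lambda>n. norm (\<eta> - p n + t *\<^sub>C v)) \<longlonglongrightarrow> norm (\<eta> - l + t *\<^sub>C v)"
      by (intro tendsto_intros l)
    ultimately have "d \<le> norm (\<eta> - l + t *\<^sub>C v)"
      by (intro LIMSEQ_le_const) auto
    then show "norm (\<eta> - l) \<le> norm (\<eta> - l + t *\<^sub>C v)" using zd by simp
  qed
  have "(\<lambda>n. cinner (\<eta> - l) (p n)) \<longlonglongrightarrow> cinner (\<eta> - l) l"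
    by (intro cinner.tendsto tendsto_const l)
  then have "cinner (\<eta> - l) l = 0" using z0 p(1) by (simp add: LIMSEQ_const_iff)
  moreover have "cinner (\<eta> - l) \<eta> = 0" using orth z0 by blast
  ultimately have "cinner (\<eta> - l) (\<eta> - l) = 0" by (simp add: cinner.diff_right)
  then have "\<eta> = l" by (simp add: cinner_self)
  then show ?thesis using lV by simp
qed

section \<open>Translation averages of word vectors\<close>

definition comb :: "('w \<Rightarrow> 'a::complex_normed_vector) \<Rightarrow> (complex \<times> 'w) list \<Rightarrow> 'a"
  where "comb F L = (\<Sum>(c, w)\<leftarrow>L. c *\<^sub>C F w)"

lemma comb_simps [simp]:
  "comb F [] = 0" "comb F (p # L) = fst p *\<^sub>C F (snd p) + comb F L"
  by (simp_all add: comb_def split_def)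

lemma comb_append: "comb F (L @ L') = comb F L + comb F L'"
  by (induction L) (simp_all add: add.assoc)

lemma comb_scale: "comb F (map (\<lambda>(c, w). (d * c, w)) L) = d *\<^sub>C comb F L"
  by (induction L) (auto simp: scaleC_add_right scaleC_scaleC)

lemma comb_diff:
  "comb F (L @ map (\<lambda>(c, w). (- 1 * c, w)) L') = comb F L - comb F L'"
  by (simp only: comb_append comb_scale scaleC_minus_one diff_conv_add_uminus)

lemma cinner_comb_left_cong:
  assumes "\<And>w. w \<in> snd ` set L \<Longrightarrow> cinner (F w) z = cinner (F' w) z'"
  shows "cinner (comb F L) z = cinner (comb F' L) z'"
  using assms by (induction L) (simp_all add: cinner_add_left cinner_scaleC_left cinner.zero_left)

lemma cinner_comb_right_cong:
  assumes "\<And>w. w \<in> snd ` set L \<Longrightarrow> cinner z (F w) = cinner z' (F' w)"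
  shows "cinner z (comb F L) = cinner z' (comb F' L)"
  using assms by (induction L) (simp_all add: cinner_add_right cinner_scaleC_right cinner.zero_right)

lemma cbounded_comb: "a \<in> cbounded_ops \<Longrightarrow> blinfun_apply a (comb F L) = comb (\<lambda>w. blinfun_apply a (F w)) L"
  by (induction L) (simp_all add: cbounded_ops_def blinfun.add_right)

lemma blinfun_apply_comb: "blinfun_apply (comb F L) z = comb (\<lambda>w. blinfun_apply (F w) z) L"
  by (induction L) (simp_all add: plus_blinfun.rep_eq scaleC_blinfun.rep_eq)

lemma comb_cbounded: "(\<And>w. F w \<in> cbounded_ops) \<Longrightarrow> comb F L \<in> cbounded_ops"
  by (induction L) (simp_all add: cbounded_ops_intros)

definition shift :: "int \<Rightarrow> int list \<Rightarrow> int list"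
  where "shift n w = map ((+) n) w"

lemma shift_simps [simp]:
  "shift n [] = []" "shift n (i # w) = (n + i) # shift n w" "shift n (v @ w) = shift n v @ shift n w"
  "shift n (rev w) = rev (shift n w)" "shift m (shift n w) = shift (m + n) w" "shift 0 w = w"
  "set (shift n w) = (+) n ` set w" "shift n w = [] \<longleftrightarrow> w = []"
  by (simp_all add: shift_def rev_map add.assoc flip: fun.map_comp) (simp add: comp_def add.assoc map_idI)

definition beyond :: "int \<Rightarrow> int list \<Rightarrow> int list \<Rightarrow> bool"
  where "beyond s v w \<longleftrightarrow> (\<forall>i\<in>set v. \<forall>j\<in>set w. s * i < s * j)"

lemma beyond_append [simp]:
  "beyond s (u @ v) w \<longleftrightarrow> beyond s u w \<and> beyond s v w"
  "beyond s u (v @ w) \<longleftrightarrow> beyond s u v \<and> beyond s u w"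
  by (auto simp: beyond_def)

lemma beyond_rev [simp]: "beyond s (rev v) w \<longleftrightarrow> beyond s v w" "beyond s v (rev w) \<longleftrightarrow> beyond s v w"
  by (auto simp: beyond_def)

lemma threshold:
  fixes A B :: "int set"
  assumes "finite A" "finite B" "\<And>a b. a \<in> A \<Longrightarrow> b \<in> B \<Longrightarrow> a < b"
  obtains N where "\<And>a. a \<in> A \<Longrightarrow> a \<le> N" "\<And>b. b \<in> B \<Longrightarrow> N < b"
proof (cases "A = {}")
  case True
  have "Min B - 1 < b" if "b \<in> B" for b
    using Min_le[OF assms(2) that] by linarith
  then show ?thesis using that True by blast
next
  case False
  then show ?thesis using that[of "Max A"] assms by auto
qed

lemma beyond_ex: "\<exists>n0. \<forall>n\<ge>n0. \<forall>i\<in>set v. \<forall>j\<in>set w. s * i < s * j + (n :: int)"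
proof -
  let ?A = "(\<lambda>(i, j). s * i - s * j) ` (set v \<times> set w)"
  have "\<forall>n\<ge>Max (insert 0 ?A) + 1. \<forall>i\<in>set v. \<forall>j\<in>set w. s * i < s * j + n"
  proof (intro allI impI ballI)
    fix n i j assume n: "n \<ge> Max (insert 0 ?A) + 1" and ij: "i \<in> set v" "j \<in> set w"
    have "s * i - s * j \<in> insert 0 ?A" using ij by force
    then have "s * i - s * j \<le> Max (insert 0 ?A)" by (intro Max_ge) auto
    then show "s * i < s * j + n" using n by linarith
  qed
  then show ?thesis by blast
qed

lemma beyond_shift_ex:
  assumes "s \<in> {1, - 1}" shows "\<exists>n0. \<forall>n\<ge>n0. beyond s v (shift (s * n) w)"
proof -
  have "s * (s * n + j) = s * j + n" for n j using assms by auto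
  then show ?thesis using beyond_ex[of v w s] by (simp add: beyond_def)
qed

lemma beyond_shift_ex':
  assumes "s \<in> {1, - 1}" shows "\<exists>n0. \<forall>n\<ge>n0. beyond s (shift (- s * n) v) w"
proof -
  have "s * (- s * n + i) < s * j \<longleftrightarrow> s * i < s * j + n" for n i j using assms by auto
  then show ?thesis using beyond_ex[of v w s] by (simp add: beyond_def)
qed

lemma beyond_shift_mono:
  assumes "s \<in> {1, - 1}" "n \<ge> 0" "beyond s v w" shows "beyond s (shift (- s * n) v) w"
  using assms by (fastforce simp: beyond_def)

definition word_vector :: "('v \<Rightarrow> ('h::chilbert_space \<Rightarrow>\<^sub>L 'h)) \<Rightarrow> 'h \<Rightarrow> 'v list \<Rightarrow> 'h"
  where "word_vector y \<xi> w = blinfun_apply (word_product y w) \<xi>"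

locale word_system =
  fixes y :: "int \<Rightarrow> ('k::chilbert_space \<Rightarrow>\<^sub>L 'k)" and \<xi> :: 'k
  assumes cb: "y i \<in> cbounded_ops" and sa: "selfadjoint_op (y i)"
    and four: "strict_mono f \<Longrightarrow> (\<And>j. j \<le> f j) \<Longrightarrow> (\<And>j. f j \<le> j + M) \<Longrightarrow>
      strict_mono g \<Longrightarrow> (\<And>j. j \<le> g j) \<Longrightarrow> (\<And>j. g j \<le> j + M) \<Longrightarrow>
      (\<And>j. j \<in> set c \<Longrightarrow> f j = g j) \<Longrightarrow> (set v \<union> set w) \<inter> set c = {} \<Longrightarrow> c \<noteq> [] \<Longrightarrow>
      4 * cinner \<xi> (word_vector y \<xi> (v @ c @ w)) =
        cinner \<xi> (word_vector y \<xi> (map f v @ map f c @ map f w)) +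
        cinner \<xi> (word_vector y \<xi> (map f v @ map f c @ map g w)) +
        cinner \<xi> (word_vector y \<xi> (map g v @ map f c @ map f w)) +
        cinner \<xi> (word_vector y \<xi> (map g v @ map f c @ map g w))"
    and dense: "closure (range (comb (word_vector y \<xi>))) = UNIV"
begin

abbreviation "W \<equiv> word_vector y \<xi>"
abbreviation "wp u \<equiv> blinfun_apply (word_product y u)"
abbreviation "\<Phi> \<equiv> comb W"

definition m :: "int list \<Rightarrow> complex" where "m w = cinner \<xi> (W w)"

lemma wp_append: "wp (u @ v) z = wp u (wp v z)"
  by (induction u) simp_all

lemma wp_W: "wp u (W w) = W (u @ w)"
  by (simp add: word_vector_def wp_append)

lemma wp_cb: "word_product y u \<in> cbounded_ops"
  by (rule word_product_cbounded[OF cb])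

lemma y_adj: "cinner (blinfun_apply (y i) z) z' = cinner z (blinfun_apply (y i) z')"
  using sa by (simp add: is_adjoint_def)

lemma wp_adj: "cinner (wp u z) z' = cinner z (wp (rev u) z')"
  by (induction u arbitrary: z') (simp_all add: y_adj wp_append)

lemma cinner_wp: "cinner (W v) (wp c z) = cinner (W (rev c @ v)) z"
  using wp_adj[of "rev c" "W v" z] by (simp add: wp_W)

lemma cinner_W: "cinner (W v) (W w) = m (rev v @ w)"
  using wp_adj[of v \<xi> "W w"] by (simp add: m_def wp_W) (simp add: word_vector_def)

lemma m_rev: "m (rev w) = cnj (m w)"
  using cinner_W[of w "[]"] cinner_W[of "[]" w] cinner_commute[of "W w" "W []"] by simp

lemma m_spread:
  assumes f: "strict_mono f" "\<And>j. j \<le> f j" "\<And>j. f j \<le> j + M"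
  shows "m (map f w) = m w"
proof (cases "w = []")
  case False
  then show ?thesis using four[OF f f, of w "[]" "[]"] by (simp add: m_def)
qed simp

lemma m_shift: "m (shift n w) = m w"
proof -
  have pos: "m (shift n w) = m w" if "n \<ge> 0" for n w
    unfolding shift_def using that by (intro m_spread[where M = n]) (auto simp: strict_mono_def)
  show ?thesis
    using pos[of n w] pos[of "- n" "shift n w"] by (cases "n \<ge> 0") auto
qed

definition step :: "int \<Rightarrow> int \<Rightarrow> int \<Rightarrow> int"
  where "step N n j = (if j \<le> N then j else n + j)"

lemma step_props:
  assumes "n \<ge> 0"
  shows "strict_mono (step N n)" "j \<le> step N n j" "step N n j \<le> j + n"
  using assms by (auto simp: step_def strict_mono_def)

lemma map_step:
  "(\<And>j. j \<in> set w \<Longrightarrow> j \<le> N) \<Longrightarrow> map (step N n) w = w"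
  "(\<And>j. j \<in> set w \<Longrightarrow> N < j) \<Longrightarrow> map (step N n) w = shift n w"
  by (fastforce simp: step_def shift_def intro!: map_idI)+

lemma m_step: "n \<ge> 0 \<Longrightarrow> m (map (step N n) w) = m w"
  by (rule m_spread[OF step_props])

lemma m_far:
  assumes s: "s \<in> {1, - 1}" and vw: "beyond s v w" and n: "n \<ge> 0"
  shows "m (v @ shift (s * n) w) = m (v @ w)"
proof (cases "s = 1")
  case True
  obtain N where "\<And>a. a \<in> set v \<Longrightarrow> a \<le> N" "\<And>b. b \<in> set w \<Longrightarrow> N < b"
    by (rule threshold[of "set v" "set w"]) (use vw True in \<open>auto simp: beyond_def\<close>)
  then show ?thesis
    using m_step[OF n, of N "v @ w"] True by (simp add: map_step)
next
  case False
  then have s1: "s = - 1" using s by simp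
  obtain N where "\<And>a. a \<in> set w \<Longrightarrow> a \<le> N" "\<And>b. b \<in> set v \<Longrightarrow> N < b"
    by (rule threshold[of "set w" "set v"]) (use vw s1 in \<open>auto simp: beyond_def\<close>)
  then show ?thesis
    using m_step[OF n, of N "v @ w"] m_shift[of n "v @ shift (- n) w"] s1 by (simp add: map_step)
qed

text \<open>Take \<open>f\<close> and \<open>g\<close> in the four-term identity such that they differ by a translation
  on the letters of \<open>v\<close> and \<open>w\<close>; two of the four moments then equal the one on the left.\<close>

lemma m_two:
  assumes s: "s \<in> {1, - 1}" and vw: "beyond s v c" "beyond s w c" and c: "c \<noteq> []" and n: "n \<ge> 0"
  shows "2 * m (v @ c @ w) = m (v @ c @ shift (- s * n) w) + m (shift (- s * n) v @ c @ w)"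
proof (cases "s = 1")
  case True
  obtain N where N: "\<And>a. a \<in> set v \<union> set w \<Longrightarrow> a \<le> N" "\<And>b. b \<in> set c \<Longrightarrow> N < b"
    by (rule threshold[of "set v \<union> set w" "set c"]) (use vw True in \<open>auto simp: beyond_def\<close>)
  have disj: "(set v \<union> set w) \<inter> set c = {}" using vw by (auto simp: beyond_def)
  have st: "map (step N n) v = v" "map (step N n) w = w" "map (step N n) c = shift n c"
    using N by (simp_all add: map_step)
  have "4 * m (v @ c @ w) = m (map (step N n) v @ map (step N n) c @ map (step N n) w)
      + m (map (step N n) v @ map (step N n) c @ map ((+) n) w)
      + m (map ((+) n) v @ map (step N n) c @ map (step N n) w)
      + m (map ((+) n) v @ map (step N n) c @ map ((+) n) w)"
    unfolding m_def using disj c n N(2)[THEN less_imp_le]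
    by (intro four[where M = n] step_props) (fastforce simp: strict_mono_def step_def dest: N(2))+
  then have "4 * m (v @ c @ w) = m (v @ shift n c @ w) + m (v @ shift n c @ shift n w)
      + m (shift n v @ shift n c @ w) + m (shift n (v @ c @ w))"
    by (simp add: st flip: shift_def)
  moreover have "m (v @ shift n c @ w) = m (v @ c @ w)"
    using m_step[OF n, of N "v @ c @ w"] by (simp add: st)
  moreover have "m (v @ shift n c @ shift n w) = m (shift (- n) v @ c @ w)"
    using m_shift[of n "shift (- n) v @ c @ w"] by simp
  moreover have "m (shift n v @ shift n c @ w) = m (v @ c @ shift (- n) w)"
    using m_shift[of n "v @ c @ shift (- n) w"] by simp
  ultimately show ?thesis using True by (simp only: m_shift) simp
next
  case False
  then have s1: "s = - 1" using s by simp
  obtain N where N: "\<And>a. a \<in> set c \<Longrightarrow> a \<le> N" "\<And>b. b \<in> set v \<union> set w \<Longrightarrow> N < b"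
    by (rule threshold[of "set c" "set v \<union> set w"]) (use vw s1 in \<open>auto simp: beyond_def\<close>)
  have disj: "(set v \<union> set w) \<inter> set c = {}" using vw by (auto simp: beyond_def)
  have st: "map (step N n) v = shift n v" "map (step N n) w = shift n w" "map (step N n) c = c"
    using N by (simp_all add: map_step)
  have "4 * m (v @ c @ w) = m (map id v @ map id c @ map id w)
      + m (map id v @ map id c @ map (step N n) w)
      + m (map (step N n) v @ map id c @ map id w)
      + m (map (step N n) v @ map id c @ map (step N n) w)"
    unfolding m_def using N(1) disj c n
    by (intro four[where M = n] step_props) (auto simp: strict_mono_def step_def)
  moreover have "m (shift n v @ c @ shift n w) = m (v @ c @ w)"
    using m_step[OF n, of N "v @ c @ w"] by (simp add: st)
  ultimately show ?thesis using s1 by (simp add: st)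
qed

definition av :: "int \<Rightarrow> int list \<Rightarrow> int set \<Rightarrow> 'k"
  where "av D w A = (1 / real (card A)) *\<^sub>R (\<Sum>n\<in>A. W (shift (n * D) w))"

definition block :: "int \<Rightarrow> nat \<Rightarrow> int set"
  where "block s N = (\<lambda>n. s * int n) ` {Suc N..2 * N + 1}"

lemma block_props:
  assumes "s \<in> {1, - 1}"
  shows "finite (block s N)" "card (block s N) = Suc N" "block s N \<noteq> {}"
proof -
  have "inj_on (\<lambda>n. s * int n) {Suc N..2 * N + 1}" using assms by (auto simp: inj_on_def)
  then show "card (block s N) = Suc N" unfolding block_def by (subst card_image) auto
qed (simp_all add: block_def)

text \<open>As the Gram matrix of sufficiently separated translates is constant off the diagonal up to
  conjugation, averages over large sets of translates are close to each other, no matter whether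
  the translations go to the left or to the right.\<close>

lemma norm_translates:
  assumes D: "D \<ge> 1" "beyond 1 w (shift D w)" and F: "finite F"
  defines "\<kappa> \<equiv> Re (m (rev w @ shift D w))" and "\<rho> \<equiv> Re (m (rev w @ w))"
  shows "(norm (\<Sum>n\<in>F. c n *\<^sub>R W (shift (n * D) w)))\<^sup>2
    = (\<rho> - \<kappa>) * (\<Sum>n\<in>F. (c n)\<^sup>2) + \<kappa> * (\<Sum>n\<in>F. c n)\<^sup>2"
proof -
  have lt: "cinner (W (shift (n * D) w)) (W (shift (n' * D) w)) = m (rev w @ shift D w)"
    if "n < n'" for n n'
  proof -
    have "0 \<le> (n' - n - 1) * D" using that D(1) by simp
    then have "m (rev w @ shift (1 * ((n' - n - 1) * D)) (shift D w)) = m (rev w @ shift D w)"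
      using D(2) by (intro m_far) simp_all
    moreover have "cinner (W (shift (n * D) w)) (W (shift (n' * D) w))
        = m (shift (n * D) (rev w @ shift ((n' - n - 1) * D) (shift D w)))"
      by (simp add: cinner_W algebra_simps)
    ultimately show ?thesis by (simp only: m_shift mult_1)
  qed
  have V: "Re (cinner (W (shift (n * D) w)) (W (shift (n' * D) w))) = \<kappa> + (if n = n' then \<rho> - \<kappa> else 0)" for n n'
  proof -
    consider "n < n'" | "n = n'" | "n' < n" by linarith
    then show ?thesis
    proof cases
      case 1
      then show ?thesis using lt by (simp add: \<kappa>_def)
    next
      case 2
      then show ?thesis using m_shift[of "n * D" "rev w @ w"] by (simp add: cinner_W \<rho>_def)
    next
      case 3
      then show ?thesis
        using lt[OF 3] cinner_commute[of "W (shift (n * D) w)" "W (shift (n' * D) w)"]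
        by (simp add: \<kappa>_def)
    qed
  qed
  have "(norm (\<Sum>n\<in>F. c n *\<^sub>R W (shift (n * D) w)))\<^sup>2
      = (\<Sum>n\<in>F. \<Sum>n'\<in>F. c n * c n' * Re (cinner (W (shift (n' * D) w)) (W (shift (n * D) w))))"
    by (simp add: norm_squared_cinner cinner.sum_left cinner.sum_right cinner_scaleR_left
        cinner_scaleR_right sum_distrib_left mult.assoc mult.left_commute)
  also have "\<dots> = (\<Sum>n\<in>F. \<Sum>n'\<in>F. \<kappa> * (c n * c n') + (if n = n' then (\<rho> - \<kappa>) * (c n * c n') else 0))"
    by (intro sum.cong refl) (simp add: V algebra_simps)
  also have "\<dots> = \<kappa> * (\<Sum>n\<in>F. \<Sum>n'\<in>F. c n * c n') + (\<rho> - \<kappa>) * (\<Sum>n\<in>F. (c n)\<^sup>2)"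
    using F by (simp add: sum.distrib sum_distrib_left power2_eq_square)
  also have "(\<Sum>n\<in>F. \<Sum>n'\<in>F. c n * c n') = (\<Sum>n\<in>F. c n)\<^sup>2"
    by (simp add: power2_eq_square sum_product)
  finally show ?thesis by simp
qed

lemma av_diff_bound:
  assumes D: "D \<ge> 1" "beyond 1 w (shift D w)"
    and A: "finite A" "A \<noteq> {}" and B: "finite B" "B \<noteq> {}"
  shows "(norm (av D w A - av D w B))\<^sup>2
    \<le> \<bar>Re (m (rev w @ w)) - Re (m (rev w @ shift D w))\<bar> * (2 / card A + 2 / card B)"
proof -
  define a where "a X n = (if n \<in> X then 1 / real (card X) else 0)" for X and n :: int
  let ?V = "\<lambda>n. W (shift (n * D) w)"
  have fin: "finite (A \<union> B)" using A B by simp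
  have avs: "av D w X = (\<Sum>n\<in>A \<union> B. a X n *\<^sub>R ?V n)" if "X = A \<or> X = B" for X
  proof -
    have "av D w X = (\<Sum>n\<in>X. a X n *\<^sub>R ?V n)" by (simp add: av_def a_def scaleR_sum_right)
    also have "\<dots> = (\<Sum>n\<in>A \<union> B. a X n *\<^sub>R ?V n)"
      using that fin by (intro sum.mono_neutral_left) (auto simp: a_def)
    finally show ?thesis .
  qed
  have tot: "(\<Sum>n\<in>A \<union> B. a X n) = 1" "(\<Sum>n\<in>A \<union> B. (a X n)\<^sup>2) = 1 / card X"
    if "X = A \<or> X = B" for X
  proof -
    have X: "finite X" "X \<noteq> {}" "X \<subseteq> A \<union> B" using that A B by auto
    have "(\<Sum>n\<in>A \<union> B. a X n) = (\<Sum>n\<in>X. a X n)"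
      using X fin by (intro sum.mono_neutral_right) (auto simp: a_def)
    moreover have "(\<Sum>n\<in>A \<union> B. (a X n)\<^sup>2) = (\<Sum>n\<in>X. (a X n)\<^sup>2)"
      using X fin by (intro sum.mono_neutral_right) (auto simp: a_def)
    ultimately show "(\<Sum>n\<in>A \<union> B. a X n) = 1" "(\<Sum>n\<in>A \<union> B. (a X n)\<^sup>2) = 1 / card X"
      using X by (simp_all add: a_def power2_eq_square)
  qed
  have "av D w A - av D w B = (\<Sum>n\<in>A \<union> B. (a A n - a B n) *\<^sub>R ?V n)"
    by (simp add: avs sum_subtractf scaleR_left_diff_distrib)
  then have "(norm (av D w A - av D w B))\<^sup>2 = (Re (m (rev w @ w)) - Re (m (rev w @ shift D w)))
      * (\<Sum>n\<in>A \<union> B. (a A n - a B n)\<^sup>2)"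
    using norm_translates[OF D fin, of "\<lambda>n. a A n - a B n"] tot by (simp add: sum_subtractf)
  also have "\<dots> \<le> \<bar>Re (m (rev w @ w)) - Re (m (rev w @ shift D w))\<bar>
      * (\<Sum>n\<in>A \<union> B. (a A n - a B n)\<^sup>2)"
    by (intro mult_right_mono sum_nonneg) auto
  also have "(\<Sum>n\<in>A \<union> B. (a A n - a B n)\<^sup>2) \<le> (\<Sum>n\<in>A \<union> B. 2 * (a A n)\<^sup>2 + 2 * (a B n)\<^sup>2)"
  proof (rule sum_mono)
    fix n
    have "0 \<le> (a A n + a B n)\<^sup>2" by simp
    then show "(a A n - a B n)\<^sup>2 \<le> 2 * (a A n)\<^sup>2 + 2 * (a B n)\<^sup>2"
      by (simp add: power2_eq_square algebra_simps)
  qed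
  also have "\<dots> = 2 / card A + 2 / card B"
    by (simp add: sum.distrib tot flip: sum_distrib_left)
  finally show ?thesis by (simp add: mult_left_mono)
qed

lemma av_limit:
  "\<exists>q. \<exists>D\<ge>1. \<forall>s\<in>{1, - 1}. (\<lambda>N. av D w (block s N)) \<longlonglongrightarrow> q"
proof -
  obtain n0 where n0: "\<And>n. n \<ge> n0 \<Longrightarrow> beyond 1 w (shift (1 * n) w)"
    using beyond_shift_ex[of 1 w w] by auto
  define D where "D = max 1 n0"
  have D: "D \<ge> 1" "beyond 1 w (shift D w)" using n0[of D] by (auto simp: D_def)
  define K where "K = \<bar>Re (m (rev w @ w)) - Re (m (rev w @ shift D w))\<bar>"
  have K: "(norm (av D w (block s N) - av D w (block s' N')))\<^sup>2 \<le> 4 * K * inverse (real (Suc L))"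
    if "s \<in> {1, - 1}" "s' \<in> {1, - 1}" "L \<le> N" "L \<le> N'" for s s' N N' L
  proof -
    have "(norm (av D w (block s N) - av D w (block s' N')))\<^sup>2 \<le> K * (2 / real (Suc N) + 2 / real (Suc N'))"
      using av_diff_bound[OF D block_props(1,3)[OF that(1)] block_props(1,3)[OF that(2)]]
      by (simp only: K_def block_props(2)[OF that(1)] block_props(2)[OF that(2)])
    also have "\<dots> \<le> K * (2 / real (Suc L) + 2 / real (Suc L))"
      using that by (intro mult_left_mono add_mono divide_left_mono) (auto simp: K_def)
    finally show ?thesis by (simp add: divide_inverse algebra_simps)
  qed
  have "(\<lambda>L. 4 * K * inverse (real (Suc L))) \<longlonglongrightarrow> 4 * K * 0"
    by (intro tendsto_mult tendsto_const LIMSEQ_inverse_real_of_nat)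
  then have K0: "(\<lambda>L. 4 * K * inverse (real (Suc L))) \<longlonglongrightarrow> 0" by simp
  have "Cauchy (\<lambda>N. av D w (block 1 N))"
  proof (rule metric_CauchyI)
    fix e :: real assume e: "e > 0"
    then have "0 < e\<^sup>2" by simp
    then obtain L where L: "4 * K * inverse (real (Suc L)) < e\<^sup>2"
      using order_tendstoD(2)[OF K0] by (meson eventually_sequentially order_refl)
    show "\<exists>M. \<forall>m\<ge>M. \<forall>n\<ge>M. dist (av D w (block 1 m)) (av D w (block 1 n)) < e"
    proof (intro exI allI impI)
      fix i j assume "i \<ge> L" "j \<ge> L"
      then have "(dist (av D w (block 1 i)) (av D w (block 1 j)))\<^sup>2 < e\<^sup>2"
        using K[of 1 1 L i j] L by (simp add: dist_norm)
      then show "dist (av D w (block 1 i)) (av D w (block 1 j)) < e"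
        using e by (simp add: power2_less_imp_less)
    qed
  qed
  then obtain q where q: "(\<lambda>N. av D w (block 1 N)) \<longlonglongrightarrow> q"
    using Cauchy_convergent convergentD by blast
  have "(\<lambda>N. av D w (block s N)) \<longlonglongrightarrow> q" if s: "s \<in> {1, - 1}" for s
  proof -
    have le: "norm ((norm (av D w (block s N) - av D w (block 1 N)))\<^sup>2) \<le> 4 * K * inverse (real (Suc N))" for N
      using K[OF s, of 1 N N N] by simp
    have "(\<lambda>N. (norm (av D w (block s N) - av D w (block 1 N)))\<^sup>2) \<longlonglongrightarrow> 0"
      by (rule Lim_null_comparison[OF always_eventually[OF allI[OF le]] K0])
    then have "(\<lambda>N. sqrt ((norm (av D w (block s N) - av D w (block 1 N)))\<^sup>2)) \<longlonglongrightarrow> sqrt 0"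
      by (rule tendsto_real_sqrt)
    then have "(\<lambda>N. av D w (block s N) - av D w (block 1 N)) \<longlonglongrightarrow> 0"
      by (simp add: tendsto_norm_zero_iff)
    from tendsto_add[OF this q] show ?thesis by simp
  qed
  then show ?thesis using D(1) by blast
qed

text \<open>\<open>q w\<close> is the projection of \<open>W w\<close> to the translation-invariant vectors.\<close>

definition q :: "int list \<Rightarrow> 'k"
  where "q w = (SOME q. \<exists>D\<ge>1. \<forall>s\<in>{1, - 1}. (\<lambda>N. av D w (block s N)) \<longlonglongrightarrow> q)"

lemma q_const:
  assumes s: "s \<in> {1, - 1}" and h: "bounded_linear h"
    and C: "\<And>n. n \<ge> lo \<Longrightarrow> h (W (shift (s * n) w)) = (C :: complex)"
  shows "h (q w) = C"
proof -
  obtain D where D: "D \<ge> 1" "(\<lambda>N. av D w (block s N)) \<longlonglongrightarrow> q w"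
    using someI_ex[OF av_limit[of w]] s unfolding q_def by blast
  interpret h: bounded_linear h by fact
  have "h (av D w (block s N)) = C" if N: "N \<ge> nat lo" for N
  proof -
    have "h (W (shift (n * D) w)) = C" if n: "n \<in> block s N" for n
    proof -
      obtain k where k: "n = s * int k" "k \<in> {Suc N..2 * N + 1}"
        using n unfolding block_def by blast
      have "int k * 1 \<le> int k * D" using D(1) by (intro mult_left_mono) auto
      moreover have "lo \<le> int k" using k(2) N by auto
      ultimately have "int k * D \<ge> lo" by linarith
      from C[OF this] show ?thesis using k(1) by (simp add: mult.assoc)
    qed
    then show ?thesis
      using block_props[OF s, of N] by (simp add: av_def h.scaleR h.sum scaleR_conv_of_real del: of_nat_Suc)
  qed
  then have "\<forall>\<^sub>F N in sequentially. h (av D w (block s N)) = C"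
    by (auto simp: eventually_sequentially)
  then have "(\<lambda>N. h (av D w (block s N))) \<longlonglongrightarrow> C"
    by (rule tendsto_eventually)
  then show ?thesis using h.tendsto[OF D(2)] LIMSEQ_unique by blast
qed

lemma q_right:
  assumes s: "s \<in> {1, - 1}" and b: "beyond s v (shift n w)"
  shows "cinner (W v) (q w) = m (rev v @ shift n w)"
proof (rule q_const[OF s cinner.bounded_linear_right, where lo = "s * n"])
  fix k assume k: "k \<ge> s * n"
  have "s * k = s * (k - s * n) + n" using s by auto
  then show "cinner (W v) (W (shift (s * k) w)) = m (rev v @ shift n w)"
    using m_far[OF s, of "rev v" "shift n w" "k - s * n"] b k by (simp add: cinner_W)
qed

lemma dense_seq: "\<exists>L. (\<lambda>j. \<Phi> (L j)) \<longlonglongrightarrow> \<eta>"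
proof -
  have "\<eta> \<in> closure (range \<Phi>)" by (simp add: dense)
  then obtain f where f: "\<forall>j. f j \<in> range \<Phi>" "f \<longlonglongrightarrow> \<eta>"
    by (auto simp: closure_sequential)
  define L where "L j = (SOME L. f j = \<Phi> L)" for j
  have "f j = \<Phi> (L j)" for j
    unfolding L_def by (rule someI_ex) (use f(1) in blast)
  then have "f = (\<lambda>j. \<Phi> (L j))" by (rule ext)
  with f(2) show ?thesis by (intro exI[of _ L]) simp
qed

lemma zero_if_orthogonal:
  assumes "\<And>v. cinner (W v) z = 0" shows "z = 0"
proof -
  obtain L where L: "(\<lambda>j. \<Phi> (L j)) \<longlonglongrightarrow> z" using dense_seq by blast
  have "cinner (\<Phi> (L j)) z = 0" for j
    using cinner_comb_left_cong[of "L j" W z W 0] assms by (simp add: cinner.zero_right)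
  then have "cinner z z = 0"
    using cinner.tendsto[OF L tendsto_const[of z]] by (simp add: LIMSEQ_const_iff)
  then show ?thesis by (simp add: cinner_self)
qed

lemma q_shift: "q (shift n w) = q w"
proof -
  have "cinner (W v) (q (shift n w) - q w) = 0" for v
  proof -
    obtain k0 where "\<And>k. k \<ge> k0 \<Longrightarrow> beyond 1 v (shift (1 * k) w)"
      using beyond_shift_ex[of 1 v w] by auto
    then have b: "beyond 1 v (shift k0 w)" by simp
    then have "beyond 1 v (shift (k0 - n) (shift n w))" by simp
    from q_right[OF _ this] q_right[OF _ b] show ?thesis by (simp add: cinner.diff_right)
  qed
  then show ?thesis using zero_if_orthogonal by force
qed

lemma q_q: "cinner (q v) (q w) = cinner (q v) (W w)"
proof (rule q_const[where s = 1 and lo = 0])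
  show "bounded_linear (cinner (q v))" by (rule cinner.bounded_linear_right)
  fix n :: int
  have "cinner (W (shift n w)) (q v) = cinner (W w) (q v)"
  proof -
    obtain k0 where "\<And>k. k \<ge> k0 \<Longrightarrow> beyond 1 w (shift (1 * k) v)"
      using beyond_shift_ex[of 1 w v] by auto
    then have b: "beyond 1 w (shift k0 v)" by simp
    then have b': "beyond 1 (shift n w) (shift (n + k0) v)" by (auto simp: beyond_def)
    have "m (rev (shift n w) @ shift (n + k0) v) = m (shift n (rev w @ shift k0 v))" by simp
    then show ?thesis using q_right[OF _ b'] q_right[OF _ b] by (simp only: m_shift) simp
  qed
  then show "cinner (q v) (W (shift (1 * n) w)) = cinner (q v) (W w)"
    using cinner_commute[of "q v"] by simp
qed simp

lemma bounded_linear_cinner_left: "bounded_linear (\<lambda>u. cnj (cinner u z))"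
  using cinner.bounded_linear_right[of z] by (simp add: cinner_commute[of _ z])

lemma m_two_q:
  assumes s: "s \<in> {1, - 1}" and vw: "beyond s v c" "beyond s w c" and c: "c \<noteq> []"
  shows "2 * cinner (W v) (wp c (W w)) = cinner (W v) (wp c (q w)) + cinner (q v) (wp c (W w))"
proof -
  have s': "- s \<in> {1, - 1}" using s by auto
  obtain n1 where n1: "\<And>n. n \<ge> n1 \<Longrightarrow> beyond (- s) (rev c @ v) (shift (- s * n) w)"
    using beyond_shift_ex[OF s', of "rev c @ v" w] by auto
  obtain n2 where n2: "\<And>n. n \<ge> n2 \<Longrightarrow> beyond (- s) (c @ w) (shift (- s * n) v)"
    using beyond_shift_ex[OF s', of "c @ w" v] by auto
  define n where "n = max 0 (max n1 n2)"
  have "cinner (W v) (wp c (q w)) = m (rev v @ c @ shift (- s * n) w)"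
    using q_right[OF s' n1[of n]] by (simp add: cinner_wp n_def)
  moreover have "cinner (W (c @ w)) (q v) = m (rev (c @ w) @ shift (- s * n) v)"
    using q_right[OF s' n2[of n]] by (simp add: n_def)
  then have "cinner (q v) (wp c (W w)) = m (shift (- s * n) (rev v) @ c @ w)"
    using m_rev[of "shift (- s * n) (rev v) @ c @ w"] cinner_commute[of "q v" "W (c @ w)"]
    by (simp add: wp_W)
  ultimately show ?thesis
    using m_two[OF s, of "rev v" c w n] vw c by (simp add: wp_W cinner_W n_def)
qed

text \<open>Up to compression, \<open>m_two_q\<close> says \<open>2 c = c Q + Q c\<close> for the projection \<open>Q\<close> to the invariant
  vectors; multiplying by \<open>Q\<close> from either side gives \<open>Q c = Q c Q = c Q\<close>, so \<open>c = Q c Q\<close>.\<close>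

lemma sandwich:
  assumes s: "s \<in> {1, - 1}" and vw: "beyond s v c" "beyond s w c" and c: "c \<noteq> []"
  shows "cinner (W v) (wp c (W w)) = cinner (q v) (wp c (q w))"
proof -
  have s': "- s \<in> {1, - 1}" using s by auto
  let ?z = "2 *\<^sub>R wp c (W w) - wp c (q w)"
  have "cnj (cinner (q v) ?z) = cnj (cinner (q v) (wp c (W w)))"
  proof (rule q_const[OF s', where lo = 0 and h = "\<lambda>u. cnj (cinner u ?z)"])
    show "bounded_linear (\<lambda>u. cnj (cinner u ?z))" by (rule bounded_linear_cinner_left)
    fix n :: int assume n: "n \<ge> 0"
    have "2 * cinner (W (shift (- s * n) v)) (wp c (W w))
        = cinner (W (shift (- s * n) v)) (wp c (q w)) + cinner (q v) (wp c (W w))"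
      using m_two_q[OF s beyond_shift_mono[OF s n vw(1)] vw(2) c] by (simp only: q_shift)
    then show "cnj (cinner (W (shift (- s * n) v)) ?z) = cnj (cinner (q v) (wp c (W w)))"
      by (simp add: cinner.diff_right cinner_scaleR_right scaleR_conv_of_real)
  qed
  then have 1: "cinner (q v) (wp c (W w)) = cinner (q v) (wp c (q w))"
    by (simp add: cinner.diff_right cinner_scaleR_right scaleR_conv_of_real)
  have "(\<lambda>u. 2 * cinner (W v) (wp c u) - cinner (q v) (wp c u)) (q w) = cinner (W v) (wp c (q w))"
  proof (rule q_const[OF s', where lo = 0])
    show "bounded_linear (\<lambda>u. 2 * cinner (W v) (wp c u) - cinner (q v) (wp c u))"
      by (intro bounded_linear_sub bounded_linear_compose[OF bounded_linear_mult_right]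
          bounded_linear_compose[OF cinner.bounded_linear_right] blinfun.bounded_linear_right)
    fix n :: int assume n: "n \<ge> 0"
    show "2 * cinner (W v) (wp c (W (shift (- s * n) w))) - cinner (q v) (wp c (W (shift (- s * n) w)))
        = cinner (W v) (wp c (q w))"
      using m_two_q[OF s vw(1) beyond_shift_mono[OF s n vw(2)] c] by (simp only: q_shift) simp
  qed
  then have 2: "cinner (W v) (wp c (q w)) = cinner (q v) (wp c (q w))" by simp
  show ?thesis using m_two_q[OF s vw c] 1 2 by simp
qed

end

section \<open>Tail algebras\<close>

lemma cinner_comb_comb_cong:
  assumes "\<And>v w. cinner (F v) (G w) = cinner (F' v) (G' w)"
  shows "cinner (comb F L) (comb G L') = cinner (comb F' L) (comb G' L')"
  by (intro cinner_comb_left_cong cinner_comb_right_cong assms)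

lemma tendsto_cinner_comb_right:
  assumes "\<And>w. w \<in> snd ` set L \<Longrightarrow> ((\<lambda>n. cinner (z n) (F n w)) \<longlongrightarrow> cinner z' (G w)) net"
  shows "((\<lambda>n. cinner (z n) (comb (F n) L)) \<longlongrightarrow> cinner z' (comb G L)) net"
  using assms
  by (induction L)
    (auto simp: cinner_add_right cinner_scaleC_right cinner.zero_right intro!: tendsto_add tendsto_mult)

lemma tendsto_cinner_comb_left:
  assumes "\<And>w. w \<in> snd ` set L \<Longrightarrow> ((\<lambda>n. cinner (F w) (z n)) \<longlongrightarrow> cinner (G w) z') net"
  shows "((\<lambda>n. cinner (comb F L) (z n)) \<longlongrightarrow> cinner (comb G L) z') net"
  using assms
  by (induction L)
    (auto simp: cinner_add_left cinner_scaleC_left cinner.zero_left intro!: tendsto_add tendsto_mult)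

lemma norm_comb_le: "norm (comb F L) \<le> (\<Sum>(c, w)\<leftarrow>L. cmod c * norm (F w))"
proof (induction L)
  case (Cons p L)
  have "norm (fst p *\<^sub>C F (snd p) + comb F L) \<le> norm (fst p *\<^sub>C F (snd p)) + norm (comb F L)"
    by (rule norm_triangle_ineq)
  then show ?case using Cons by (simp add: norm_scaleC split_def)
qed simp

lemma word_product_append: "word_product y (u @ v) = word_product y u o\<^sub>L word_product y v"
  by (rule blinfun_eqI) (induction u, simp_all)

lemma comb_word_product_mult:
  assumes cb: "\<And>i. y i \<in> cbounded_ops"
  shows "comb (word_product y) (concat (map (\<lambda>(c, u). map (\<lambda>(d, v). (c * d, u @ v)) L') L))
    = comb (word_product y) L o\<^sub>L comb (word_product y) L'"
proof (induction L)
  case Nil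
  show ?case by (rule blinfun_eqI) simp
next
  case (Cons p L)
  have lin: "blinfun_apply (word_product y u) (c *\<^sub>C z) = c *\<^sub>C blinfun_apply (word_product y u) z" for u c z
    using word_product_cbounded[of y u, OF cb] by (simp add: cbounded_ops_def)
  have "comb (word_product y) (map (\<lambda>(d, v). (c * d, u @ v)) L')
      = c *\<^sub>C (word_product y u o\<^sub>L comb (word_product y) L')" for c u
    by (rule blinfun_eqI, induction L') (auto simp: plus_blinfun.rep_eq scaleC_blinfun.rep_eq
        word_product_append blinfun.add_right scaleC_add_right scaleC_scaleC lin)
  then have "comb (word_product y) (map (\<lambda>(d, v). (fst p * d, snd p @ v)) L')
      = fst p *\<^sub>C word_product y (snd p) o\<^sub>L comb (word_product y) L'"
    by (simp add: blinfun_eqI scaleC_blinfun.rep_eq)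
  then show ?case
    using Cons by (auto simp: comb_append split_def intro!: blinfun_eqI simp: plus_blinfun.rep_eq)
qed

lemma nonunital_algebra_expand:
  assumes cb: "\<And>i. y i \<in> cbounded_ops" and a: "a \<in> nonunital_algebra (y ` I)"
  shows "\<exists>L. (\<forall>u\<in>snd ` set L. u \<noteq> [] \<and> set u \<subseteq> I) \<and> a = comb (word_product y) L"
  using a
proof induction
  case zero
  show ?case by (rule exI[of _ "[]"]) simp
next
  case (gen a)
  then obtain i where "i \<in> I" "a = y i" by blast
  moreover have "y i o\<^sub>L id_blinfun = y i" by (rule blinfun_eqI) simp
  ultimately show ?case by (intro exI[of _ "[(1, [i])]"]) simp
next
  case (add a b)
  then obtain L L' where "\<forall>u\<in>snd ` set L. u \<noteq> [] \<and> set u \<subseteq> I" "a = comb (word_product y) L"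
    "\<forall>u\<in>snd ` set L'. u \<noteq> [] \<and> set u \<subseteq> I" "b = comb (word_product y) L'" by blast
  then show ?case by (intro exI[of _ "L @ L'"]) (auto simp: comb_append)
next
  case (scale a d)
  then obtain L where "\<forall>u\<in>snd ` set L. u \<noteq> [] \<and> set u \<subseteq> I" "a = comb (word_product y) L" by blast
  then show ?case
    by (intro exI[of _ "map (\<lambda>(c, w). (d * c, w)) L"]) (fastforce simp: comb_scale)
next
  case (mult a b)
  then obtain L L' where *: "\<forall>u\<in>snd ` set L. u \<noteq> [] \<and> set u \<subseteq> I" "a = comb (word_product y) L"
    "\<forall>u\<in>snd ` set L'. u \<noteq> [] \<and> set u \<subseteq> I" "b = comb (word_product y) L'" by blast
  show ?case
  proof (intro exI conjI)
    show "a o\<^sub>L b = comb (word_product y) (concat (map (\<lambda>(c, u). map (\<lambda>(d, v). (c * d, u @ v)) L') L))"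
      by (simp only: comb_word_product_mult[OF cb] *(2,4))
    show "\<forall>u\<in>snd ` set (concat (map (\<lambda>(c, u). map (\<lambda>(d, v). (c * d, u @ v)) L') L)). u \<noteq> [] \<and> set u \<subseteq> I"
      using *(1,3) by fastforce
  qed
qed

lemma word_product_in_algebra:
  "u \<noteq> [] \<Longrightarrow> set u \<subseteq> I \<Longrightarrow> word_product y u \<in> nonunital_algebra (y ` I)"
proof (induction u)
  case (Cons i u)
  have i: "y i \<in> nonunital_algebra (y ` I)" using Cons.prems by (auto intro: nonunital_algebra.gen)
  show ?case
  proof (cases "u = []")
    case True
    have "y i o\<^sub>L id_blinfun = y i" by (rule blinfun_eqI) simp
    then show ?thesis using i True by simp
  next
    case False
    then show ?thesis using Cons i by (auto intro: nonunital_algebra.mult)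
  qed
qed simp

lemma comb_in_algebra:
  "\<forall>u\<in>snd ` set L. F u \<in> nonunital_algebra S \<Longrightarrow> comb F L \<in> nonunital_algebra S"
  by (induction L)
    (auto intro!: nonunital_algebra.zero nonunital_algebra.add nonunital_algebra.scale)

lemma nonunital_algebra_cbounded: "S \<subseteq> cbounded_ops \<Longrightarrow> nonunital_algebra S \<subseteq> cbounded_ops"
proof
  fix a assume "S \<subseteq> cbounded_ops" "a \<in> nonunital_algebra S"
  from this(2,1) show "a \<in> cbounded_ops"
    by (induction rule: nonunital_algebra.induct) (auto intro: cbounded_ops_intros)
qed

lemma wot_closureD:
  assumes "a \<in> weak_operator_topology closure_of S" "finite F" "e > 0"
  obtains s where "s \<in> S"
    "\<forall>(u, v)\<in>F. cmod (cinner u (blinfun_apply s v) - cinner u (blinfun_apply a v)) < e"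
  using assms(1)[unfolded wot_closure_iff, rule_format, OF conjI, OF assms(2,3)] by (elim bexE)

lemma complex_eqI_small:
  fixes z w :: complex assumes "\<And>e. e > 0 \<Longrightarrow> cmod (z - w) \<le> c * e" shows "z = w"
proof (rule ccontr)
  assume "z \<noteq> w"
  then have p: "cmod (z - w) > 0" by simp
  show False
  proof (cases "c \<le> 0")
    case True
    then show False using assms[of 1] p by simp
  next
    case False
    then show False using assms[of "cmod (z - w) / (2 * c)"] p by simp
  qed
qed

lemma eq_if_cinner_eq: "(\<And>u. cinner u z = cinner u z') \<Longrightarrow> z = (z' :: 'a::complex_inner)"
  using cinner.diff_right[of "z - z'" z z'] cinner_self[of "z - z'"] by simp

lemma wot_closure_cbounded:
  fixes a :: "'h::chilbert_space \<Rightarrow>\<^sub>L 'h"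
  assumes S: "S \<subseteq> cbounded_ops" and a: "a \<in> weak_operator_topology closure_of S"
  shows "a \<in> cbounded_ops"
  unfolding cbounded_ops_def
proof (intro CollectI allI)
  fix c z
  show "blinfun_apply a (c *\<^sub>C z) = c *\<^sub>C blinfun_apply a z"
  proof (rule eq_if_cinner_eq, rule complex_eqI_small)
    fix u :: 'h and e :: real assume e: "e > 0"
    have fin: "finite {(u, c *\<^sub>C z), (u, z)}" by simp
    obtain s where s: "s \<in> S"
      "\<forall>(u', v)\<in>{(u, c *\<^sub>C z), (u, z)}.
        cmod (cinner u' (blinfun_apply s v) - cinner u' (blinfun_apply a v)) < e"
      by (rule wot_closureD[OF a fin e])
    have sc: "blinfun_apply s (c *\<^sub>C z) = c *\<^sub>C blinfun_apply s z"
      using S s(1) by (auto simp: cbounded_ops_def)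
    have "cinner u (blinfun_apply a (c *\<^sub>C z)) - cinner u (c *\<^sub>C blinfun_apply a z)
      = c * (cinner u (blinfun_apply s z) - cinner u (blinfun_apply a z))
        - (cinner u (blinfun_apply s (c *\<^sub>C z)) - cinner u (blinfun_apply a (c *\<^sub>C z)))"
      by (simp add: sc cinner_scaleC_right algebra_simps)
    also have "cmod \<dots> \<le> cmod (c * (cinner u (blinfun_apply s z) - cinner u (blinfun_apply a z)))
        + cmod (cinner u (blinfun_apply s (c *\<^sub>C z)) - cinner u (blinfun_apply a (c *\<^sub>C z)))"
      by (rule norm_triangle_ineq4)
    also have "\<dots> \<le> cmod c * e + e"
      using s(2) by (intro add_mono) (auto simp: norm_mult intro!: mult_left_mono)
    finally show "cmod (cinner u (blinfun_apply a (c *\<^sub>C z)) - cinner u (c *\<^sub>C blinfun_apply a z))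
        \<le> (cmod c + 1) * e"
      by (simp add: algebra_simps)
  qed
qed

context word_system
begin

abbreviation "\<Psi> \<equiv> comb q"

lemma norm_Psi_le: "norm (\<Psi> L) \<le> norm (\<Phi> L)"
proof -
  have "cinner (\<Psi> L) (\<Psi> L) = cinner (\<Psi> L) (\<Phi> L)"
    by (rule cinner_comb_comb_cong) (rule q_q)
  then have "(norm (\<Psi> L))\<^sup>2 \<le> norm (\<Psi> L) * norm (\<Phi> L)"
    using complex_cauchy_schwarz[of "\<Psi> L" "\<Phi> L"] complex_Re_le_cmod[of "cinner (\<Psi> L) (\<Phi> L)"]
    by (simp add: norm_squared_cinner)
  then show ?thesis
    by (cases "norm (\<Psi> L) = 0") (simp_all add: power2_eq_square)
qed

lemma norm_comb_shift: "norm (comb (\<lambda>w. W (shift n (h w))) L) = norm (comb (\<lambda>w. W (h w)) L)"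
proof -
  have "cinner (W (shift n v)) (W (shift n w)) = cinner (W v) (W w)" for v w
    using m_shift[of n "rev v @ w"] by (simp add: cinner_W)
  then have "cinner (comb (\<lambda>w. W (shift n (h w))) L) (comb (\<lambda>w. W (shift n (h w))) L)
      = cinner (comb (\<lambda>w. W (h w)) L) (comb (\<lambda>w. W (h w)) L)"
    by (intro cinner_comb_comb_cong)
  then have "(norm (comb (\<lambda>w. W (shift n (h w))) L))\<^sup>2 = (norm (comb (\<lambda>w. W (h w)) L))\<^sup>2"
    by (simp add: norm_squared_cinner)
  then show ?thesis by simp
qed

lemma W_Cons: "W (i # w) = blinfun_apply (y i) (W w)"
  by (simp add: word_vector_def)

lemma norm_y: "norm (y i) \<le> norm (y 0)"
proof (rule norm_blinfun_bound)
  fix \<eta>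
  obtain L where L: "(\<lambda>j. \<Phi> (L j)) \<longlonglongrightarrow> \<eta>" using dense_seq by blast
  have "norm (blinfun_apply (y i) (\<Phi> L)) \<le> norm (y 0) * norm (\<Phi> L)" for L
  proof -
    have "norm (blinfun_apply (y i) (\<Phi> L)) = norm (comb (\<lambda>w. W (i # w)) L)"
      by (simp add: cbounded_comb[OF cb] W_Cons)
    also have "\<dots> = norm (comb (\<lambda>w. W (shift (- i) (i # w))) L)"
      by (rule norm_comb_shift[symmetric])
    also have "\<dots> = norm (blinfun_apply (y 0) (comb (\<lambda>w. W (shift (- i) w)) L))"
      by (simp add: cbounded_comb[OF cb] W_Cons)
    also have "\<dots> \<le> norm (y 0) * norm (comb (\<lambda>w. W (shift (- i) w)) L)"
      by (rule norm_blinfun)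
    also have "\<dots> = norm (y 0) * norm (\<Phi> L)"
      using norm_comb_shift[of "- i" "\<lambda>w. w" L] by simp
    finally show ?thesis .
  qed
  then show "norm (blinfun_apply (y i) \<eta>) \<le> norm (y 0) * norm \<eta>"
    by (intro LIMSEQ_le[OF tendsto_norm[OF blinfun.tendsto[OF tendsto_const L]]
        tendsto_mult[OF tendsto_const tendsto_norm[OF L]]]) blast
qed simp

lemma norm_word_product: "norm (word_product y u) \<le> norm (y 0) ^ length u"
proof (induction u)
  case Nil
  show ?case by (simp add: norm_blinfun_id_le)
next
  case (Cons i u)
  have "norm (word_product y (i # u)) \<le> norm (y i) * norm (word_product y u)"
    by (simp add: norm_blinfun_compose)
  also have "\<dots> \<le> norm (y 0) * norm (y 0) ^ length u"
    by (intro mult_mono norm_y Cons.IH) simp_all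
  finally show ?case by simp
qed

definition translate :: "int \<Rightarrow> (complex \<times> int list) list \<Rightarrow> ('k \<Rightarrow>\<^sub>L 'k)"
  where "translate n L = comb (\<lambda>u. word_product y (shift n u)) L"

lemma translate_cb: "translate n L \<in> cbounded_ops"
  unfolding translate_def by (rule comb_cbounded) (rule wp_cb)

lemma norm_translate: "norm (translate n L) \<le> (\<Sum>(c, u)\<leftarrow>L. cmod c * norm (y 0) ^ length u)"
proof -
  have "norm (translate n L) \<le> (\<Sum>(c, u)\<leftarrow>L. cmod c * norm (word_product y (shift n u)))"
    unfolding translate_def by (rule norm_comb_le)
  also have "\<dots> \<le> (\<Sum>(c, u)\<leftarrow>L. cmod c * norm (y 0) ^ length u)"
  proof (rule sum_list_mono, clarify)
    fix c u
    show "cmod c * norm (word_product y (shift n u)) \<le> cmod c * norm (y 0) ^ length u"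
      using norm_word_product[of "shift n u"] by (intro mult_left_mono) (simp_all add: shift_def)
  qed
  finally show ?thesis .
qed

lemma translate_zero: "translate 0 L = comb (word_product y) L"
  by (simp add: translate_def)

lemma q_translate:
  assumes c: "c \<noteq> []"
  shows "cinner (q v) (wp (shift k c) (q w)) = cinner (q v) (wp c (q w))"
proof -
  obtain n1 where n1: "\<And>n. n \<ge> n1 \<Longrightarrow> beyond 1 (shift (- 1 * n) (v @ w)) c"
    using beyond_shift_ex'[of 1 "v @ w" c] by auto
  then have b: "beyond 1 (shift (- n1) v) c" "beyond 1 (shift (- n1) w) c" using n1[of n1] by simp_all
  then have b': "beyond 1 (shift (k - n1) v) (shift k c)" "beyond 1 (shift (k - n1) w) (shift k c)"
    by (auto simp: beyond_def)
  have "cinner (q v) (wp (shift k c) (q w))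
      = cinner (W (shift (k - n1) v)) (wp (shift k c) (W (shift (k - n1) w)))"
    using sandwich[OF _ b'] c by (simp add: q_shift)
  also have "\<dots> = m (shift k (rev (shift (- n1) v) @ c @ shift (- n1) w))"
    by (simp add: wp_W cinner_W)
  also have "\<dots> = cinner (W (shift (- n1) v)) (wp c (W (shift (- n1) w)))"
    by (simp only: m_shift wp_W cinner_W)
  also have "\<dots> = cinner (q v) (wp c (q w))"
    using sandwich[OF _ b c] by (simp add: q_shift)
  finally show ?thesis .
qed

lemma translate_words:
  assumes s: "s \<in> {1, - 1}" and c: "c \<noteq> []"
  shows "(\<lambda>n. cinner (W v) (wp (shift (s * int n) c) (W w))) \<longlonglongrightarrow> cinner (q v) (wp c (q w))"
proof -
  obtain n1 where n1: "\<And>n. n \<ge> n1 \<Longrightarrow> beyond s (v @ w) (shift (s * n) c)"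
    using beyond_shift_ex[OF s, of "v @ w" c] by blast
  have "cinner (W v) (wp (shift (s * int n) c) (W w)) = cinner (q v) (wp c (q w))"
    if "n \<ge> nat n1" for n
    using sandwich[OF s, of v "shift (s * int n) c" w] n1[of "int n"] that c by (simp add: q_translate)
  then show ?thesis
    by (intro tendsto_eventually) (auto simp: eventually_sequentially)
qed

lemma translate_comb:
  assumes s: "s \<in> {1, - 1}" and Lc: "\<And>u. u \<in> snd ` set Lc \<Longrightarrow> u \<noteq> []"
  shows "(\<lambda>n. cinner (\<Phi> L) (blinfun_apply (translate (s * int n) Lc) (\<Phi> L')))
    \<longlonglongrightarrow> cinner (\<Psi> L) (blinfun_apply (translate 0 Lc) (\<Psi> L'))"
  unfolding cbounded_comb[OF translate_cb]
proof (intro tendsto_cinner_comb_left tendsto_cinner_comb_right)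
  fix v w
  show "(\<lambda>n. cinner (W v) (blinfun_apply (translate (s * int n) Lc) (W w)))
    \<longlonglongrightarrow> cinner (q v) (blinfun_apply (translate 0 Lc) (q w))"
    unfolding translate_def blinfun_apply_comb
    using translate_words[OF s Lc] by (intro tendsto_cinner_comb_right) simp
qed

text \<open>\<open>lim_pair \<eta> \<theta>\<close> says that \<open>\<theta>\<close> is the image of \<open>\<eta>\<close> under the continuous extension of
  \<open>W w \<mapsto> q w\<close>.\<close>

definition lim_pair :: "'k \<Rightarrow> 'k \<Rightarrow> bool"
  where "lim_pair \<eta> \<theta> \<longleftrightarrow> (\<exists>L. (\<lambda>j. \<Phi> (L j)) \<longlonglongrightarrow> \<eta> \<and> (\<lambda>j. \<Psi> (L j)) \<longlonglongrightarrow> \<theta>)"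

lemma lim_pair_ex: "\<exists>\<theta>. lim_pair \<eta> \<theta>"
proof -
  obtain L where L: "(\<lambda>j. \<Phi> (L j)) \<longlonglongrightarrow> \<eta>" using dense_seq by blast
  have le: "dist (\<Psi> (L i)) (\<Psi> (L j)) \<le> dist (\<Phi> (L i)) (\<Phi> (L j))" for i j
    using norm_Psi_le[of "L i @ map (\<lambda>(c, w). (- 1 * c, w)) (L j)"]
    unfolding comb_diff by (simp only: dist_norm)
  have "Cauchy (\<lambda>j. \<Phi> (L j))" using L by (rule LIMSEQ_imp_Cauchy)
  then have "Cauchy (\<lambda>j. \<Psi> (L j))"
    unfolding Cauchy_def by (meson le le_less_trans)
  then show ?thesis using L unfolding lim_pair_def convergent_eq_Cauchy[symmetric] by blast
qed

lemma translate_lim: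
  assumes s: "s \<in> {1, - 1}" and Lc: "\<And>u. u \<in> snd ` set Lc \<Longrightarrow> u \<noteq> []"
    and \<eta>: "lim_pair \<eta> \<theta>" and \<zeta>: "lim_pair \<zeta> \<theta>'"
  shows "(\<lambda>n. cinner \<eta> (blinfun_apply (translate (s * int n) Lc) \<zeta>))
    \<longlonglongrightarrow> cinner \<theta> (blinfun_apply (translate 0 Lc) \<theta>')"
proof (rule LIMSEQ_I)
  fix e :: real assume "e > 0"
  then have e: "e / 3 > 0" by simp
  obtain L L' where L: "(\<lambda>j. \<Phi> (L j)) \<longlonglongrightarrow> \<eta>" "(\<lambda>j. \<Psi> (L j)) \<longlonglongrightarrow> \<theta>"
    and L': "(\<lambda>j. \<Phi> (L' j)) \<longlonglongrightarrow> \<zeta>" "(\<lambda>j. \<Psi> (L' j)) \<longlonglongrightarrow> \<theta>'"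
    using \<eta> \<zeta> unfolding lim_pair_def by blast
  define B where "B = (\<Sum>(c, u)\<leftarrow>Lc. cmod c * norm (y 0) ^ length u)"
  define T where "T n = blinfun_apply (translate (s * int n) Lc)" for n
  define T0 where "T0 = blinfun_apply (translate 0 Lc)"
  have B: "norm (T n z) \<le> B * norm z" for n z
    using norm_blinfun[of "translate (s * int n) Lc" z]
      mult_right_mono[OF norm_translate[of "s * int n" Lc], of "norm z"]
    by (simp add: T_def B_def)
  define r where "r j = norm (\<eta> - \<Phi> (L j)) * (B * norm \<zeta>) + norm (\<Phi> (L j)) * (B * norm (\<zeta> - \<Phi> (L' j)))" for j
  have close: "cmod (cinner \<eta> (T n \<zeta>) - cinner (\<Phi> (L j)) (T n (\<Phi> (L' j)))) \<le> r j" for n j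
  proof -
    have "cinner \<eta> (T n \<zeta>) - cinner (\<Phi> (L j)) (T n (\<Phi> (L' j)))
        = cinner (\<eta> - \<Phi> (L j)) (T n \<zeta>) + cinner (\<Phi> (L j)) (T n (\<zeta> - \<Phi> (L' j)))"
      by (simp add: T_def cinner.diff_left cinner.diff_right blinfun.diff_right)
    also have "cmod \<dots> \<le> norm (\<eta> - \<Phi> (L j)) * norm (T n \<zeta>)
        + norm (\<Phi> (L j)) * norm (T n (\<zeta> - \<Phi> (L' j)))"
      by (intro order_trans[OF norm_triangle_ineq add_mono] complex_cauchy_schwarz)
    also have "\<dots> \<le> r j"
      unfolding r_def by (intro add_mono mult_left_mono B) simp_all
    finally show ?thesis .
  qed
  have "r \<longlonglongrightarrow> norm (\<eta> - \<eta>) * (B * norm \<zeta>) + norm \<eta> * (B * norm (\<zeta> - \<zeta>))"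
    unfolding r_def[abs_def] by (intro tendsto_intros L L')
  then have "r \<longlonglongrightarrow> 0" by simp
  then have 1: "\<forall>\<^sub>F j in sequentially. r j < e / 3" using e by (rule order_tendstoD(2))
  have "(\<lambda>j. cinner (\<Psi> (L j)) (T0 (\<Psi> (L' j)))) \<longlonglongrightarrow> cinner \<theta> (T0 \<theta>')"
    unfolding T0_def by (intro cinner.tendsto blinfun.tendsto tendsto_const L L')
  then have "\<forall>\<^sub>F j in sequentially. dist (cinner (\<Psi> (L j)) (T0 (\<Psi> (L' j)))) (cinner \<theta> (T0 \<theta>')) < e / 3"
    using e by (rule tendstoD)
  with 1 have "\<forall>\<^sub>F j in sequentially. r j < e / 3 \<and>
      dist (cinner (\<Psi> (L j)) (T0 (\<Psi> (L' j)))) (cinner \<theta> (T0 \<theta>')) < e / 3"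
    by (rule eventually_conj)
  then obtain j where j: "r j < e / 3"
    "dist (cinner (\<Psi> (L j)) (T0 (\<Psi> (L' j)))) (cinner \<theta> (T0 \<theta>')) < e / 3"
    using eventually_happens by (metis (no_types, lifting) trivial_limit_sequentially)
  obtain n1 where n1: "\<And>n. n \<ge> n1 \<Longrightarrow>
      dist (cinner (\<Phi> (L j)) (T n (\<Phi> (L' j)))) (cinner (\<Psi> (L j)) (T0 (\<Psi> (L' j)))) < e / 3"
    using tendstoD[OF translate_comb[where L = "L j" and L' = "L' j", OF s Lc] e]
    unfolding T_def T0_def eventually_sequentially by blast
  show "\<exists>no. \<forall>n\<ge>no. norm (cinner \<eta> (blinfun_apply (translate (s * int n) Lc) \<zeta>)
      - cinner \<theta> (blinfun_apply (translate 0 Lc) \<theta>')) < e"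
  proof (intro exI allI impI)
    fix n assume n: "n \<ge> n1"
    have "dist (cinner \<eta> (T n \<zeta>)) (cinner \<theta> (T0 \<theta>'))
      \<le> dist (cinner \<eta> (T n \<zeta>)) (cinner (\<Phi> (L j)) (T n (\<Phi> (L' j))))
        + dist (cinner (\<Phi> (L j)) (T n (\<Phi> (L' j)))) (cinner (\<Psi> (L j)) (T0 (\<Psi> (L' j))))
        + dist (cinner (\<Psi> (L j)) (T0 (\<Psi> (L' j)))) (cinner \<theta> (T0 \<theta>'))"
      by (meson add_right_mono dist_triangle order_trans)
    also have "\<dots> < e"
      using close[of n j] j n1[OF n] by (simp add: dist_norm)
    finally show "norm (cinner \<eta> (blinfun_apply (translate (s * int n) Lc) \<zeta>)
      - cinner \<theta> (blinfun_apply (translate 0 Lc) \<theta>')) < e"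
      by (simp add: T_def T0_def dist_norm)
  qed
qed

definition tail :: "int \<Rightarrow> ('k \<Rightarrow>\<^sub>L 'k) set"
  where "tail s = (\<Inter>k\<in>{0<..}. weak_operator_topology closure_of nonunital_algebra (y ` {i. k \<le> s * i}))"

lemma tail_closure:
  "a \<in> tail s \<Longrightarrow> k > 0 \<Longrightarrow> a \<in> weak_operator_topology closure_of nonunital_algebra (y ` {i. k \<le> s * i})"
  by (auto simp: tail_def)

lemma algebra_cb: "nonunital_algebra (y ` I) \<subseteq> cbounded_ops"
  using cb by (intro nonunital_algebra_cbounded) auto

lemma tail_cb: "a \<in> tail s \<Longrightarrow> a \<in> cbounded_ops"
  using tail_closure[of a s 1] by (auto intro: wot_closure_cbounded[OF algebra_cb])

lemma tail_sandwich:
  assumes s: "s \<in> {1, - 1}" and a: "a \<in> tail s"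
  shows "cinner (W v) (blinfun_apply a (W w)) = cinner (q v) (blinfun_apply a (q w))"
proof (rule complex_eqI_small)
  fix e :: real assume e: "e > 0"
  let ?A = "insert 0 ((*) s ` (set v \<union> set w))"
  define k where "k = Max ?A + 1"
  have max: "j < k" if "j \<in> ?A" for j
    using Max_ge[OF _ that] unfolding k_def by simp
  have k: "k > 0" "\<And>i. i \<in> set v \<union> set w \<Longrightarrow> s * i < k"
    using max by blast+
  have fin: "finite {(W v, W w), (q v, q w)}" by simp
  obtain b where b: "b \<in> nonunital_algebra (y ` {i. k \<le> s * i})"
    and close: "\<forall>(u, u')\<in>{(W v, W w), (q v, q w)}.
      cmod (cinner u (blinfun_apply b u') - cinner u (blinfun_apply a u')) < e"
    by (rule wot_closureD[OF tail_closure[OF a k(1)] fin e])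
  obtain L where L: "\<And>u. u \<in> snd ` set L \<Longrightarrow> u \<noteq> [] \<and> set u \<subseteq> {i. k \<le> s * i}"
    "b = comb (word_product y) L"
    using nonunital_algebra_expand[OF cb b] by blast
  have "cinner (W v) (blinfun_apply b (W w)) = cinner (q v) (blinfun_apply b (q w))"
    unfolding L(2) blinfun_apply_comb
  proof (rule cinner_comb_right_cong, rule sandwich[OF s])
    fix u assume "u \<in> snd ` set L"
    from L(1)[OF this] show "u \<noteq> []" "beyond s v u" "beyond s w u"
      using k(2) by (fastforce simp: beyond_def)+
  qed
  then have "cinner (W v) (blinfun_apply a (W w)) - cinner (q v) (blinfun_apply a (q w))
    = (cinner (q v) (blinfun_apply b (q w)) - cinner (q v) (blinfun_apply a (q w)))
      - (cinner (W v) (blinfun_apply b (W w)) - cinner (W v) (blinfun_apply a (W w)))"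
    by simp
  also have "cmod \<dots> \<le> e + e"
    using close by (intro order_trans[OF norm_triangle_ineq4 add_mono]) auto
  finally show "cmod (cinner (W v) (blinfun_apply a (W w)) - cinner (q v) (blinfun_apply a (q w))) \<le> 2 * e"
    by simp
qed

lemma tail_lim:
  assumes s: "s \<in> {1, - 1}" and a: "a \<in> tail s" and \<eta>: "lim_pair \<eta> \<theta>" and \<zeta>: "lim_pair \<zeta> \<theta>'"
  shows "cinner \<eta> (blinfun_apply a \<zeta>) = cinner \<theta> (blinfun_apply a \<theta>')"
proof -
  obtain L L' where L: "(\<lambda>j. \<Phi> (L j)) \<longlonglongrightarrow> \<eta>" "(\<lambda>j. \<Psi> (L j)) \<longlonglongrightarrow> \<theta>"
    and L': "(\<lambda>j. \<Phi> (L' j)) \<longlonglongrightarrow> \<zeta>" "(\<lambda>j. \<Psi> (L' j)) \<longlonglongrightarrow> \<theta>'"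
    using \<eta> \<zeta> unfolding lim_pair_def by blast
  have "cinner (\<Phi> (L j)) (blinfun_apply a (\<Phi> (L' j))) = cinner (\<Psi> (L j)) (blinfun_apply a (\<Psi> (L' j)))" for j
    unfolding cbounded_comb[OF tail_cb[OF a]]
    by (rule cinner_comb_comb_cong) (rule tail_sandwich[OF s a])
  moreover have "(\<lambda>j. cinner (\<Phi> (L j)) (blinfun_apply a (\<Phi> (L' j)))) \<longlonglongrightarrow> cinner \<eta> (blinfun_apply a \<zeta>)"
    "(\<lambda>j. cinner (\<Psi> (L j)) (blinfun_apply a (\<Psi> (L' j)))) \<longlonglongrightarrow> cinner \<theta> (blinfun_apply a \<theta>')"
    by (intro cinner.tendsto blinfun.tendsto tendsto_const L L')+
  ultimately show ?thesis using LIMSEQ_unique by simp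
qed

lemma tail_flip:
  assumes s: "s \<in> {1, - 1}" and a: "a \<in> tail s"
  shows "a \<in> tail (- s)"
  unfolding tail_def wot_closure_iff
proof (intro INT_I CollectI allI impI)
  fix k :: int
  assume "k \<in> {0<..}"
  show "a \<in> weak_operator_topology closure_of nonunital_algebra (y ` {i. k \<le> - s * i})"
    unfolding wot_closure_iff
  proof (intro allI impI)
    fix F :: "('k \<times> 'k) set" and e :: real
    assume "finite F \<and> e > 0"
    then have F: "finite F" and e: "e / 2 > 0" by auto
    have s': "- s \<in> {1, - 1}" using s by auto
    obtain th where th: "\<And>\<eta>. lim_pair \<eta> (th \<eta>)" using lim_pair_ex by metis
    have fin: "finite ((\<lambda>(\<eta>, \<zeta>). (th \<eta>, th \<zeta>)) ` F)" using F by simp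
    obtain b where b: "b \<in> nonunital_algebra (y ` {i. 1 \<le> s * i})"
      and close: "\<forall>(u, u')\<in>(\<lambda>(\<eta>, \<zeta>). (th \<eta>, th \<zeta>)) ` F.
        cmod (cinner u (blinfun_apply b u') - cinner u (blinfun_apply a u')) < e / 2"
      by (rule wot_closureD[OF tail_closure[OF a zero_less_one] fin e])
    obtain L where L: "\<And>u. u \<in> snd ` set L \<Longrightarrow> u \<noteq> []" "b = translate 0 L"
      using nonunital_algebra_expand[OF cb b] unfolding translate_zero by blast
    have "\<forall>\<^sub>F n in sequentially. \<forall>(\<eta>, \<zeta>)\<in>F. dist (cinner \<eta> (blinfun_apply (translate (- s * int n) L) \<zeta>))
        (cinner (th \<eta>) (blinfun_apply b (th \<zeta>))) < e / 2"
      unfolding L(2)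
      by (intro eventually_ball_finite[OF F] ballI, clarify)
        (intro tendstoD[OF translate_lim[OF s' L(1) th th] e])
    moreover have "\<forall>\<^sub>F n in sequentially. \<forall>u\<in>snd ` set L. set (shift (- s * int n) u) \<subseteq> {i. k \<le> - s * i}"
    proof (intro eventually_ball_finite ballI)
      fix u
      obtain n1 where n1: "\<And>n. n \<ge> n1 \<Longrightarrow> beyond (- s) [- s * k] (shift (- s * n) u)"
        using beyond_shift_ex[OF s', of "[- s * k]" u] by blast
      have k: "- s * (- s * k) = k" using s by auto
      have "set (shift (- s * int n) u) \<subseteq> {i. k \<le> - s * i}" if "n \<ge> nat n1" for n
      proof (intro subsetI CollectI)
        fix j assume j: "j \<in> set (shift (- s * int n) u)"
        have "n1 \<le> int n" using that by linarith
        then have "- s * (- s * k) < - s * j"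
          using n1 j unfolding beyond_def by (meson list.set_intros(1))
        then show "k \<le> - s * j" unfolding k by simp
      qed
      then show "\<forall>\<^sub>F n in sequentially. set (shift (- s * int n) u) \<subseteq> {i. k \<le> - s * i}"
        by (auto simp: eventually_sequentially)
    qed simp
    ultimately have "\<forall>\<^sub>F n in sequentially. (\<forall>(\<eta>, \<zeta>)\<in>F. dist (cinner \<eta> (blinfun_apply (translate (- s * int n) L) \<zeta>))
        (cinner (th \<eta>) (blinfun_apply b (th \<zeta>))) < e / 2) \<and>
        (\<forall>u\<in>snd ` set L. set (shift (- s * int n) u) \<subseteq> {i. k \<le> - s * i})"
      by (rule eventually_conj)
    then obtain n where n: "\<forall>(\<eta>, \<zeta>)\<in>F. dist (cinner \<eta> (blinfun_apply (translate (- s * int n) L) \<zeta>))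
        (cinner (th \<eta>) (blinfun_apply b (th \<zeta>))) < e / 2"
      "\<forall>u\<in>snd ` set L. set (shift (- s * int n) u) \<subseteq> {i. k \<le> - s * i}"
      unfolding eventually_sequentially by (metis (no_types, lifting) order_refl)
    have "translate (- s * int n) L \<in> nonunital_algebra (y ` {i. k \<le> - s * i})"
      unfolding translate_def
    proof (intro comb_in_algebra ballI word_product_in_algebra)
      fix u assume u: "u \<in> snd ` set L"
      show "shift (- s * int n) u \<noteq> []" using L(1)[OF u] by simp
      show "set (shift (- s * int n) u) \<subseteq> {i. k \<le> - s * i}" using n(2) u by (rule bspec)
    qed
    moreover have "\<forall>(\<eta>, \<zeta>)\<in>F. cmod (cinner \<eta> (blinfun_apply (translate (- s * int n) L) \<zeta>)
        - cinner \<eta> (blinfun_apply a \<zeta>)) < e"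
    proof (clarify)
      fix \<eta> \<zeta> assume p: "(\<eta>, \<zeta>) \<in> F"
      have "cinner \<eta> (blinfun_apply a \<zeta>) = cinner (th \<eta>) (blinfun_apply a (th \<zeta>))"
        by (rule tail_lim[OF s a th th])
      moreover have "cmod (cinner (th \<eta>) (blinfun_apply b (th \<zeta>)) - cinner (th \<eta>) (blinfun_apply a (th \<zeta>))) < e / 2"
        using close p by fastforce
      moreover have "cmod (cinner \<eta> (blinfun_apply (translate (- s * int n) L) \<zeta>) - cinner (th \<eta>) (blinfun_apply b (th \<zeta>))) < e / 2"
        using n(1) p unfolding dist_norm by blast
      ultimately show "cmod (cinner \<eta> (blinfun_apply (translate (- s * int n) L) \<zeta>)
        - cinner \<eta> (blinfun_apply a \<zeta>)) < e"
        using norm_diff_triangle_less[of _ "cinner (th \<eta>) (blinfun_apply b (th \<zeta>))" "e / 2" _ "e / 2"] by simp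
    qed
    ultimately show "\<exists>t\<in>nonunital_algebra (y ` {i. k \<le> - s * i}). \<forall>(\<eta>, \<zeta>)\<in>F.
        cmod (cinner \<eta> (blinfun_apply t \<zeta>) - cinner \<eta> (blinfun_apply a \<zeta>)) < e"
      by blast
  qed
qed

lemma tail_eq: "tail 1 = tail (- 1)"
  using tail_flip[of 1] tail_flip[of "- 1"] by auto

lemma tail_algebras_eq: "positive_tail_algebra y = negative_tail_algebra y"
proof -
  have "positive_tail_algebra y = tail 1"
    by (simp add: positive_tail_algebra_def tail_def atLeast_def)
  moreover have "negative_tail_algebra y = tail (- 1)"
  proof -
    have "{i. - k \<le> - 1 * i} = {..k}" for k :: int by auto
    moreover have "{0<..} = uminus ` {..<0 :: int}" by (auto simp: image_iff intro: bexI[of _ "- _"])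
    ultimately show ?thesis
      unfolding negative_tail_algebra_def tail_def by (simp only: image_image)
  qed
  ultimately show ?thesis by (simp add: tail_eq)
qed

end

lemma is_adjointD: "is_adjoint a b \<Longrightarrow> cinner (blinfun_apply a u) v = cinner u (blinfun_apply b v)"
  by (simp add: is_adjoint_def)

lemma is_adjoint_commute: "is_adjoint a b \<Longrightarrow> is_adjoint b a"
  unfolding is_adjoint_def by (metis cinner_commute)

locale star_subalgebra =
  fixes S :: "('h::chilbert_space \<Rightarrow>\<^sub>L 'h) set"
  assumes sub_add: "a \<in> S \<Longrightarrow> b \<in> S \<Longrightarrow> a + b \<in> S"
    and sub_scale: "a \<in> S \<Longrightarrow> c *\<^sub>C a \<in> S"
    and sub_mult: "a \<in> S \<Longrightarrow> b \<in> S \<Longrightarrow> a o\<^sub>L b \<in> S"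
    and sub_adj: "a \<in> S \<Longrightarrow> \<exists>b\<in>S. is_adjoint a b"
begin

abbreviation "C \<equiv> weak_operator_topology closure_of S"

lemma closure_add:
  assumes a: "a \<in> C" and b: "b \<in> C" shows "a + b \<in> C"
  unfolding wot_closure_iff
proof (intro allI impI)
  fix F :: "('h \<times> 'h) set" and e :: real
  assume "finite F \<and> e > 0"
  then have F: "finite F" and e: "e / 2 > 0" by simp_all
  obtain s where s: "s \<in> S" "\<forall>(u, v)\<in>F. cmod (cinner u (blinfun_apply s v) - cinner u (blinfun_apply a v)) < e / 2"
    by (rule wot_closureD[OF a F e])
  obtain t where t: "t \<in> S" "\<forall>(u, v)\<in>F. cmod (cinner u (blinfun_apply t v) - cinner u (blinfun_apply b v)) < e / 2"
    by (rule wot_closureD[OF b F e])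
  show "\<exists>r\<in>S. \<forall>(u, v)\<in>F. cmod (cinner u (blinfun_apply r v) - cinner u (blinfun_apply (a + b) v)) < e"
  proof (intro bexI[of _ "s + t"] sub_add s t, clarify)
    fix u v assume p: "(u, v) \<in> F"
    have "cmod ((cinner u (blinfun_apply s v) - cinner u (blinfun_apply a v))
        + (cinner u (blinfun_apply t v) - cinner u (blinfun_apply b v))) < e / 2 + e / 2"
      using s(2) t(2) p by (intro norm_add_less) auto
    then show "cmod (cinner u (blinfun_apply (s + t) v) - cinner u (blinfun_apply (a + b) v)) < e"
      by (simp add: plus_blinfun.rep_eq cinner_add_right algebra_simps)
  qed
qed

lemma closure_scale:
  assumes a: "a \<in> C" shows "c *\<^sub>C a \<in> C"
  unfolding wot_closure_iff
proof (intro allI impI)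
  fix F :: "('h \<times> 'h) set" and e :: real
  assume "finite F \<and> e > 0"
  then have F: "finite F" and e: "e / (cmod c + 1) > 0" by (simp_all add: add_nonneg_pos)
  obtain s where s: "s \<in> S" "\<forall>(u, v)\<in>F. cmod (cinner u (blinfun_apply s v) - cinner u (blinfun_apply a v)) < e / (cmod c + 1)"
    by (rule wot_closureD[OF a F e])
  have e0: "e > 0" using \<open>finite F \<and> e > 0\<close> by simp
  show "\<exists>r\<in>S. \<forall>(u, v)\<in>F. cmod (cinner u (blinfun_apply r v) - cinner u (blinfun_apply (c *\<^sub>C a) v)) < e"
  proof (intro bexI[of _ "c *\<^sub>C s"] sub_scale s, clarify)
    fix u v assume p: "(u, v) \<in> F"
    have "cmod (cinner u (blinfun_apply (c *\<^sub>C s) v) - cinner u (blinfun_apply (c *\<^sub>C a) v))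
        = cmod c * cmod (cinner u (blinfun_apply s v) - cinner u (blinfun_apply a v))"
      by (simp add: scaleC_blinfun.rep_eq cinner_scaleC_right flip: right_diff_distrib norm_mult)
    also have "\<dots> \<le> cmod c * (e / (cmod c + 1))"
      using s(2) p by (intro mult_left_mono) (auto intro: less_imp_le)
    also have "\<dots> < e" using e0 by (simp add: divide_less_eq add_nonneg_pos distrib_left mult.commute)
    finally show "cmod (cinner u (blinfun_apply (c *\<^sub>C s) v) - cinner u (blinfun_apply (c *\<^sub>C a) v)) < e" .
  qed
qed

lemma closure_mult:
  assumes a: "a \<in> C" and b: "b \<in> C" shows "a o\<^sub>L b \<in> C"
  unfolding wot_closure_iff
proof (intro allI impI)
  fix F :: "('h \<times> 'h) set" and e :: real
  assume "finite F \<and> e > 0"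
  then have F: "finite ((\<lambda>(u, v). (u, blinfun_apply b v)) ` F)" and e: "e / 2 > 0" by simp_all
  obtain s where s: "s \<in> S" "\<forall>(u, v)\<in>(\<lambda>(u, v). (u, blinfun_apply b v)) ` F.
      cmod (cinner u (blinfun_apply s v) - cinner u (blinfun_apply a v)) < e / 2"
    by (rule wot_closureD[OF a F e])
  obtain s' where s': "is_adjoint s s'" using sub_adj s(1) by blast
  have F': "finite ((\<lambda>(u, v). (blinfun_apply s' u, v)) ` F)" using \<open>finite F \<and> e > 0\<close> by simp
  obtain t where t: "t \<in> S" "\<forall>(u, v)\<in>(\<lambda>(u, v). (blinfun_apply s' u, v)) ` F.
      cmod (cinner u (blinfun_apply t v) - cinner u (blinfun_apply b v)) < e / 2"
    by (rule wot_closureD[OF b F' e])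
  show "\<exists>r\<in>S. \<forall>(u, v)\<in>F. cmod (cinner u (blinfun_apply r v) - cinner u (blinfun_apply (a o\<^sub>L b) v)) < e"
  proof (intro bexI[of _ "s o\<^sub>L t"] sub_mult s t, clarify)
    fix u v assume p: "(u, v) \<in> F"
    have adj: "cinner u (blinfun_apply s z) = cinner (blinfun_apply s' u) z" for z
      using is_adjointD[OF is_adjoint_commute[OF s']] by simp
    have 1: "cmod (cinner (blinfun_apply s' u) (blinfun_apply t v) - cinner (blinfun_apply s' u) (blinfun_apply b v)) < e / 2"
      using t(2) p by fastforce
    have 2: "cmod (cinner u (blinfun_apply s (blinfun_apply b v)) - cinner u (blinfun_apply a (blinfun_apply b v))) < e / 2"
      using s(2) p by fastforce
    have "cmod ((cinner (blinfun_apply s' u) (blinfun_apply t v) - cinner (blinfun_apply s' u) (blinfun_apply b v))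
        + (cinner u (blinfun_apply s (blinfun_apply b v)) - cinner u (blinfun_apply a (blinfun_apply b v)))) < e / 2 + e / 2"
      using 1 2 by (rule norm_add_less)
    then show "cmod (cinner u (blinfun_apply (s o\<^sub>L t) v) - cinner u (blinfun_apply (a o\<^sub>L b) v)) < e"
      by (simp add: adj)
  qed
qed

lemma closure_adj:
  assumes a: "a \<in> C" and ab: "is_adjoint a b" shows "b \<in> C"
  unfolding wot_closure_iff
proof (intro allI impI)
  fix F :: "('h \<times> 'h) set" and e :: real
  assume F: "finite F \<and> e > 0"
  then have F': "finite (prod.swap ` F)" and e: "e > 0" by simp_all
  obtain s where s: "s \<in> S" "\<forall>(u, v)\<in>prod.swap ` F.
      cmod (cinner u (blinfun_apply s v) - cinner u (blinfun_apply a v)) < e"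
    by (rule wot_closureD[OF a F' e])
  obtain s' where s': "s' \<in> S" "is_adjoint s s'" using sub_adj s(1) by blast
  show "\<exists>r\<in>S. \<forall>(u, v)\<in>F. cmod (cinner u (blinfun_apply r v) - cinner u (blinfun_apply b v)) < e"
  proof (intro bexI[of _ s'] s', clarify)
    fix u v assume p: "(u, v) \<in> F"
    have eq: "cinner u (blinfun_apply d v) = cnj (cinner v (blinfun_apply c u))" if "is_adjoint c d" for c d
      using is_adjointD[OF that, of u v] cinner_commute[of "blinfun_apply c u" v] by simp
    have "cmod (cnj (cinner v (blinfun_apply s u) - cinner v (blinfun_apply a u))) < e"
      unfolding complex_mod_cnj using s(2) p by fastforce
    then show "cmod (cinner u (blinfun_apply s' v) - cinner u (blinfun_apply b v)) < e"
      by (simp add: eq[OF s'(2)] eq[OF ab])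
  qed
qed

end

lemma is_adjoint_intros:
  "is_adjoint 0 0"
  "is_adjoint a a' \<Longrightarrow> is_adjoint b b' \<Longrightarrow> is_adjoint (a + b) (a' + b')"
  "is_adjoint a a' \<Longrightarrow> is_adjoint (c *\<^sub>C a) (cnj c *\<^sub>C a')"
  "is_adjoint a a' \<Longrightarrow> is_adjoint b b' \<Longrightarrow> is_adjoint (a o\<^sub>L b) (b' o\<^sub>L a')"
  by (simp_all add: is_adjoint_def plus_blinfun.rep_eq scaleC_blinfun.rep_eq cinner_add_left
      cinner_add_right cinner_scaleC_left cinner_scaleC_right cinner.zero_left cinner.zero_right)

lemma star_subalgebra_nonunital:
  assumes "\<And>a. a \<in> S \<Longrightarrow> selfadjoint_op a"
  shows "star_subalgebra (nonunital_algebra S)"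
proof
  fix a assume "a \<in> nonunital_algebra S"
  then show "\<exists>b\<in>nonunital_algebra S. is_adjoint a b"
    by induction (blast intro: assms nonunital_algebra.intros is_adjoint_intros)+
qed (rule nonunital_algebra.intros; assumption)+

lemma vN_generated_subset_closure:
  assumes sa: "\<And>a. a \<in> S \<Longrightarrow> selfadjoint_op a" and SB: "S \<subseteq> vN_generated S"
    and B: "vN_generated S \<subseteq> cbounded_ops" "id_blinfun \<in> vN_generated S"
      "\<And>a b. a \<in> vN_generated S \<Longrightarrow> b \<in> vN_generated S \<Longrightarrow> a + b \<in> vN_generated S"
      "\<And>a b. a \<in> vN_generated S \<Longrightarrow> b \<in> vN_generated S \<Longrightarrow> a o\<^sub>L b \<in> vN_generated S"
      "\<And>a c. a \<in> vN_generated S \<Longrightarrow> c *\<^sub>C a \<in> vN_generated S"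
      "\<And>a. a \<in> vN_generated S \<Longrightarrow> \<exists>b\<in>vN_generated S. is_adjoint a b"
    and one: "id_blinfun \<in> weak_operator_topology closure_of nonunital_algebra S"
  shows "vN_generated S \<subseteq> weak_operator_topology closure_of nonunital_algebra S"
proof -
  interpret star_subalgebra "nonunital_algebra S" by (rule star_subalgebra_nonunital[OF sa])
  have "closedin weak_operator_topology (vN_generated S)"
  proof (cases "{M. von_neumann_algebra M \<and> S \<subseteq> M} = {}")
    case True
    then show ?thesis unfolding vN_generated_def True
      using closedin_topspace[of weak_operator_topology] by simp
  next
    case False
    then show ?thesis
      unfolding vN_generated_def by (intro closedin_Inter) (auto simp: von_neumann_algebra_def)
  qed
  then have cl: "closedin weak_operator_topology (vN_generated S \<inter> C)"
    by (intro closedin_Int closedin_closure_of)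
  have "von_neumann_algebra (vN_generated S \<inter> C)"
    unfolding von_neumann_algebra_def
  proof (intro conjI ballI allI cl)
    show "vN_generated S \<inter> C \<subseteq> cbounded_ops" using B(1) by blast
    show "id_blinfun \<in> vN_generated S \<inter> C" using B(2) one by blast
    show "a + b \<in> vN_generated S \<inter> C" "a o\<^sub>L b \<in> vN_generated S \<inter> C"
      if "a \<in> vN_generated S \<inter> C" "b \<in> vN_generated S \<inter> C" for a b
      using that B(3,4) closure_add closure_mult by blast+
    show "c *\<^sub>C a \<in> vN_generated S \<inter> C" if "a \<in> vN_generated S \<inter> C" for a c
      using that B(5) closure_scale by blast
    show "\<exists>b\<in>vN_generated S \<inter> C. is_adjoint a b" if "a \<in> vN_generated S \<inter> C" for a
      using that B(6)[of a] closure_adj by blast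
  qed
  moreover have "S \<subseteq> C"
    using closure_of_subset[of "nonunital_algebra S" weak_operator_topology]
    by (auto intro: nonunital_algebra.gen)
  ultimately have "vN_generated S \<inter> C \<in> {M. von_neumann_algebra M \<and> S \<subseteq> M}"
    using SB by blast
  then show ?thesis unfolding vN_generated_def by blast
qed

lemma closure_range_comb:
  assumes cb: "\<And>i. y i \<in> cbounded_ops"
    and cyclic: "closure ((\<lambda>a. blinfun_apply a \<xi>) ` B) = UNIV"
    and B: "B \<subseteq> weak_operator_topology closure_of nonunital_algebra (range y)"
  shows "closure (range (comb (word_vector y \<xi>))) = UNIV"
proof -
  let ?V = "range (comb (word_vector y \<xi>))"
  have "blinfun_apply a \<xi> \<in> closure ?V" if a: "a \<in> B" for a
  proof (rule in_closure_if_orthogonal)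
    show "0 \<in> ?V" by (rule range_eqI[of _ _ "[]"]) simp
    show "u + v \<in> ?V" if "u \<in> ?V" "v \<in> ?V" for u v
      using that by (auto simp flip: comb_append)
    show "c *\<^sub>C v \<in> ?V" if "v \<in> ?V" for c v
      using that by (auto simp flip: comb_scale)
    fix z assume z: "\<And>v. v \<in> ?V \<Longrightarrow> cinner z v = 0"
    show "cinner z (blinfun_apply a \<xi>) = 0"
    proof (rule complex_eqI_small)
      fix e :: real assume e: "e > 0"
      have a': "a \<in> weak_operator_topology closure_of nonunital_algebra (y ` UNIV)"
        using a B by blast
      have fin: "finite {(z, \<xi>)}" by simp
      obtain b where b: "b \<in> nonunital_algebra (y ` UNIV)"
        "\<forall>(u, v)\<in>{(z, \<xi>)}. cmod (cinner u (blinfun_apply b v) - cinner u (blinfun_apply a v)) < e"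
        by (rule wot_closureD[OF a' fin e])
      obtain L where "b = comb (word_product y) L"
        using nonunital_algebra_expand[OF cb b(1)] by blast
      then have "blinfun_apply b \<xi> = comb (word_vector y \<xi>) L"
        by (simp add: blinfun_apply_comb word_vector_def[abs_def])
      then have "cinner z (blinfun_apply b \<xi>) = 0" using z by simp
      then show "cmod (cinner z (blinfun_apply a \<xi>) - 0) \<le> 1 * e" using b(2) by simp
    qed
  qed
  then have "(\<lambda>a. blinfun_apply a \<xi>) ` B \<subseteq> closure ?V" by blast
  then have "closure ((\<lambda>a. blinfun_apply a \<xi>) ` B) \<subseteq> closure ?V"
    by (rule closure_minimal) simp
  then show ?thesis using cyclic by blast
qed

theorem corollary9p3:
  fixes A :: "('h::chilbert_space \<Rightarrow>\<^sub>L 'h) set"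
    and \<phi> :: "('h \<Rightarrow>\<^sub>L 'h) \<Rightarrow> complex"
    and \<pi> :: "('h \<Rightarrow>\<^sub>L 'h) \<Rightarrow> ('k::chilbert_space \<Rightarrow>\<^sub>L 'k)"
    and \<xi> :: 'k
    and x :: "int \<Rightarrow> ('h \<Rightarrow>\<^sub>L 'h)"
  assumes "von_neumann_algebra A"
    and "normal_state_on A \<phi>"
    and "nondegenerated A \<phi>"
    and "GNS_representation A \<phi> \<pi> \<xi>"
    and "\<And>i. x i \<in> A" and "\<And>i. selfadjoint_op (x i)"
    and "\<pi> ` A = vN_generated (range (\<pi> \<circ> x))"
    and "id_blinfun \<in> weak_operator_topology closure_of nonunital_algebra (range (\<pi> \<circ> x))"
    and "boolean_spreadable \<phi> x"
  shows "positive_tail_algebra (\<pi> \<circ> x) = negative_tail_algebra (\<pi> \<circ> x)"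
proof -
  let ?y = "\<pi> \<circ> x"
  note x = assms(5)
  have A: "A \<subseteq> cbounded_ops" "id_blinfun \<in> A"
    and A_add: "\<And>a b. a \<in> A \<Longrightarrow> b \<in> A \<Longrightarrow> a + b \<in> A"
    and A_mult: "\<And>a b. a \<in> A \<Longrightarrow> b \<in> A \<Longrightarrow> a o\<^sub>L b \<in> A"
    and A_scale: "\<And>a c. a \<in> A \<Longrightarrow> c *\<^sub>C a \<in> A"
    and A_adj: "\<And>a. a \<in> A \<Longrightarrow> \<exists>b\<in>A. is_adjoint a b"
    using assms(1) unfolding von_neumann_algebra_def by blast+
  have pi_cb: "\<And>a. a \<in> A \<Longrightarrow> \<pi> a \<in> cbounded_ops" and pi_one: "\<pi> id_blinfun = id_blinfun"
    and pi_add: "\<And>a b. a \<in> A \<Longrightarrow> b \<in> A \<Longrightarrow> \<pi> (a + b) = \<pi> a + \<pi> b"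
    and pi_mult: "\<And>a b. a \<in> A \<Longrightarrow> b \<in> A \<Longrightarrow> \<pi> (a o\<^sub>L b) = \<pi> a o\<^sub>L \<pi> b"
    and pi_scale: "\<And>a c. a \<in> A \<Longrightarrow> \<pi> (c *\<^sub>C a) = c *\<^sub>C \<pi> a"
    and pi_adj: "\<And>a b. a \<in> A \<Longrightarrow> b \<in> A \<Longrightarrow> is_adjoint a b \<Longrightarrow> is_adjoint (\<pi> a) (\<pi> b)"
    and cyclic: "closure ((\<lambda>a. blinfun_apply (\<pi> a) \<xi>) ` A) = UNIV"
    and phi: "\<And>a. a \<in> A \<Longrightarrow> \<phi> a = cinner \<xi> (blinfun_apply (\<pi> a) \<xi>)"
    using assms(4) unfolding GNS_representation_def by blast+
  have y_cb: "?y i \<in> cbounded_ops" for i using pi_cb x by simp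
  have y_sa: "selfadjoint_op (?y i)" for i using pi_adj[OF x x assms(6)] by simp
  have word: "word_product x u \<in> A \<and> \<pi> (word_product x u) = word_product ?y u" for u
    by (induction u) (simp_all add: A pi_one pi_mult A_mult x)
  have mom: "\<phi> (word_product x u) = cinner \<xi> (word_vector ?y \<xi> u)" for u
    using phi[of "word_product x u"] word[of u] by (simp add: word_vector_def)
  have "vN_generated (range ?y) \<subseteq> weak_operator_topology closure_of nonunital_algebra (range ?y)"
  proof (rule vN_generated_subset_closure[OF _ _ _ _ _ _ _ _ assms(8)], unfold assms(7)[symmetric])
    show "range ?y \<subseteq> \<pi> ` A" using x by auto
    show "\<pi> ` A \<subseteq> cbounded_ops" using pi_cb by blast
    show "id_blinfun \<in> \<pi> ` A" using pi_one A(2) by (metis imageI)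
    show "a + b \<in> \<pi> ` A" "a o\<^sub>L b \<in> \<pi> ` A" if "a \<in> \<pi> ` A" "b \<in> \<pi> ` A" for a b
      using that pi_add pi_mult A_add A_mult by (metis (no_types, lifting) imageE imageI)+
    show "c *\<^sub>C a \<in> \<pi> ` A" if "a \<in> \<pi> ` A" for a c
      using that pi_scale A_scale by (metis (no_types, lifting) imageE imageI)
    show "\<exists>b\<in>\<pi> ` A. is_adjoint a b" if "a \<in> \<pi> ` A" for a
      using that pi_adj A_adj by blast
  qed (use y_sa in auto)
  then have gen: "\<pi> ` A \<subseteq> weak_operator_topology closure_of nonunital_algebra (range ?y)"
    by (simp only: assms(7))
  interpret word_system ?y \<xi>
  proof
    show "closure (range (comb (word_vector ?y \<xi>))) = UNIV"
      by (rule closure_range_comb[OF y_cb _ gen]) (simp add: image_image cyclic)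
    show "?y i \<in> cbounded_ops" "selfadjoint_op (?y i)" for i by (rule y_cb y_sa)+
    show "4 * cinner \<xi> (word_vector ?y \<xi> (v @ c @ w)) =
        cinner \<xi> (word_vector ?y \<xi> (map f v @ map f c @ map f w)) +
        cinner \<xi> (word_vector ?y \<xi> (map f v @ map f c @ map g w)) +
        cinner \<xi> (word_vector ?y \<xi> (map g v @ map f c @ map f w)) +
        cinner \<xi> (word_vector ?y \<xi> (map g v @ map f c @ map g w))"
      if "strict_mono f" "\<And>j. j \<le> f j" "\<And>j. f j \<le> j + M"
        "strict_mono g" "\<And>j. j \<le> g j" "\<And>j. g j \<le> j + M"
        "\<And>j. j \<in> set c \<Longrightarrow> f j = g j" "(set v \<union> set w) \<inter> set c = {}" "c \<noteq> []"
      for f g :: "int \<Rightarrow> int" and M v w c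
    proof (rule boolean_spreadable_moments[OF assms(9) _ that])
      show "x i \<in> cbounded_ops" for i using A(1) x by blast
      show "cinner \<xi> (word_vector ?y \<xi> u) = \<phi> (word_product x u)" for u
        by (rule mom[symmetric])
    qed
  qed
  show ?thesis by (rule tail_algebras_eq)
qed

end
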